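(* Fix $m\in\mathbb Z$. For $N\ge1$ let $N_2\in\{0,1\}$ be the residue of $N$ mod $2$. There are complex numbers $d_{m,j}(a)$ ($j\ge0$, $a\in\{0,1\}$), depending only on $m,j,a$, with $$d_{m,0}(a)=-\frac{\sqrt2}{\pi i}\Big(\frac{-2}{z_0}\Big)^{m}e^{-z_0/2}\big(1+(-1)^{a}e^{z_0/2}\big)^{1/2}$$ (principal square root), such that for every integer $r\ge1$ and all integers $N\ge1$, $$A_m(-1,N)=\mathrm{Re}\Big[\frac{w_0^{-N/2}}{N^{1-m}}\Big(d_{m,0}(N_2)+\frac{d_{m,1}(N_2)}{N}+\dots+\frac{d_{m,r-1}(N_2)}{N^{r-1}}\Big)\Big]+O\Big(\frac{|w_0|^{-N/2}}{N^{r+1-m}}\Big),$$ with implied constant depending only on $m$ and $r$.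
   Context: $(q)_N:=(1-q)(1-q^2)\cdots(1-q^N)$. For a primitive $k$th root of unity $\xi$, the numbers $A_m(\xi,N)$ are the coefficients of the Laurent expansion $1/(q)_N=\sum_{m\ge -\lfloor N/k\rfloor}A_m(\xi,N)(q-\xi)^m$ about $q=\xi$. $\mathrm{Li}_2$ denotes the dilogarithm ($\mathrm{Li}_2(w)=\sum_{n\ge1}w^n/n^2$ for $|w|\le1$, continued analytically to $\mathbb C\setminus[1,\infty)$). $w_0$ is the solution of $\mathrm{Li}_2(w)-2\pi i\log w=0$ (principal branches), numerically $w_0\approx 0.91619782-0.18245890i$, and $z_0:=2\pi i+\log(1-w_0)\approx -1.6055276+7.4234262i$ (principal logarithm). Complex powers $w^{\tau}$ mean $e^{\tau\log w}$ with the principal logarithm. *)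

theory Defs
  imports "HOL-Complex_Analysis.Complex_Analysis"
begin

definition qpoch :: "nat \<Rightarrow> complex \<Rightarrow> complex" where
  "qpoch N q = (\<Prod>k=1..N. 1 - q ^ k)"

definition A_coeff :: "int \<Rightarrow> complex \<Rightarrow> nat \<Rightarrow> complex" where
  "A_coeff m \<xi> N = fls_nth (laurent_expansion (\<lambda>q. inverse (qpoch N q)) \<xi>) m"

text \<open>Dilogarithm on C minus [1,inf): Li2(w) = - integral from 0 to w of Ln(1-u)/u du
  along the straight segment (this is the analytic continuation of the power series
  sum w^n/n^2).\<close>
definition Li2 :: "complex \<Rightarrow> complex" where
  "Li2 w = contour_integral (linepath 0 w) (\<lambda>u. - Ln (1 - u) / u)"

end

theory Submission
  imports Defs "HOL-Probability.Distributions" "HOL-Real_Asymp.Real_Asymp"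
begin

text \<open>
  Substituting \<open>q = - exp (x / N)\<close> turns \<open>A_coeff m (-1) N\<close> into a contour integral around \<open>x = 0\<close>.
  Splitting \<open>qpoch N q\<close> into its even and odd factors, the logarithm of each product is a Riemann sum of
  a function that is holomorphic on the half plane \<open>Re x < 0\<close> together with the strip \<open>\<bar>Im x\<bar> < pi\<close>; this gives
  \<open>1 / qpoch N q = exp (N * phase x) * amplitude / sqrt N\<close>, where the amplitude has an expansion in
  powers of \<open>1 / N\<close> whose coefficients depend on the parity of \<open>N\<close>. The derivative of \<open>x * phase x\<close>
  is \<open>- Ln (1 - exp (2 * x)) / 2\<close>, so \<open>4 * x * phase x\<close> is a dilogarithm, and the equation for \<open>w0\<close> says that
  \<open>x0 = z0 / 2\<close> is a saddle point of \<open>phase\<close>, with \<open>phase x0 = - Ln w0 / 2\<close>.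

  The contour consists of a piece of the ray through \<open>x0\<close>, its complex conjugate, and pieces
  joining them. Along the ray \<open>Re phase\<close> has a strict maximum at \<open>x0\<close>, so Laplace's method
  expands its contribution; on the joining pieces the exponential growth rate is at most \<open>1/30\<close>, which is smaller than
  \<open>Re (phase x0) = - ln \<bar>w0\<bar> / 2\<close>. Conjugation symmetry produces the real part.
\<close>

section \<open>Locally uniform asymptotic expansions\<close>

text \<open>At \<open>q = -1\<close> the even factors of \<open>qpoch N q\<close> vanish and the odd
  ones equal 2. With \<open>q = - exp (x / N)\<close> the factor \<open>- u\<close> is divided out
  of each even factor \<open>1 - exp u\<close>. This leaves logarithms holomorphic at 0, but also a
  power of \<open>x\<close> and a factorial, so Stirling's expansion has to be fed in. There are
  \<open>N div 2\<close> even factors, hence the last sample point of the even Riemann sum stops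
  short of \<open>x\<close> when \<open>N\<close> is odd. This is why all expansions run along a
  filter: it is later one residue class mod 2, and the two classes are joined only at the end. The
  obstacle is that \<open>x0\<close> lies outside the strip, at height
  \<open>pi + \<theta> / 2\<close> with \<open>\<theta>\<close> the argument of
  \<open>1 - w0\<close>, while the poles other than 0 sit on the imaginary axis at height at least
  \<open>pi\<close>. A loop around 0 crosses the axis below them and can reach \<open>x0\<close>
  only through the left half plane, where the principal \<open>Ln (- x)\<close> is available. The
  comparison on the joining pieces has little room: \<open>1/30 = 0.0333...\<close> is played
  against the proved value 0.0334 at the saddle. The numerical lemmas are shaped by this narrow
  gap.\<close>

definition unif_O :: "nat filter \<Rightarrow> complex set \<Rightarrow> nat \<Rightarrow> (nat \<Rightarrow> complex \<Rightarrow> complex) \<Rightarrow> bool" where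
  "unif_O F D r f \<longleftrightarrow> (\<forall>K. compact K \<and> K \<subseteq> D \<longrightarrow>
     (\<exists>C\<ge>0. \<forall>\<^sub>F N in F. \<forall>x\<in>K. norm (f N x) \<le> C / real N ^ r))"

lemma unif_OI:
  assumes "\<And>K. compact K \<Longrightarrow> K \<subseteq> D \<Longrightarrow> \<exists>C. \<forall>\<^sub>F N in F. \<forall>x\<in>K. norm (f N x) \<le> C / real N ^ r"
  shows "unif_O F D r f"
  unfolding unif_O_def
proof (intro allI impI)
  fix K assume "compact K \<and> K \<subseteq> D"
  then obtain C where C: "\<forall>\<^sub>F N in F. \<forall>x\<in>K. norm (f N x) \<le> C / real N ^ r"
    using assms by blast
  have "\<forall>\<^sub>F N in F. \<forall>x\<in>K. norm (f N x) \<le> \<bar>C\<bar> / real N ^ r"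
    using C by eventually_elim (smt (verit) divide_right_mono of_nat_0_le_iff zero_le_power)
  thus "\<exists>C\<ge>0. \<forall>\<^sub>F N in F. \<forall>x\<in>K. norm (f N x) \<le> C / real N ^ r"
    by (intro exI[of _ "\<bar>C\<bar>"]) auto
qed

lemma unif_OE:
  assumes "unif_O F D r f" "compact K" "K \<subseteq> D"
  obtains C where "C \<ge> 0" "\<forall>\<^sub>F N in F. \<forall>x\<in>K. norm (f N x) \<le> C / real N ^ r"
  using assms unfolding unif_O_def by blast

lemma unif_O_add:
  assumes "unif_O F D r f" "unif_O F D r g"
  shows "unif_O F D r (\<lambda>N x. f N x + g N x)"
proof (rule unif_OI)
  fix K assume K: "compact K" "K \<subseteq> D"
  obtain C where C: "\<forall>\<^sub>F N in F. \<forall>x\<in>K. norm (f N x) \<le> C / real N ^ r"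
    using unif_OE[OF assms(1) K] by blast
  obtain C' where C': "\<forall>\<^sub>F N in F. \<forall>x\<in>K. norm (g N x) \<le> C' / real N ^ r"
    using unif_OE[OF assms(2) K] by blast
  have "\<forall>\<^sub>F N in F. \<forall>x\<in>K. norm (f N x + g N x) \<le> (C + C') / real N ^ r"
    using C C' by eventually_elim (auto simp: add_divide_distrib intro!: norm_triangle_le add_mono)
  thus "\<exists>C. \<forall>\<^sub>F N in F. \<forall>x\<in>K. norm (f N x + g N x) \<le> C / real N ^ r" ..
qed

lemma unif_O_mult:
  assumes "unif_O F D r f" "unif_O F D s g"
  shows "unif_O F D (r + s) (\<lambda>N x. f N x * g N x)"
proof (rule unif_OI)
  fix K assume K: "compact K" "K \<subseteq> D"
  obtain C where C: "C \<ge> 0" "\<forall>\<^sub>F N in F. \<forall>x\<in>K. norm (f N x) \<le> C / real N ^ r"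
    using unif_OE[OF assms(1) K] by blast
  obtain C' where C': "C' \<ge> 0" "\<forall>\<^sub>F N in F. \<forall>x\<in>K. norm (g N x) \<le> C' / real N ^ s"
    using unif_OE[OF assms(2) K] by blast
  have "\<forall>\<^sub>F N in F. \<forall>x\<in>K. norm (f N x * g N x) \<le> (C * C') / real N ^ (r + s)"
    using C(2) C'(2)
  proof eventually_elim
    case (elim N)
    show ?case
    proof
      fix x assume x: "x \<in> K"
      have "norm (f N x) * norm (g N x) \<le> (C / real N ^ r) * (C' / real N ^ s)"
        using elim x C(1) by (intro mult_mono) auto
      thus "norm (f N x * g N x) \<le> (C * C') / real N ^ (r + s)"
        by (simp add: norm_mult power_add)
    qed
  qed
  thus "\<exists>C. \<forall>\<^sub>F N in F. \<forall>x\<in>K. norm (f N x * g N x) \<le> C / real N ^ (r + s)" ..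
qed

lemma unif_O_mono:
  assumes "unif_O F D r f" "s \<le> r" "F \<le> sequentially"
  shows "unif_O F D s f"
proof (rule unif_OI)
  fix K assume K: "compact K" "K \<subseteq> D"
  obtain C where C: "C \<ge> 0" "\<forall>\<^sub>F N in F. \<forall>x\<in>K. norm (f N x) \<le> C / real N ^ r"
    using unif_OE[OF assms(1) K] by blast
  have ev: "\<forall>\<^sub>F N in F. N \<ge> 1"
    using assms(3) eventually_ge_at_top[of 1] by (auto simp: le_filter_def)
  have "\<forall>\<^sub>F N in F. \<forall>x\<in>K. norm (f N x) \<le> C / real N ^ s"
    using C(2) ev
  proof eventually_elim
    case (elim N)
    have "C / real N ^ r \<le> C / real N ^ s"
      using elim(2) C(1) assms(2) by (intro divide_left_mono power_increasing) auto
    thus ?case using elim(1) by force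
  qed
  thus "\<exists>C. \<forall>\<^sub>F N in F. \<forall>x\<in>K. norm (f N x) \<le> C / real N ^ s" ..
qed

lemma unif_O_subset:
  assumes "unif_O F D r f" "E \<subseteq> D"
  shows "unif_O F E r f"
  using assms unfolding unif_O_def by blast

lemma unif_O_cong:
  assumes "unif_O F D r f" "\<forall>\<^sub>F N in F. \<forall>x\<in>D. f N x = g N x"
  shows "unif_O F D r g"
proof (rule unif_OI)
  fix K assume K: "compact K" "K \<subseteq> D"
  obtain C where C: "\<forall>\<^sub>F N in F. \<forall>x\<in>K. norm (f N x) \<le> C / real N ^ r"
    using unif_OE[OF assms(1) K] by blast
  have "\<forall>\<^sub>F N in F. \<forall>x\<in>K. norm (g N x) \<le> C / real N ^ r"
    using C assms(2) by eventually_elim (use K in \<open>metis subsetD\<close>)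
  thus "\<exists>C. \<forall>\<^sub>F N in F. \<forall>x\<in>K. norm (g N x) \<le> C / real N ^ r" ..
qed

lemma unif_O_const:
  assumes "continuous_on D h"
  shows "unif_O F D 0 (\<lambda>N. h)"
proof (rule unif_OI)
  fix K assume K: "compact K" "K \<subseteq> D"
  have "bounded (h ` K)"
    by (intro compact_imp_bounded compact_continuous_image continuous_on_subset[OF assms] K)
  then obtain C where "\<forall>x\<in>K. norm (h x) \<le> C"
    by (auto simp: bounded_iff)
  thus "\<exists>C. \<forall>\<^sub>F N in F. \<forall>x\<in>K. norm (h x) \<le> C / real N ^ 0" by (intro exI[of _ C]) simp
qed

lemma unif_O_inverse_N: "unif_O F D 1 (\<lambda>N x. 1 / of_nat N)"
  by (rule unif_OI, rule exI[of _ 1]) (auto simp: norm_divide)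

lemma unif_O_zero: "unif_O F D r (\<lambda>N x. 0)"
  by (rule unif_OI, rule exI[of _ 0]) auto

lemma unif_O_diff:
  assumes "unif_O F D r f" "unif_O F D r g"
  shows "unif_O F D r (\<lambda>N x. f N x - g N x)"
proof -
  have "unif_O F D (0 + r) (\<lambda>N x. -1 * g N x)"
    by (intro unif_O_mult unif_O_const assms continuous_intros)
  thus ?thesis using unif_O_add[OF assms(1)] by fastforce
qed

text \<open>Polynomials in \<open>1 / N\<close> with coefficients holomorphic on \<open>D\<close>; the last argument records the constant coefficient.\<close>

inductive lpoly :: "complex set \<Rightarrow> (nat \<Rightarrow> complex \<Rightarrow> complex) \<Rightarrow> (complex \<Rightarrow> complex) \<Rightarrow> bool"
  for D where
  const: "h holomorphic_on D \<Longrightarrow> lpoly D (\<lambda>N. h) h"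
| shift: "lpoly D g c \<Longrightarrow> lpoly D (\<lambda>N x. g N x / of_nat N) (\<lambda>x. 0)"
| add: "lpoly D g c \<Longrightarrow> lpoly D g' c' \<Longrightarrow> lpoly D (\<lambda>N x. g N x + g' N x) (\<lambda>x. c x + c' x)"

lemma lpoly_holomorphic:
  "lpoly D g c \<Longrightarrow> c holomorphic_on D \<and> (\<forall>N. g N holomorphic_on D)"
proof (induction rule: lpoly.induct)
  case (shift g c)
  have "(\<lambda>x. g N x * inverse (of_nat N)) holomorphic_on D" for N
    using shift by (intro holomorphic_intros) auto
  thus ?case by (simp add: field_simps)
qed (auto intro!: holomorphic_intros)

lemma lpoly_subset: "lpoly D g c \<Longrightarrow> E \<subseteq> D \<Longrightarrow> lpoly E g c"
  by (induction rule: lpoly.induct) (auto intro: lpoly.intros holomorphic_on_subset)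

lemma lpoly_unif_O:
  assumes "lpoly D g c"
  shows "unif_O F D 0 g" "unif_O F D 1 (\<lambda>N x. g N x - c x)"
proof -
  have **: "unif_O F D 0 g \<and> unif_O F D 1 (\<lambda>N x. g N x - c x)"
    using assms
  proof (induction rule: lpoly.induct)
    case (const h)
    thus ?case using unif_O_const[OF holomorphic_on_imp_continuous_on, of h D]
      by (auto intro: unif_O_zero)
  next
    case (shift g c)
    have 1: "unif_O F D (0 + 1) (\<lambda>N x. g N x * (1 / of_nat N))"
      using shift by (intro unif_O_mult unif_O_inverse_N) auto
    have "unif_O F D 0 (\<lambda>N x. 1 / of_nat N)"
      by (rule unif_OI, rule exI[of _ 1], rule always_eventually) (auto simp: norm_divide divide_le_eq_1)
    hence "unif_O F D (0 + 0) (\<lambda>N x. g N x * (1 / of_nat N))"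
      using shift by (intro unif_O_mult) auto
    thus ?case using 1 by simp
  next
    case (add g c g' c')
    have "unif_O F D 1 (\<lambda>N x. (g N x - c x) + (g' N x - c' x))"
      using add by (intro unif_O_add) auto
    thus ?case using add by (auto intro: unif_O_add simp: algebra_simps)
  qed
  show "unif_O F D 0 g" "unif_O F D 1 (\<lambda>N x. g N x - c x)" using ** by auto
qed

lemma lpoly_cmult:
  "lpoly D g c \<Longrightarrow> h holomorphic_on D \<Longrightarrow> lpoly D (\<lambda>N x. h x * g N x) (\<lambda>x. h x * c x)"
proof (induction rule: lpoly.induct)
  case (const k)
  thus ?case using lpoly.const[of "\<lambda>x. h x * k x" D] by (auto intro: holomorphic_intros)
next
  case (shift g c)
  thus ?case using lpoly.shift[of D "\<lambda>N x. h x * g N x"] by simp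
next
  case (add g c g' c')
  thus ?case using lpoly.add[of D "\<lambda>N x. h x * g N x" "\<lambda>x. h x * c x" "\<lambda>N x. h x * g' N x" "\<lambda>x. h x * c' x"]
    by (simp add: ring_distribs)
qed

lemma lpoly_mult:
  assumes "lpoly D g c" "lpoly D g' c'"
  shows "lpoly D (\<lambda>N x. g N x * g' N x) (\<lambda>x. c x * c' x)"
  using assms(1)
proof (induction rule: lpoly.induct)
  case (const h)
  thus ?case using lpoly_cmult[OF assms(2)] by simp
next
  case (shift g c)
  thus ?case using lpoly.shift[of D "\<lambda>N x. g N x * g' N x"] by simp
next
  case (add g1 c1 g2 c2)
  thus ?case using lpoly.add[of D "\<lambda>N x. g1 N x * g' N x" "\<lambda>x. c1 x * c' x" "\<lambda>N x. g2 N x * g' N x" "\<lambda>x. c2 x * c' x"]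
    by (simp add: ring_distribs)
qed

text \<open>At a fixed point the inductive shape becomes a finite list of coefficients. The range
  \<open>Suc m\<close> keeps index 0 in the sum, which ties the first coefficient to
  \<open>c x\<close>.\<close>

lemma lpoly_coeffs:
  assumes "lpoly D g c"
  shows "\<exists>m e. e 0 = c x \<and> (\<forall>N\<ge>1. g N x = (\<Sum>j<Suc m. e j / of_nat N ^ j))"
  using assms
proof (induction rule: lpoly.induct)
  case (const h)
  show ?case by (rule exI[of _ 0], rule exI[of _ "\<lambda>_. h x"]) auto
next
  case (shift g c)
  then obtain m e where e: "e 0 = c x" "\<forall>N\<ge>1. g N x = (\<Sum>j<Suc m. e j / of_nat N ^ j)" by blast
  show ?case
  proof (rule exI[of _ "Suc m"], rule exI[of _ "\<lambda>j. if j = 0 then 0 else e (j - 1)"], safe)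
    fix N :: nat assume N: "N \<ge> 1"
    have "(\<Sum>j<Suc (Suc m). (if j = 0 then 0 else e (j - 1)) / of_nat N ^ j)
       = (\<Sum>j<Suc m. e j / of_nat N ^ Suc j)"
      by (subst sum.lessThan_Suc_shift) simp
    also have "\<dots> = g N x / of_nat N" using e N
      by (simp add: sum_divide_distrib mult.commute add_divide_distrib)
    finally show "g N x / of_nat N = (\<Sum>j<Suc (Suc m). (if j = 0 then 0 else e (j - 1)) / of_nat N ^ j)" ..
  qed auto
next
  case (add g c g' c')
  then obtain m e m' e' where e: "e 0 = c x" "\<forall>N\<ge>1. g N x = (\<Sum>j<Suc m. e j / of_nat N ^ j)"
    and e': "e' 0 = c' x" "\<forall>N\<ge>1. g' N x = (\<Sum>j<Suc m'. e' j / of_nat N ^ j)" by blast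
  define E where "E j = (if j < Suc m then e j else 0) + (if j < Suc m' then e' j else 0)" for j
  show ?case
  proof (rule exI[of _ "max m m'"], rule exI[of _ E], safe)
    show "E 0 = c x + c' x" using e e' by (simp add: E_def)
    fix N :: nat assume N: "N \<ge> 1"
    have "(\<Sum>j<Suc m. e j / of_nat N ^ j) = (\<Sum>j<Suc (max m m'). (if j < Suc m then e j else 0) / of_nat N ^ j)"
      by (rule sum.mono_neutral_cong_left) auto
    moreover have "(\<Sum>j<Suc m'. e' j / of_nat N ^ j) = (\<Sum>j<Suc (max m m'). (if j < Suc m' then e' j else 0) / of_nat N ^ j)"
      by (rule sum.mono_neutral_cong_left) auto
    ultimately show "g N x + g' N x = (\<Sum>j<Suc (max m m'). E j / of_nat N ^ j)"
      using e e' N by (simp only: E_def add_divide_distrib sum.distrib)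
  qed
qed

text \<open>Only the order \<open>r\<close> and the constant coefficient are recorded; the
  approximating polynomial may change with \<open>r\<close>. This weak form is closed under sums,
  products and \<open>exp\<close> with short proofs, and the coherence of the coefficients is
  recovered once, in \<open>asy_const_imp_expansion\<close>. For \<open>r = 0\<close> the condition
  is mere local boundedness, so there \<open>c\<close> may be any holomorphic function.\<close>

definition asy :: "nat filter \<Rightarrow> complex set \<Rightarrow> nat \<Rightarrow> (nat \<Rightarrow> complex \<Rightarrow> complex) \<Rightarrow> (complex \<Rightarrow> complex) \<Rightarrow> bool" where
  "asy F D r f c \<longleftrightarrow> (\<exists>g. lpoly D g c \<and> unif_O F D r (\<lambda>N x. f N x - g N x))"

lemma asyI: "lpoly D g c \<Longrightarrow> unif_O F D r (\<lambda>N x. f N x - g N x) \<Longrightarrow> asy F D r f c"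
  unfolding asy_def by blast

lemma asy_const: "h holomorphic_on D \<Longrightarrow> asy F D r (\<lambda>N. h) h"
  by (rule asyI[OF lpoly.const]) (auto intro: unif_O_zero)

lemma asy_small: "unif_O F D r f \<Longrightarrow> asy F D r f (\<lambda>_. 0)"
  by (rule asyI[OF lpoly.const]) auto

lemma asy_add:
  assumes "asy F D r f c" "asy F D r f' c'"
  shows "asy F D r (\<lambda>N x. f N x + f' N x) (\<lambda>x. c x + c' x)"
proof -
  obtain g g' where g: "lpoly D g c" "unif_O F D r (\<lambda>N x. f N x - g N x)"
    and g': "lpoly D g' c'" "unif_O F D r (\<lambda>N x. f' N x - g' N x)"
    using assms unfolding asy_def by blast
  show ?thesis
    using unif_O_add[OF g(2) g'(2)] by (intro asyI[OF lpoly.add[OF g(1) g'(1)]]) (simp add: algebra_simps)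
qed

lemma asy_O0:
  assumes "asy F D r f c" "F \<le> sequentially"
  shows "unif_O F D 0 f"
proof -
  obtain g where g: "lpoly D g c" "unif_O F D r (\<lambda>N x. f N x - g N x)"
    using assms unfolding asy_def by blast
  show ?thesis
    using unif_O_add[OF unif_O_mono[OF g(2) _ assms(2)] lpoly_unif_O(1)[OF g(1)]] by simp
qed

lemma asy_mult:
  assumes "asy F D r f c" "asy F D r f' c'" "F \<le> sequentially"
  shows "asy F D r (\<lambda>N x. f N x * f' N x) (\<lambda>x. c x * c' x)"
proof -
  obtain g g' where g: "lpoly D g c" "unif_O F D r (\<lambda>N x. f N x - g N x)"
    and g': "lpoly D g' c'" "unif_O F D r (\<lambda>N x. f' N x - g' N x)"
    using assms unfolding asy_def by blast
  have "unif_O F D (r + 0) (\<lambda>N x. (f N x - g N x) * g' N x)"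
    by (intro unif_O_mult g lpoly_unif_O(1)[OF g'(1)])
  moreover have "unif_O F D (0 + r) (\<lambda>N x. f N x * (f' N x - g' N x))"
    by (intro unif_O_mult g' asy_O0[OF assms(1,3)])
  ultimately have "unif_O F D r (\<lambda>N x. (f N x - g N x) * g' N x + f N x * (f' N x - g' N x))"
    by (intro unif_O_add) auto
  thus ?thesis
    by (intro asyI[OF lpoly_mult[OF g(1) g'(1)]]) (simp add: algebra_simps)
qed

lemma asy_shift:
  assumes "asy F D r f c"
  shows "asy F D (Suc r) (\<lambda>N x. f N x / of_nat N) (\<lambda>_. 0)"
proof -
  obtain g where g: "lpoly D g c" "unif_O F D r (\<lambda>N x. f N x - g N x)"
    using assms unfolding asy_def by blast
  have "unif_O F D (r + 1) (\<lambda>N x. (f N x - g N x) * (1 / of_nat N))"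
    by (intro unif_O_mult g unif_O_inverse_N)
  thus ?thesis by (intro asyI[OF lpoly.shift[OF g(1)]]) (simp add: diff_divide_distrib)
qed

lemma asy_mono:
  assumes "asy F D r f c" "s \<le> r" "F \<le> sequentially"
  shows "asy F D s f c"
  using assms unif_O_mono unfolding asy_def by blast

lemma asy_cong:
  assumes "asy F D r f c" "\<forall>\<^sub>F N in F. \<forall>x\<in>D. f N x = f' N x"
  shows "asy F D r f' c"
proof -
  obtain g where g: "lpoly D g c" "unif_O F D r (\<lambda>N x. f N x - g N x)"
    using assms unfolding asy_def by blast
  have "unif_O F D r (\<lambda>N x. f' N x - g N x)"
    by (rule unif_O_cong[OF g(2)]) (use assms(2) in \<open>eventually_elim, auto\<close>)
  thus ?thesis by (rule asyI[OF g(1)])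
qed

lemma asy_subset:
  assumes "asy F D r f c" "E \<subseteq> D"
  shows "asy F E r f c"
  using assms lpoly_subset unif_O_subset unfolding asy_def by blast

lemma asy_sum:
  assumes "finite A" "\<And>i. i \<in> A \<Longrightarrow> asy F D r (f i) (c i)"
  shows "asy F D r (\<lambda>N x. \<Sum>i\<in>A. f i N x) (\<lambda>x. \<Sum>i\<in>A. c i x)"
  using assms by (induction rule: finite_induct) (auto intro: asy_add asy_const)

lemma asy_power:
  assumes "asy F D r f c" "F \<le> sequentially"
  shows "asy F D r (\<lambda>N x. f N x ^ n) (\<lambda>x. c x ^ n)"
proof (induction n)
  case 0
  show ?case by (simp add: asy_const)
next
  case (Suc n)
  show ?case using asy_mult[OF assms(1) Suc assms(2)] by simp
qed

lemma asy_leading: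
  assumes "asy F D r f c" "r \<ge> 1" "F \<le> sequentially"
  shows "unif_O F D 1 (\<lambda>N x. f N x - c x)"
proof -
  obtain g where g: "lpoly D g c" "unif_O F D r (\<lambda>N x. f N x - g N x)"
    using assms unfolding asy_def by blast
  show ?thesis
    using unif_O_add[OF unif_O_mono[OF g(2) assms(2,3)] lpoly_unif_O(2)[OF g(1)]] by simp
qed

lemma asy_cmult:
  assumes "asy F D r f c" "h holomorphic_on D" "F \<le> sequentially"
  shows "asy F D r (\<lambda>N x. h x * f N x) (\<lambda>x. h x * c x)"
  by (intro asy_mult asy_const assms)

lemma asy_holomorphic: "asy F D r f c \<Longrightarrow> c holomorphic_on D"
  unfolding asy_def using lpoly_holomorphic by blast

text \<open>After division by \<open>exp (c x)\<close> the exponent \<open>u\<close> has leading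
  coefficient 0, hence is \<open>O(1/N)\<close>, and the exponential series cut after
  \<open>r\<close> terms is exact up to \<open>O(1/N ^ r)\<close>. For \<open>r = 0\<close> the
  exponent need not be small, and boundedness is all that is claimed.\<close>

lemma asy_exp:
  assumes "asy F D r f c" "F \<le> sequentially"
  shows "asy F D r (\<lambda>N x. exp (f N x)) (\<lambda>x. exp (c x))"
proof (cases r)
  case 0
  have "unif_O F D 0 (\<lambda>N x. exp (f N x))"
  proof (rule unif_OI)
    fix K assume K: "compact K" "K \<subseteq> D"
    obtain C where C: "C \<ge> 0" "\<forall>\<^sub>F N in F. \<forall>x\<in>K. norm (f N x) \<le> C / real N ^ 0"
      using unif_OE[OF asy_O0[OF assms] K] by blast
    have "\<forall>\<^sub>F N in F. \<forall>x\<in>K. norm (exp (f N x)) \<le> exp C / real N ^ 0"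
      using C(2)
    proof eventually_elim
      case (elim N)
      show ?case
      proof
        fix x assume "x \<in> K"
        hence "norm (exp (f N x)) \<le> exp (norm (f N x))" by (rule_tac norm_exp)
        also have "\<dots> \<le> exp C" using elim \<open>x \<in> K\<close> by simp
        finally show "norm (exp (f N x)) \<le> exp C / real N ^ 0" by simp
      qed
    qed
    thus "\<exists>C. \<forall>\<^sub>F N in F. \<forall>x\<in>K. norm (exp (f N x)) \<le> C / real N ^ 0" ..
  qed
  hence "unif_O F D 0 (\<lambda>N x. exp (f N x) - exp (c x))"
    using asy_holomorphic[OF assms(1)]
    by (intro unif_O_diff unif_O_const holomorphic_on_imp_continuous_on holomorphic_intros) auto
  thus ?thesis using 0 asy_holomorphic[OF assms(1)]
    by (auto intro!: asyI[OF lpoly.const] holomorphic_intros)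
next
  case (Suc n)
  have hol: "c holomorphic_on D" by (rule asy_holomorphic[OF assms(1)])
  define u where "u N x = f N x + (-1) * c x" for N x
  have u: "asy F D r u (\<lambda>x. c x + (-1) * c x)"
    unfolding u_def by (intro asy_add asy_cmult asy_const assms hol holomorphic_intros)
  hence u0: "asy F D r u (\<lambda>x. 0)" by simp
  have uO: "unif_O F D 1 u"
    using asy_leading[OF u0 _ assms(2)] Suc by simp
  have 1: "asy F D r (\<lambda>N x. \<Sum>k\<le>n. (1 / fact k) * u N x ^ k) (\<lambda>x. \<Sum>k\<le>n. (1 / fact k) * 0 ^ k)"
    by (intro asy_sum asy_cmult asy_power u0 assms holomorphic_intros) auto
  have s0: "(\<Sum>k\<le>n. (1 / fact k) * 0 ^ k) = (1::complex)"
  proof -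
    have "(\<Sum>k\<le>n. (1 / fact k) * 0 ^ k) = (\<Sum>k\<in>{0}. (1 / fact k) * (0::complex) ^ k)"
      by (rule sum.mono_neutral_right) auto
    thus ?thesis by simp
  qed
  have 2: "unif_O F D r (\<lambda>N x. exp (u N x) - (\<Sum>k\<le>n. (1 / fact k) * u N x ^ k))"
  proof (rule unif_OI)
    fix K assume K: "compact K" "K \<subseteq> D"
    obtain C where C: "C \<ge> 0" "\<forall>\<^sub>F N in F. \<forall>x\<in>K. norm (u N x) \<le> C / real N ^ 1"
      using unif_OE[OF uO K] by blast
    have ev: "\<forall>\<^sub>F N in F. N \<ge> 1"
      using assms(2) eventually_ge_at_top[of 1] by (auto simp: le_filter_def)
    have "\<forall>\<^sub>F N in F. \<forall>x\<in>K. norm (exp (u N x) - (\<Sum>k\<le>n. (1 / fact k) * u N x ^ k)) \<le> exp C * C ^ r / real N ^ r"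
      using C(2) ev
    proof eventually_elim
      case (elim N)
      show ?case
      proof
        fix x assume "x \<in> K"
        hence ux: "norm (u N x) \<le> C / real N" using elim by simp
        also have "\<dots> \<le> C" using elim C by (simp add: divide_le_eq mult_le_cancel_left1)
        finally have uC: "norm (u N x) \<le> C" .
        have "norm (exp (u N x) - (\<Sum>k\<le>n. u N x ^ k / fact k)) \<le> exp \<bar>Re (u N x)\<bar> * norm (u N x) ^ Suc n / fact n"
          by (rule Taylor_exp)
        also have "\<dots> \<le> exp \<bar>Re (u N x)\<bar> * norm (u N x) ^ Suc n / 1"
          by (intro divide_left_mono) auto
        also have "\<dots> \<le> exp C * (C / real N) ^ Suc n / 1"
          using ux uC abs_Re_le_cmod[of "u N x"]
          by (intro divide_right_mono mult_mono power_mono) auto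
        finally show "norm (exp (u N x) - (\<Sum>k\<le>n. (1 / fact k) * u N x ^ k)) \<le> exp C * C ^ r / real N ^ r"
          using Suc by (simp add: power_divide)
      qed
    qed
    thus "\<exists>C. \<forall>\<^sub>F N in F. \<forall>x\<in>K. norm (exp (u N x) - (\<Sum>k\<le>n. (1 / fact k) * u N x ^ k)) \<le> C / real N ^ r" ..
  qed
  have 3: "asy F D r (\<lambda>N x. (\<Sum>k\<le>n. (1 / fact k) * u N x ^ k) + (exp (u N x) - (\<Sum>k\<le>n. (1 / fact k) * u N x ^ k))) (\<lambda>x. 1 + 0)"
    using asy_add[OF 1 asy_small[OF 2]] s0 by simp
  have "asy F D r (\<lambda>N x. exp (c x) * exp (u N x)) (\<lambda>x. exp (c x) * 1)"
    using 3 by (intro asy_cmult holomorphic_intros hol assms) simp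
  thus ?thesis by (simp add: u_def flip: exp_add)
qed

text \<open>Letting \<open>N\<close> grow along \<open>F\<close> isolates the first coefficient.
  Once it is 0, the whole sum can be multiplied by \<open>N\<close>, which lowers \<open>r\<close>
  by one. Properness of \<open>F\<close> makes the limit unique.\<close>

lemma coeffs_unique:
  fixes e :: "nat \<Rightarrow> complex"
  assumes F: "F \<le> sequentially" "F \<noteq> bot"
    and "\<forall>\<^sub>F N in F. norm (\<Sum>j<r. e j / of_nat N ^ j) \<le> C / real N ^ r"
    and "j < r"
  shows "e j = 0"
  using assms(3,4)
proof (induction r arbitrary: e j)
  case 0
  thus ?case by simp
next
  case (Suc r)
  have ev: "\<forall>\<^sub>F N in F. N \<ge> 1"
    using F eventually_ge_at_top[of 1] by (auto simp: le_filter_def)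
  have lim: "((\<lambda>N. 1 / of_nat N) \<longlongrightarrow> (0::complex)) F"
    using F(1) lim_1_over_n by (rule tendsto_mono)
  have limr: "((\<lambda>N. 1 / real N) \<longlongrightarrow> 0) F"
    using F(1) lim_1_over_n by (rule tendsto_mono)
  have "((\<lambda>N. \<Sum>j<Suc r. e j * (1 / of_nat N) ^ j) \<longlongrightarrow> (\<Sum>j<Suc r. e j * 0 ^ j)) F"
    by (intro tendsto_intros lim)
  moreover have "(\<Sum>j<Suc r. e j * 0 ^ j) = e 0"
    by (subst sum.lessThan_Suc_shift) simp
  ultimately have l1: "((\<lambda>N. \<Sum>j<Suc r. e j / of_nat N ^ j) \<longlongrightarrow> e 0) F"
    by (simp add: power_divide)
  have "((\<lambda>N. C * (1 / real N) ^ Suc r) \<longlongrightarrow> C * 0 ^ Suc r) F"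
    by (intro tendsto_intros limr)
  hence "((\<lambda>N. C / real N ^ Suc r) \<longlongrightarrow> 0) F"
    by (simp add: power_divide)
  hence "((\<lambda>N. \<Sum>j<Suc r. e j / of_nat N ^ j) \<longlongrightarrow> 0) F"
    by (rule Lim_null_comparison[OF Suc.prems(1)])
  hence e0: "e 0 = 0" using l1 F(2) tendsto_unique by blast
  have "\<forall>\<^sub>F N in F. norm (\<Sum>j<r. e (Suc j) / of_nat N ^ j) \<le> C / real N ^ r"
    using Suc.prems(1) ev
  proof eventually_elim
    case (elim N)
    have "(\<Sum>j<Suc r. e j / of_nat N ^ j) = (\<Sum>j<r. e (Suc j) / of_nat N ^ j) / of_nat N"
      by (subst sum.lessThan_Suc_shift) (simp add: e0 sum_divide_distrib mult.commute)
    hence "norm (\<Sum>j<r. e (Suc j) / of_nat N ^ j) / real N \<le> C / real N ^ Suc r"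
      using elim(1) by (simp add: norm_divide)
    thus ?case using elim(2) by (simp add: field_simps)
  qed
  hence "e (Suc i) = 0" if "i < r" for i
    using Suc.IH[of "\<lambda>j. e (Suc j)"] that by blast
  thus ?case using e0 Suc.prems(2) by (cases j) auto
qed

text \<open>Each order \<open>r\<close> comes with its own list of coefficients. Two lists differ by
  a sum that is \<open>O(1/N ^ r)\<close>, so by \<open>coeffs_unique\<close> they agree below
  \<open>r\<close> and glue to one sequence.\<close>

lemma asy_const_imp_expansion:
  fixes a :: "nat \<Rightarrow> complex"
  assumes F: "F \<le> sequentially" "F \<noteq> bot"
    and asy: "\<And>r. asy F UNIV r (\<lambda>N _. a N) (\<lambda>_. c)"
  obtains d where "d 0 = c"
    "\<And>r. \<exists>C. \<forall>\<^sub>F N in F. norm (a N - (\<Sum>j<r. d j / of_nat N ^ j)) \<le> C / real N ^ r"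
proof -
  have ev: "\<forall>\<^sub>F N in F. N \<ge> 1"
    using F eventually_ge_at_top[of 1] by (auto simp: le_filter_def)
  have ex: "\<exists>e. e 0 = c \<and> (\<exists>C. \<forall>\<^sub>F N in F. norm (a N - (\<Sum>j<r. e j / of_nat N ^ j)) \<le> C / real N ^ r)" for r
  proof -
    obtain g where g: "lpoly UNIV g (\<lambda>_. c)" "unif_O F UNIV r (\<lambda>N x. a N - g N x)"
      using asy[of r] unfolding asy_def by blast
    obtain m e where e: "e 0 = c" "\<forall>N\<ge>1. g N 0 = (\<Sum>j<Suc m. e j / of_nat N ^ j)"
      using lpoly_coeffs[OF g(1), of 0] by blast
    define e' where "e' j = (if j < Suc m then e j else 0)" for j
    obtain C where C: "C \<ge> 0" "\<forall>\<^sub>F N in F. \<forall>x\<in>{0}. norm (a N - g N x) \<le> C / real N ^ r"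
      using unif_OE[OF g(2), of "{0}"] by auto
    \<comment> \<open>The polynomial may contain powers beyond \<open>r - 1\<close>; they are moved
      into the error, with \<open>B\<close> bounding their total weight.\<close>
    define B where "B = (\<Sum>j\<in>{r..<r + Suc m}. norm (e' j))"
    have "\<forall>\<^sub>F N in F. norm (a N - (\<Sum>j<r. e' j / of_nat N ^ j)) \<le> (C + B) / real N ^ r"
      using C(2) ev
    proof eventually_elim
      case (elim N)
      have "g N 0 = (\<Sum>j<Suc m. e j / of_nat N ^ j)" using e elim by blast
      also have "\<dots> = (\<Sum>j<r + Suc m. e' j / of_nat N ^ j)"
        by (rule sum.mono_neutral_cong_left) (auto simp: e'_def)
      also have "{..<r + Suc m} = {..<r} \<union> {r..<r + Suc m}" by auto
      also have "(\<Sum>j\<in>{..<r} \<union> {r..<r + Suc m}. e' j / of_nat N ^ j)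
         = (\<Sum>j<r. e' j / of_nat N ^ j) + (\<Sum>j\<in>{r..<r + Suc m}. e' j / of_nat N ^ j)"
        by (rule sum.union_disjoint) auto
      finally have "a N - (\<Sum>j<r. e' j / of_nat N ^ j) = (a N - g N 0) + (\<Sum>j\<in>{r..<r + Suc m}. e' j / of_nat N ^ j)"
        by simp
      also have "norm \<dots> \<le> C / real N ^ r + (\<Sum>j\<in>{r..<r + Suc m}. norm (e' j) / real N ^ r)"
      proof (intro norm_triangle_le add_mono)
        show "norm (a N - g N 0) \<le> C / real N ^ r" using elim by simp
        have "norm (\<Sum>j\<in>{r..<r + Suc m}. e' j / of_nat N ^ j) \<le> (\<Sum>j\<in>{r..<r + Suc m}. norm (e' j / of_nat N ^ j))"
          by (rule norm_sum)
        also have "\<dots> \<le> (\<Sum>j\<in>{r..<r + Suc m}. norm (e' j) / real N ^ r)"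
          using elim by (intro sum_mono) (auto simp: norm_divide norm_power intro!: divide_left_mono power_increasing)
        finally show "norm (\<Sum>j\<in>{r..<r + Suc m}. e' j / of_nat N ^ j) \<le> (\<Sum>j\<in>{r..<r + Suc m}. norm (e' j) / real N ^ r)" .
      qed
      also have "\<dots> = (C + B) / real N ^ r"
        by (simp add: B_def add_divide_distrib sum_divide_distrib)
      finally show ?case .
    qed
    thus ?thesis using e by (intro exI[of _ e']) (auto simp: e'_def)
  qed
  define e where "e r = (SOME e. e 0 = c \<and> (\<exists>C. \<forall>\<^sub>F N in F. norm (a N - (\<Sum>j<r. e j / of_nat N ^ j)) \<le> C / real N ^ r))" for r
  have e: "e r 0 = c" "\<exists>C. \<forall>\<^sub>F N in F. norm (a N - (\<Sum>j<r. e r j / of_nat N ^ j)) \<le> C / real N ^ r" for r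
    using someI_ex[OF ex[of r]] unfolding e_def by auto
  have uniq: "e r j = e s j" if "j < r" "r \<le> s" for r s j
  proof -
    obtain C where C: "\<forall>\<^sub>F N in F. norm (a N - (\<Sum>j<r. e r j / of_nat N ^ j)) \<le> C / real N ^ r" using e by blast
    obtain C' where C': "\<forall>\<^sub>F N in F. norm (a N - (\<Sum>j<s. e s j / of_nat N ^ j)) \<le> C' / real N ^ s" using e by blast
    define B where "B = (\<Sum>j\<in>{r..<s}. norm (e s j))"
    have "\<forall>\<^sub>F N in F. norm (\<Sum>j<r. (e r j - e s j) / of_nat N ^ j) \<le> (C + (\<bar>C'\<bar> + B)) / real N ^ r"
      using C C' ev
    proof eventually_elim
      case (elim N)
      have "(\<Sum>j<s. e s j / of_nat N ^ j) = (\<Sum>j\<in>{..<r} \<union> {r..<s}. e s j / of_nat N ^ j)"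
        using that by (intro sum.cong) auto
      also have "\<dots> = (\<Sum>j<r. e s j / of_nat N ^ j) + (\<Sum>j\<in>{r..<s}. e s j / of_nat N ^ j)"
        by (rule sum.union_disjoint) auto
      finally have "(\<Sum>j<r. (e r j - e s j) / of_nat N ^ j) = - (a N - (\<Sum>j<r. e r j / of_nat N ^ j))
          + ((a N - (\<Sum>j<s. e s j / of_nat N ^ j)) + (\<Sum>j\<in>{r..<s}. e s j / of_nat N ^ j))"
        by (simp only: diff_divide_distrib sum_subtractf minus_diff_eq) (simp only: add_diff_cancel_right' algebra_simps)
      also have "norm \<dots> \<le> C / real N ^ r + (\<bar>C'\<bar> / real N ^ r + (\<Sum>j\<in>{r..<s}. norm (e s j) / real N ^ r))"
      proof (intro norm_triangle_le add_mono)
        show "norm (- (a N - (\<Sum>j<r. e r j / of_nat N ^ j))) \<le> C / real N ^ r" 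
          using elim by (metis norm_minus_cancel)
        have "norm (a N - (\<Sum>j<s. e s j / of_nat N ^ j)) \<le> \<bar>C'\<bar> / real N ^ s"
          using elim(2) by (smt (verit) divide_right_mono of_nat_0_le_iff zero_le_power)
        also have "\<dots> \<le> \<bar>C'\<bar> / real N ^ r"
          using elim that by (intro divide_left_mono power_increasing) auto
        finally show "norm (a N - (\<Sum>j<s. e s j / of_nat N ^ j)) \<le> \<bar>C'\<bar> / real N ^ r" .
        have "norm (\<Sum>j\<in>{r..<s}. e s j / of_nat N ^ j) \<le> (\<Sum>j\<in>{r..<s}. norm (e s j / of_nat N ^ j))"
          by (rule norm_sum)
        also have "\<dots> \<le> (\<Sum>j\<in>{r..<s}. norm (e s j) / real N ^ r)"
          using elim by (intro sum_mono) (auto simp: norm_divide norm_power intro!: divide_left_mono power_increasing)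
        finally show "norm (\<Sum>j\<in>{r..<s}. e s j / of_nat N ^ j) \<le> (\<Sum>j\<in>{r..<s}. norm (e s j) / real N ^ r)" .
      qed
      finally show ?case by (simp add: B_def add_divide_distrib sum_divide_distrib)
    qed
    from coeffs_unique[OF F this, of j] that show ?thesis by simp
  qed
  \<comment> \<open>The diagonal choice: \<open>Suc j\<close> is the least order whose list has a
    meaningful entry at index \<open>j\<close>.\<close>
  define d where "d j = e (Suc j) j" for j
  show ?thesis
  proof (rule that[of d])
    show "d 0 = c" by (simp add: d_def e)
    fix r
    have "(\<Sum>j<r. d j / of_nat N ^ j) = (\<Sum>j<r. e r j / of_nat N ^ j)" for N :: nat
      by (intro sum.cong) (auto simp: d_def uniq)
    thus "\<exists>C. \<forall>\<^sub>F N in F. norm (a N - (\<Sum>j<r. d j / of_nat N ^ j)) \<le> C / real N ^ r"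
      using e(2)[of r] by simp
  qed
qed

lemma asy_inverse_N: "asy F D r (\<lambda>N x. 1 / of_nat N) (\<lambda>_. 0)"
  by (rule asyI[OF lpoly.shift[OF lpoly.const[of "\<lambda>_. 1"]]]) (auto intro: unif_O_zero)

section \<open>Riemann sums along radial segments\<close>

text \<open>All segments from 0 to points of \<open>K\<close> together form the compact set
  \<open>Ks\<close> inside \<open>D\<close>, so one bound on the next derivative serves every base
  point \<open>u\<close> and every target \<open>w\<close> at once.\<close>

lemma taylor_radial_bound:
  assumes D: "open D" "\<And>x. x \<in> D \<Longrightarrow> closed_segment 0 x \<subseteq> D"
    and G: "G holomorphic_on D" and K: "compact K" "K \<subseteq> D"
  obtains B where "B \<ge> 0" "\<And>x u w. x \<in> K \<Longrightarrow> u \<in> closed_segment 0 x \<Longrightarrow> w \<in> closed_segment 0 x \<Longrightarrow>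
     norm (G w - (\<Sum>i\<le>n. (deriv ^^ i) G u * (w - u) ^ i / fact i)) \<le> B * norm (w - u) ^ Suc n"
proof -
  define Ks where "Ks = (\<lambda>(t::real, x::complex). t *\<^sub>R x) ` ({0..1} \<times> K)"
  have "compact Ks" unfolding Ks_def
    by (intro compact_continuous_image compact_Times K compact_Icc)
       (auto simp: case_prod_unfold intro!: continuous_intros)
  have seg: "closed_segment 0 x \<subseteq> Ks" if "x \<in> K" for x
    using that by (auto simp: Ks_def closed_segment_def)
  have KsD: "Ks \<subseteq> D"
  proof
    fix y assume "y \<in> Ks"
    then obtain t x where "t \<in> {0..1}" "x \<in> K" "y = t *\<^sub>R x" by (auto simp: Ks_def)
    hence "y \<in> closed_segment 0 x" by (auto simp: closed_segment_def)
    thus "y \<in> D" using D(2)[of x] \<open>x \<in> K\<close> K by blast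
  qed
  have hol: "(deriv ^^ i) G holomorphic_on D" for i
    by (rule holomorphic_higher_deriv[OF G D(1)])
  have "bounded ((deriv ^^ Suc n) G ` Ks)"
    by (intro compact_imp_bounded compact_continuous_image holomorphic_on_imp_continuous_on
         holomorphic_on_subset[OF hol] \<open>compact Ks\<close> KsD)
  then obtain B where B: "\<And>y. y \<in> Ks \<Longrightarrow> norm ((deriv ^^ Suc n) G y) \<le> B"
    by (auto simp: bounded_iff)
  have B': "norm ((deriv ^^ Suc n) G y) \<le> \<bar>B\<bar>" if "y \<in> Ks" for y
    using B[OF that] by linarith
  show ?thesis
  proof (rule that[of "\<bar>B\<bar>"])
    fix x u w assume x: "x \<in> K" and u: "u \<in> closed_segment 0 x" and w: "w \<in> closed_segment 0 x"
    have "norm ((deriv ^^ 0) G w - (\<Sum>i\<le>n. (deriv ^^ i) G u * (w - u) ^ i / fact i)) \<le> \<bar>B\<bar> * norm (w - u) ^ Suc n / fact n"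
    proof (rule complex_Taylor[of "closed_segment 0 x"])
      fix i y assume y: "y \<in> closed_segment 0 x"
      hence "y \<in> D" using seg[OF x] KsD by blast
      have "((deriv ^^ i) G has_field_derivative deriv ((deriv ^^ i) G) y) (at y)"
        by (rule holomorphic_derivI[OF hol D(1) \<open>y \<in> D\<close>])
      thus "((deriv ^^ i) G has_field_derivative (deriv ^^ Suc i) G y) (at y within closed_segment 0 x)"
        by (simp add: has_field_derivative_at_within)
    qed (use u w seg[OF x] B' in auto)
    also have "\<dots> \<le> \<bar>B\<bar> * norm (w - u) ^ Suc n / 1"
      by (intro divide_left_mono) auto
    finally show "norm (G w - (\<Sum>i\<le>n. (deriv ^^ i) G u * (w - u) ^ i / fact i)) \<le> \<bar>B\<bar> * norm (w - u) ^ Suc n"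
      by simp
  qed auto
qed

text \<open>The difference between a Riemann sum with step \<open>\<gamma> * x / N\<close> and \<open>N / (\<gamma> * x)\<close> times the integral from \<open>0\<close> to \<open>x\<close>.\<close>

definition riemann_defect :: "nat \<Rightarrow> (nat \<Rightarrow> nat) \<Rightarrow> (complex \<Rightarrow> complex) \<Rightarrow> nat \<Rightarrow> complex \<Rightarrow> complex" where
  "riemann_defect \<gamma> s G N x = (\<Sum>k=1..s N. deriv G (of_nat k * (of_nat \<gamma> * x / of_nat N)))
     - of_nat N / (of_nat \<gamma> * x) * (G x - G 0)"

text \<open>A replacement for the Euler-Maclaurin formula without Bernoulli numbers. Expanding
  \<open>G\<close> backwards at each sample point and summing telescopes; the terms of degree
  \<open>i \<ge> 2\<close> are again Riemann sums, for the derivatives of \<open>G\<close>,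
  multiplied by at least one power of the step. The induction on the order therefore closes. The
  number \<open>b\<close> measures how far the last sample point falls short of
  \<open>x\<close>.\<close>

lemma riemann_defect_asy:
  assumes D: "open D" "\<And>x. x \<in> D \<Longrightarrow> closed_segment 0 x \<subseteq> D"
    and F: "F \<le> sequentially" and \<gamma>: "\<gamma> \<ge> 1" and s: "\<forall>\<^sub>F N in F. \<gamma> * s N + b = N"
    and "G holomorphic_on D"
  shows "asy F (D - {0}) r (riemann_defect \<gamma> s G)
           (\<lambda>x. (1/2 - of_nat b / of_nat \<gamma>) * deriv G x - deriv G 0 / 2)"
  using assms(6)
proof (induction r arbitrary: G rule: less_induct)
  case (less r G)
  \<comment> \<open>About \<open>N\<close> Taylor remainders of size \<open>N ^ - (n + 1)\<close>
    are added and divided by a step of size \<open>1/N\<close>, which leaves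
    \<open>N ^ (1 - n) = N ^ - r\<close>.\<close>
  define n where "n = Suc r"
  define h :: "nat \<Rightarrow> complex \<Rightarrow> complex" where "h N x = of_nat \<gamma> * x / of_nat N" for N x
  let ?R = "riemann_defect \<gamma> s"
  let ?d = "\<lambda>i. (deriv ^^ i) G"
  \<comment> \<open>\<open>M1\<close> corrects for the gap between the last sample point and
    \<open>x\<close>. \<open>M2\<close> and \<open>M3\<close> come from the higher Taylor terms:
    each such sum is its own defect (\<open>M2\<close>) plus the difference of endpoint values that
    the defect subtracts (\<open>M3\<close>).\<close>
  define M1 where "M1 N x = (\<Sum>i=1..n. (?d i x * x ^ (i-1) * (- of_nat b) ^ i / (of_nat \<gamma> * fact i)) * (1 / of_nat N) ^ (i - 1))" for N x
  define M2 where "M2 N x = (\<Sum>i=2..n. ((-1) ^ i / fact i) * (h N x ^ (i - 1) * ?R (?d (i-1)) N x))" for N x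
  define M3 where "M3 N x = (\<Sum>i=2..n. ((-1) ^ i / fact i) * (h N x ^ (i - 2) * (?d (i-1) x - ?d (i-1) 0)))" for N x
  have hol: "?d i holomorphic_on D" for i
    by (rule holomorphic_higher_deriv[OF less.prems D(1)])
  have hol': "?d i holomorphic_on D - {0}" for i
    by (rule holomorphic_on_subset[OF hol]) auto
  have evN: "\<forall>\<^sub>F N in F. N \<ge> 1"
    using F eventually_ge_at_top[of 1] by (auto simp: le_filter_def)
  have hasy: "asy F (D - {0}) q h (\<lambda>_. 0)" for q
    using asy_cmult[OF asy_inverse_N[of F "D - {0}" q], of "\<lambda>x. of_nat \<gamma> * x"] F
    by (auto simp: h_def[abs_def] intro!: holomorphic_intros)

  have a1: "asy F (D - {0}) r M1 (\<lambda>x. \<Sum>i=1..n. (?d i x * x ^ (i-1) * (- of_nat b) ^ i / (of_nat \<gamma> * fact i)) * 0 ^ (i - 1))"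
    unfolding M1_def using \<gamma>
    by (intro asy_sum asy_cmult asy_power asy_inverse_N F holomorphic_intros hol') auto
  have "(\<Sum>i=1..n. (?d i x * x ^ (i-1) * (- of_nat b) ^ i / (of_nat \<gamma> * fact i)) * 0 ^ (i - 1))
      = (\<Sum>i\<in>{1}. (?d i x * x ^ (i-1) * (- of_nat b) ^ i / (of_nat \<gamma> * fact i)) * 0 ^ (i - 1))" for x
    by (rule sum.mono_neutral_right) (auto simp: n_def)
  with a1 have a1': "asy F (D - {0}) r M1 (\<lambda>x. - (of_nat b / of_nat \<gamma>) * deriv G x)"
    by (simp add: field_simps)

  have a2: "asy F (D - {0}) r M2 (\<lambda>x. \<Sum>i=2..n. ((-1) ^ i / fact i) * 0)"
    unfolding M2_def
  proof (intro asy_sum asy_cmult F holomorphic_intros)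
    fix i assume i: "i \<in> {2..n}"
    hence r: "r \<ge> 1" by (auto simp: n_def)
    then obtain q where q: "r = Suc q" by (cases r) auto
    have 1: "asy F (D - {0}) q (?R (?d (i-1))) (\<lambda>x. (1/2 - of_nat b / of_nat \<gamma>) * deriv (?d (i-1)) x - deriv (?d (i-1)) 0 / 2)"
      using less.IH[of q "?d (i-1)"] hol q by auto
    have 2: "asy F (D - {0}) r (\<lambda>N x. ?R (?d (i-1)) N x / of_nat N) (\<lambda>_. 0)"
      unfolding q by (rule asy_shift[OF 1])
    have "asy F (D - {0}) r (\<lambda>N x. (of_nat \<gamma> * x) * (h N x ^ (i - 2) * (?R (?d (i-1)) N x / of_nat N))) (\<lambda>x. (of_nat \<gamma> * x) * (0 ^ (i-2) * 0))"
      by (intro asy_cmult asy_mult asy_power hasy 2 F holomorphic_intros)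
    moreover have "(of_nat \<gamma> * x) * (h N x ^ (i - 2) * (?R (?d (i-1)) N x / of_nat N)) = h N x ^ (i - 1) * ?R (?d (i-1)) N x" for N x
    proof -
      have "i - 1 = Suc (i - 2)" using i by auto
      thus ?thesis by (simp add: h_def)
    qed
    ultimately show "asy F (D - {0}) r (\<lambda>N x. h N x ^ (i - 1) * ?R (?d (i-1)) N x) (\<lambda>x. 0)" by simp
  qed auto

  have a3: "asy F (D - {0}) r M3 (\<lambda>x. \<Sum>i=2..n. ((-1) ^ i / fact i) * (0 ^ (i - 2) * (?d (i-1) x - ?d (i-1) 0)))"
    unfolding M3_def
    by (intro asy_sum asy_cmult asy_mult asy_power asy_const hasy F holomorphic_intros hol') auto

  have E: "unif_O F (D - {0}) r (\<lambda>N x. ?R G N x - (M1 N x + (M2 N x + M3 N x)))"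
  proof (rule unif_OI)
    fix K assume K: "compact K" "K \<subseteq> D - {0}"
    obtain B where B: "B \<ge> 0" "\<And>x u w. x \<in> K \<Longrightarrow> u \<in> closed_segment 0 x \<Longrightarrow> w \<in> closed_segment 0 x \<Longrightarrow>
         norm (G w - (\<Sum>i\<le>n. ?d i u * (w - u) ^ i / fact i)) \<le> B * norm (w - u) ^ Suc n"
      using taylor_radial_bound[OF D less.prems K(1), of n] K(2) by blast
    obtain X where X: "\<And>x. x \<in> K \<Longrightarrow> norm x \<le> X"
      using compact_imp_bounded[OF K(1)] by (auto simp: bounded_iff)
    define C where "C = B * \<bar>real \<gamma> * X\<bar> ^ n + B * real b ^ Suc n * \<bar>X\<bar> ^ n / real \<gamma>"
    have "\<forall>\<^sub>F N in F. \<forall>x\<in>K. norm (?R G N x - (M1 N x + (M2 N x + M3 N x))) \<le> C / real N ^ r"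
      using evN s
    proof eventually_elim
      case (elim N)
      show ?case
      proof
        fix x assume xK: "x \<in> K"
        have x0: "x \<noteq> 0" using xK K by auto
        have N0: "(of_nat N :: complex) \<noteq> 0" "real N > 0" using elim by auto
        have g0: "(of_nat \<gamma> :: complex) \<noteq> 0" "real \<gamma> > 0" using \<gamma> by auto
        define H where "H = h N x"
        have H0: "H \<noteq> 0" using x0 N0 g0 by (simp add: H_def h_def)
        define m where "m = s N"
        define S where "S i = (\<Sum>k=1..m. ?d i (of_nat k * H))" for i
        have mem: "of_nat k * H \<in> closed_segment 0 x" if "k \<le> m" for k
        proof -
          have "\<gamma> * k \<le> N" using that elim(2) by (metis m_def le_add1 mult_le_mono2 order_trans)
          hence "real \<gamma> * real k \<le> real N" by (metis of_nat_le_iff of_nat_mult)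
          hence "(real \<gamma> * real k / real N) \<in> {0..1}" using N0 by (auto simp: divide_le_eq)
          moreover have "of_nat k * H = (real \<gamma> * real k / real N) *\<^sub>R x"
            by (simp add: H_def h_def scaleR_conv_of_real)
          ultimately show ?thesis by (auto simp: closed_segment_def)
        qed
        have xmem: "x \<in> closed_segment 0 x" by simp
        have mH: "of_nat m * H - x = - (of_nat b * x / of_nat N)"
        proof -
          have "of_nat N = of_nat \<gamma> * (of_nat m :: complex) + of_nat b"
            using elim(2) m_def by (metis of_nat_add of_nat_mult)
          hence "of_nat m * H = x - of_nat b * x / of_nat N"
            using N0 by (simp add: H_def h_def field_simps)
          thus ?thesis by simp
        qed
        \<comment> \<open>\<open>e k\<close> is the Taylor remainder for the step from sample
          \<open>k\<close> back to sample \<open>k - 1\<close>; \<open>e'\<close> is the one for the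
          last sample point seen from \<open>x\<close>.\<close>
        define e where "e k = G (of_nat (k - 1) * H) - (\<Sum>i\<le>n. ?d i (of_nat k * H) * (of_nat (k-1) * H - of_nat k * H) ^ i / fact i)" for k
        define e' where "e' = G (of_nat m * H) - (\<Sum>i\<le>n. ?d i x * (of_nat m * H - x) ^ i / fact i)"
        have split: "(\<Sum>i\<le>n. f i) = f 0 + (\<Sum>i=1..n. f i)" for f :: "nat \<Rightarrow> complex"
          by (simp add: atMost_atLeast0 sum.atLeast_Suc_atMost)
        have split2: "(\<Sum>i=1..n. f i) = f 1 + (\<Sum>i=2..n. f i)" for f :: "nat \<Rightarrow> complex"
          using sum.atLeast_Suc_atMost[of 1 n f] by (simp add: n_def numeral_2_eq_2)
        have "e k = G (of_nat (k - 1) * H) - (\<Sum>i\<le>n. ?d i (of_nat k * H) * (- H) ^ i / fact i)" if "k \<in> {1..m}" for k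
        proof -
          have "of_nat (k-1) * H - of_nat k * H = - H" using that by (simp add: of_nat_diff algebra_simps)
          thus ?thesis by (simp add: e_def)
        qed
        hence "(\<Sum>k=1..m. e k) = (\<Sum>k=1..m. G (of_nat (k - 1) * H)) - (\<Sum>k=1..m. \<Sum>i\<le>n. ?d i (of_nat k * H) * (- H) ^ i / fact i)"
          by (simp add: sum_subtractf)
        also have "(\<Sum>k=1..m. \<Sum>i\<le>n. ?d i (of_nat k * H) * (- H) ^ i / fact i) = (\<Sum>i\<le>n. (- H) ^ i / fact i * S i)"
          by (subst sum.swap) (simp add: S_def sum_distrib_left mult.commute)
        also have "\<dots> = S 0 + (- H * S 1 + (\<Sum>i=2..n. (- H) ^ i / fact i * S i))"
          by (subst split, subst split2) simp
        also have "(\<Sum>k=1..m. G (of_nat (k - 1) * H)) = S 0 + G 0 - G (of_nat m * H)"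
        proof -
          have "S 0 - (\<Sum>k=1..m. G (of_nat (k - 1) * H)) = (\<Sum>k=1..m. G (of_nat k * H) - G (of_nat (k - 1) * H))"
            by (simp add: S_def sum_subtractf)
          also have "\<dots> = G (of_nat m * H) - G 0"
            by (induction m) auto
          finally show ?thesis by (simp add: algebra_simps)
        qed
        finally have Se: "H * S 1 = (\<Sum>k=1..m. e k) + (G (of_nat m * H) - G 0) + (\<Sum>i=2..n. (- H) ^ i / fact i * S i)"
          by (simp add: algebra_simps)
        have invH: "of_nat N / (of_nat \<gamma> * x) = 1 / H" by (simp add: H_def h_def)
        have RS: "H * ?R (?d i) N x = H * S (Suc i) - (?d i x - ?d i 0)" for i
        proof -
          have "?R (?d i) N x = S (Suc i) - 1 / H * (?d i x - ?d i 0)"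
            unfolding riemann_defect_def invH S_def m_def by (simp add: H_def h_def)
          thus ?thesis using H0 by (simp add: right_diff_distrib)
        qed
        \<comment> \<open>Here \<open>S i\<close> samples \<open>deriv\<close> of the
          \<open>(i - 1)\<close>-th derivative, so it equals the defect of that derivative plus
          \<open>1 / H\<close> times the difference of its endpoint values. The second summand costs
          one power of \<open>H\<close>, whence the exponent \<open>i - 2\<close>.\<close>
        have S2: "(- H) ^ i / fact i * S i = H * (((-1) ^ i / fact i) * (H ^ (i - 1) * ?R (?d (i-1)) N x) + ((-1) ^ i / fact i) * (H ^ (i - 2) * (?d (i-1) x - ?d (i-1) 0)))"
          if "i \<in> {2..n}" for i
        proof -
          have i: "i = Suc (Suc (i - 2))" "i - 1 = Suc (i - 2)" using that by auto
          have "H * S i = H * ?R (?d (i-1)) N x + (?d (i-1) x - ?d (i-1) 0)"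
            using RS[of "i-1"] i by (simp add: algebra_simps)
          hence "(-1) ^ i / fact i * H ^ (i - 1) * (H * S i) = (-1) ^ i / fact i * H ^ (i - 1) * (H * ?R (?d (i-1)) N x + (?d (i-1) x - ?d (i-1) 0))" by simp
          moreover have "(-H) ^ i = (-1) ^ i * (H ^ (i - 1) * H)"
            using i by (metis power_Suc2 power_minus)
          moreover have "H ^ (i - 1) = H * H ^ (i - 2)" using i by simp
          ultimately show ?thesis by (simp add: algebra_simps)
        qed
        have M23: "(\<Sum>i=2..n. (- H) ^ i / fact i * S i) = H * (M2 N x + M3 N x)"
          unfolding M2_def M3_def sum.distrib[symmetric] sum_distrib_left H_def[symmetric]
          by (intro sum.cong refl S2) auto
        have M1': "H * M1 N x = (\<Sum>i=1..n. ?d i x * (of_nat m * H - x) ^ i / fact i)"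
          unfolding M1_def sum_distrib_left
        proof (intro sum.cong refl)
          fix i assume "i \<in> {1..n}"
          then obtain j where j: "i = Suc j" by (cases i) auto
          have pw: "(- (of_nat b * x / of_nat N)) ^ Suc j = (- of_nat b) ^ Suc j * x ^ Suc j / of_nat N ^ Suc j"
            by (metis minus_divide_left mult_minus_left power_divide power_mult_distrib)
          show "H * (?d i x * x ^ (i-1) * (- of_nat b) ^ i / (of_nat \<gamma> * fact i) * (1 / of_nat N) ^ (i - 1)) = ?d i x * (of_nat m * H - x) ^ i / fact i"
            unfolding mH unfolding j pw unfolding H_def h_def using N0 g0
            by (simp add: power_divide mult_ac del: fact_Suc)
        qed
        have e'2: "G (of_nat m * H) - G x = e' + H * M1 N x"
          unfolding M1' e'_def by (subst split) simp
        have "H * ?R G N x = H * S 1 - (G x - G 0)"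
          using RS[of 0] by simp
        hence key: "H * (?R G N x - (M1 N x + (M2 N x + M3 N x))) = (\<Sum>k=1..m. e k) + e'"
          unfolding Se M23 using e'2 by (simp add: algebra_simps)
        have eb: "norm (e k) \<le> B * norm H ^ Suc n" if "k \<in> {1..m}" for k
        proof -
          have "norm (of_nat (k-1) * H - of_nat k * H) = norm H"
            using that by (simp add: of_nat_diff algebra_simps)
          thus ?thesis unfolding e_def using B(2)[OF xK mem[of k] mem[of "k-1"]] that by auto
        qed
        have "norm ((\<Sum>k=1..m. e k) + e') \<le> (\<Sum>k=1..m. B * norm H ^ Suc n) + B * norm (of_nat m * H - x) ^ Suc n"
        proof (intro norm_triangle_le add_mono sum_norm_le eb)
          show "norm e' \<le> B * norm (of_nat m * H - x) ^ Suc n"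
            unfolding e'_def by (rule B(2)[OF xK xmem mem]) simp
        qed auto
        also have "\<dots> = real m * B * norm H ^ Suc n + B * (real b * norm x / real N) ^ Suc n"
          by (simp add: mH norm_mult norm_divide)
        also have "\<dots> \<le> real N * B * norm H ^ Suc n + B * (real b * norm x / real N) ^ Suc n"
        proof (intro add_mono mult_right_mono)
          have "m \<le> \<gamma> * m" using \<gamma> by simp
          also have "\<dots> \<le> N" using elim(2) m_def by (metis le_add1)
          finally show "real m \<le> real N" by simp
        qed (use B in auto)
        finally have "norm H * norm (?R G N x - (M1 N x + (M2 N x + M3 N x))) \<le> real N * B * norm H ^ Suc n + B * (real b * norm x / real N) ^ Suc n"
          using key by (metis norm_mult)
        hence "norm (?R G N x - (M1 N x + (M2 N x + M3 N x))) \<le> (real N * B * norm H ^ Suc n + B * (real b * norm x / real N) ^ Suc n) / norm H"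
          using H0 by (simp add: field_simps)
        also have "\<dots> = real N * B * norm H ^ n + B * (real b * norm x / real N) ^ Suc n / norm H"
          using H0 by (simp add: add_divide_distrib)
        also have "norm H = real \<gamma> * norm x / real N"
          by (simp add: H_def h_def norm_mult norm_divide)
        also have "real N * B * (real \<gamma> * norm x / real N) ^ n = B * (real \<gamma> * norm x) ^ n / real N ^ r"
          using N0 by (simp add: n_def field_simps)
        also have "B * (real b * norm x / real N) ^ Suc n / (real \<gamma> * norm x / real N) = B * real b ^ Suc n * norm x ^ n / real \<gamma> / real N ^ n"
          using N0 g0 x0 by (simp add: field_simps)
        also have "B * (real \<gamma> * norm x) ^ n / real N ^ r + B * real b ^ Suc n * norm x ^ n / real \<gamma> / real N ^ n
            \<le> B * \<bar>real \<gamma> * X\<bar> ^ n / real N ^ r + B * real b ^ Suc n * \<bar>X\<bar> ^ n / real \<gamma> / real N ^ r"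
        proof (intro add_mono)
          have nx: "norm x \<le> \<bar>X\<bar>" using X[OF xK] by simp
          show "B * (real \<gamma> * norm x) ^ n / real N ^ r \<le> B * \<bar>real \<gamma> * X\<bar> ^ n / real N ^ r"
            using B nx by (intro divide_right_mono mult_left_mono power_mono) (auto simp: abs_mult intro: mult_left_mono)
          have "B * real b ^ Suc n * norm x ^ n / real \<gamma> / real N ^ n \<le> B * real b ^ Suc n * \<bar>X\<bar> ^ n / real \<gamma> / real N ^ n"
            using B nx by (intro divide_right_mono mult_left_mono power_mono) auto
          also have "\<dots> \<le> B * real b ^ Suc n * \<bar>X\<bar> ^ n / real \<gamma> / real N ^ r"
            using B elim by (intro divide_left_mono power_increasing) (auto simp: n_def)
          finally show "B * real b ^ Suc n * norm x ^ n / real \<gamma> / real N ^ n \<le> B * real b ^ Suc n * \<bar>X\<bar> ^ n / real \<gamma> / real N ^ r" .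
        qed
        also have "\<dots> = C / real N ^ r" by (simp add: C_def add_divide_distrib)
        finally show "norm (?R G N x - (M1 N x + (M2 N x + M3 N x))) \<le> C / real N ^ r" .
      qed
    qed
    thus "\<exists>C. \<forall>\<^sub>F N in F. \<forall>x\<in>K. norm (?R G N x - (M1 N x + (M2 N x + M3 N x))) \<le> C / real N ^ r" ..
  qed

  show ?case
  proof (cases "r = 0")
    \<comment> \<open>With \<open>r = 0\<close> the sums from 2 are empty and the leading
      coefficient is not yet visible. Boundedness suffices, because any holomorphic function may
      then be taken as leading coefficient.\<close>
    case True
    have O1: "unif_O F (D - {0}) 0 (\<lambda>N x. (M1 N x + (M2 N x + M3 N x)) + (?R G N x - (M1 N x + (M2 N x + M3 N x))))"
      using E a1 a2 a3 unfolding True by (intro unif_O_add) (auto intro: asy_O0 F)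
    have holc: "(\<lambda>x. (1/2 - of_nat b / of_nat \<gamma>) * deriv G x - deriv G 0 / 2) holomorphic_on D - {0}"
      using hol'[of 1] by (auto intro!: holomorphic_intros)
    have "unif_O F (D - {0}) 0 (\<lambda>N x. ?R G N x - ((1/2 - of_nat b / of_nat \<gamma>) * deriv G x - deriv G 0 / 2))"
      using O1 by (intro unif_O_diff unif_O_const holomorphic_on_imp_continuous_on holc) simp
    thus ?thesis unfolding True by (rule asyI[OF lpoly.const[OF holc]])
  next
    case False
    have lead: "(\<Sum>i=2..n. ((-1) ^ i / fact i) * (0 ^ (i - 2) * (?d (i-1) x - ?d (i-1) 0))) = 1/2 * (deriv G x - deriv G 0)" for x
    proof -
      have "(\<Sum>i=2..n. ((-1) ^ i / fact i) * (0 ^ (i - 2) * (?d (i-1) x - ?d (i-1) 0)))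
        = (\<Sum>i\<in>{2}. ((-1) ^ i / fact i) * (0 ^ (i - 2) * (?d (i-1) x - ?d (i-1) 0)))"
        using False by (intro sum.mono_neutral_right) (auto simp: n_def)
      thus ?thesis by (simp add: fact_2)
    qed
    have a3': "asy F (D - {0}) r M3 (\<lambda>x. 1/2 * (deriv G x - deriv G 0))"
      using a3 unfolding lead .
    have "asy F (D - {0}) r (\<lambda>N x. (M1 N x + (M2 N x + M3 N x)) + (?R G N x - (M1 N x + (M2 N x + M3 N x))))
       (\<lambda>x. (- (of_nat b / of_nat \<gamma>) * deriv G x + ((\<Sum>i=2..n. ((-1) ^ i / fact i) * 0) + 1/2 * (deriv G x - deriv G 0))) + 0)"
      by (intro asy_add a1' a2 a3' asy_small E)
    moreover have "(- (of_nat b / of_nat \<gamma>) * deriv G x + ((\<Sum>i=2..n. ((-1) ^ i / fact i) * 0) + 1/2 * (deriv G x - deriv G 0))) + 0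
       = (1/2 - of_nat b / of_nat \<gamma>) * deriv G x - deriv G 0 / 2" for x
      by (simp add: field_simps)
    ultimately show ?thesis by simp
  qed
qed

section \<open>Laplace's method\<close>

lemma eventually_power_exp_le:
  fixes \<eta> :: real
  assumes "\<eta> > 0"
  shows "\<forall>\<^sub>F N in sequentially. real N ^ r * exp (- \<eta> * real N) \<le> 1"
proof -
  have "((\<lambda>x. x ^ r / exp x) \<longlongrightarrow> (0::real)) at_top"
    by (rule tendsto_power_div_exp_0)
  moreover have "filterlim (\<lambda>N. \<eta> * real N) at_top sequentially"
    using assms by real_asymp
  ultimately have "((\<lambda>N. (\<eta> * real N) ^ r / exp (\<eta> * real N)) \<longlongrightarrow> 0) sequentially"
    by (rule filterlim_compose)
  hence "((\<lambda>N. (1 / \<eta>) ^ r * ((\<eta> * real N) ^ r / exp (\<eta> * real N))) \<longlongrightarrow> (1 / \<eta>) ^ r * 0) sequentially"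
    by (intro tendsto_intros)
  hence "((\<lambda>N. real N ^ r * exp (- \<eta> * real N)) \<longlongrightarrow> 0) sequentially"
    using assms by (simp add: power_mult_distrib power_divide exp_minus field_simps)
  hence "\<forall>\<^sub>F N in sequentially. real N ^ r * exp (- \<eta> * real N) < 1"
    by (rule order_tendstoD) simp
  thus ?thesis by eventually_elim simp
qed

lemma unif_O_exp_small:
  fixes f :: "nat \<Rightarrow> complex"
  assumes "F \<le> sequentially" "\<eta> > 0" "\<forall>\<^sub>F N in F. norm (f N) \<le> C * real N * exp (- \<eta> * real N)"
  shows "unif_O F UNIV r (\<lambda>N _. f N)"
proof (rule unif_OI)
  fix K :: "complex set"
  have "\<forall>\<^sub>F N in F. real N ^ (r + 1) * exp (- \<eta> * real N) \<le> 1"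
    using eventually_power_exp_le[OF assms(2), of "r+1"] assms(1) by (auto simp: le_filter_def)
  moreover have "\<forall>\<^sub>F N in F. N \<ge> 1"
    using assms(1) eventually_ge_at_top[of 1] by (auto simp: le_filter_def)
  ultimately have "\<forall>\<^sub>F N in F. \<forall>x\<in>K. norm (f N) \<le> \<bar>C\<bar> / real N ^ r"
    using assms(3)
  proof eventually_elim
    case (elim N)
    have "norm (f N) \<le> \<bar>C\<bar> * (real N * exp (- \<eta> * real N))"
    proof -
      have "C * (real N * exp (- \<eta> * real N)) \<le> \<bar>C\<bar> * (real N * exp (- \<eta> * real N))"
        by (intro mult_right_mono) auto
      thus ?thesis using elim(3) by (simp add: mult.assoc)
    qed
    also have "\<dots> \<le> \<bar>C\<bar> * (1 / real N ^ r)"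
      using elim(1,2) by (intro mult_left_mono) (auto simp: field_simps)
    finally show ?case by simp
  qed
  thus "\<exists>C. \<forall>\<^sub>F N in F. \<forall>x\<in>K. norm (f N) \<le> C / real N ^ r" ..
qed

section \<open>Gaussian integrals with real and with complex endpoints\<close>

lemma gauss_has_integral:
  assumes "c > (0::real)"
  shows "((\<lambda>s. exp (- c * s\<^sup>2)) has_integral sqrt (pi / c)) UNIV"
proof -
  define \<sigma> where "\<sigma> = sqrt (1 / (2 * c))"
  have \<sigma>2: "\<sigma>\<^sup>2 = 1 / (2 * c)" using assms by (simp add: \<sigma>_def)
  have "\<sigma> > 0" using assms by (simp add: \<sigma>_def)
  have "(normal_density 0 \<sigma> has_integral 1) UNIV"
    using has_integral_integral_lborel[OF integrable_normal_density[of \<sigma> 0]]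
      integral_normal_density[of \<sigma> 0] \<open>\<sigma> > 0\<close> by simp
  hence "((\<lambda>s. sqrt (pi / c) * normal_density 0 \<sigma> s) has_integral sqrt (pi / c) * 1) UNIV"
    by (rule has_integral_mult_right)
  moreover have "sqrt (pi / c) * normal_density 0 \<sigma> s = exp (- c * s\<^sup>2)" for s
    using assms by (simp add: normal_density_def \<sigma>2 field_simps)
  ultimately show ?thesis by simp
qed

text \<open>Outside the interval half of the exponent, at least
  \<open>c * \<rho>\<^sup>2 / 2\<close>, is given away as a constant factor; the other half keeps
  the tail integrable over the whole line.\<close>

lemma gauss_truncated:
  assumes "\<rho> > (0::real)" "c > 0"
  shows "\<bar>sqrt c * integral {-\<rho>..\<rho>} (\<lambda>s. exp (- c * s\<^sup>2)) - sqrt pi\<bar> \<le> sqrt (2 * pi) * exp (- (\<rho>\<^sup>2 / 2) * c)"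
proof -
  let ?f = "\<lambda>s. exp (- c * s\<^sup>2)"
  define I where "I = integral {-\<rho>..\<rho>} ?f"
  have cont: "continuous_on {-\<rho>..\<rho>} ?f" by (intro continuous_intros)
  have hI: "(?f has_integral I) {-\<rho>..\<rho>}"
    unfolding I_def by (intro integrable_integral integrable_continuous_interval cont)
  hence hI': "((\<lambda>s. if s \<in> {-\<rho>..\<rho>} then ?f s else 0) has_integral I) UNIV"
    by (subst has_integral_restrict_UNIV)
  have hf: "(?f has_integral sqrt (pi / c)) UNIV" by (rule gauss_has_integral[OF assms(2)])
  have le1: "I \<le> sqrt (pi / c)"
    by (rule has_integral_le[OF hI' hf]) auto
  have "((\<lambda>s. exp (- (c/2) * s\<^sup>2)) has_integral sqrt (pi / (c/2))) UNIV"
    using assms by (intro gauss_has_integral) auto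
  hence "((\<lambda>s. exp (- (\<rho>\<^sup>2 / 2) * c) * exp (- (c/2) * s\<^sup>2)) has_integral exp (- (\<rho>\<^sup>2 / 2) * c) * sqrt (pi / (c/2))) UNIV"
    by (rule has_integral_mult_right)
  hence hg: "((\<lambda>s. (if s \<in> {-\<rho>..\<rho>} then ?f s else 0) + exp (- (\<rho>\<^sup>2 / 2) * c) * exp (- (c/2) * s\<^sup>2)) has_integral
     I + exp (- (\<rho>\<^sup>2 / 2) * c) * sqrt (pi / (c/2))) UNIV"
    by (rule has_integral_add[OF hI'])
  have le2: "sqrt (pi / c) \<le> I + exp (- (\<rho>\<^sup>2 / 2) * c) * sqrt (pi / (c/2))"
  proof (rule has_integral_le[OF hf hg])
    fix s :: real
    show "?f s \<le> (if s \<in> {-\<rho>..\<rho>} then ?f s else 0) + exp (- (\<rho>\<^sup>2 / 2) * c) * exp (- (c/2) * s\<^sup>2)"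
    proof (cases "s \<in> {-\<rho>..\<rho>}")
      case False
      hence "\<bar>\<rho>\<bar> \<le> \<bar>s\<bar>" using assms by auto
      hence "\<rho>\<^sup>2 \<le> s\<^sup>2" by (simp add: abs_le_square_iff)
      hence "c * \<rho>\<^sup>2 \<le> c * s\<^sup>2" using assms by simp
      hence "- c * s\<^sup>2 \<le> - (\<rho>\<^sup>2 / 2) * c + - (c/2) * s\<^sup>2" by (simp add: algebra_simps)
      thus ?thesis using False by (simp flip: exp_add)
    qed auto
  qed
  have s1: "sqrt c * sqrt (pi / c) = sqrt pi" "sqrt c * sqrt (pi / (c/2)) = sqrt (2 * pi)"
    using assms by (simp_all flip: real_sqrt_mult)
  have "sqrt c * I \<le> sqrt c * sqrt (pi / c)" using le1 by (intro mult_left_mono) (use assms in auto)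
  hence a: "sqrt c * I \<le> sqrt pi" unfolding s1 .
  have "sqrt c * sqrt (pi / c) \<le> sqrt c * (I + exp (- (\<rho>\<^sup>2 / 2) * c) * sqrt (pi / (c/2)))"
    using le2 by (intro mult_left_mono) (use assms in auto)
  also have "sqrt c * (I + exp (- (\<rho>\<^sup>2 / 2) * c) * sqrt (pi / (c/2))) = sqrt c * I + exp (- (\<rho>\<^sup>2 / 2) * c) * (sqrt c * sqrt (pi / (c/2)))"
    by (simp only: distrib_left mult.left_commute)
  finally have b: "sqrt pi \<le> sqrt c * I + exp (- (\<rho>\<^sup>2 / 2) * c) * sqrt (2 * pi)" unfolding s1 .
  show ?thesis using a b unfolding I_def[symmetric] by (simp add: mult.commute)
qed

text \<open>The path is deformed to run through -1 and 1. The middle part is the real truncated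
  Gaussian. The outer parts lie in the two sectors where \<open>Re (w\<^sup>2) > 0\<close>; these
  are convex, so on a segment the exponent has a positive minimum and the contribution is
  exponentially small.\<close>

lemma gauss_complex_endpoints:
  fixes w1 w2 :: complex
  assumes "Re w1 < 0" "Re (w1\<^sup>2) > 0" "Re w2 > 0" "Re (w2\<^sup>2) > 0"
  obtains C \<eta> where "\<eta> > 0" "\<And>N. N \<ge> 1 \<Longrightarrow>
     norm (sqrt (real N) * contour_integral (linepath w1 w2) (\<lambda>w. exp (- of_nat N * w\<^sup>2)) - sqrt pi) \<le> C * real N * exp (- \<eta> * real N)"
proof -
  define Sec where "Sec = {w::complex. \<bar>Im w\<bar> < Re w}"
  have convSec: "convex Sec"
  proof -
    have "Sec = {w. Im w - Re w < 0} \<inter> {w. - Im w - Re w < 0}" by (auto simp: Sec_def)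
    moreover have "{w. Im w - Re w < 0} = {w. inner (Complex (-1) 1) w < 0}"
      "{w. - Im w - Re w < 0} = {w. inner (Complex (-1) (-1)) w < 0}"
      by (auto simp: inner_complex_def)
    ultimately show ?thesis by (auto intro!: convex_Int convex_halfspace_lt)
  qed
  have SecRe: "Re (w\<^sup>2) > 0" if "w \<in> Sec" for w
  proof -
    have "\<bar>Im w\<bar> < \<bar>Re w\<bar>" using that by (auto simp: Sec_def)
    hence "(Im w)\<^sup>2 < (Re w)\<^sup>2" using abs_le_square_iff[of "Re w" "Im w"] by linarith
    thus ?thesis by (simp add: Re_power2)
  qed
  have inSec: "w \<in> Sec" if "Re w > 0" "Re (w\<^sup>2) > 0" for w
  proof -
    have "(Im w)\<^sup>2 < (Re w)\<^sup>2" using that by (simp add: Re_power2)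
    hence "\<bar>Im w\<bar> < \<bar>Re w\<bar>" using abs_le_square_iff[of "Re w" "Im w"] by linarith
    thus ?thesis using that by (auto simp: Sec_def)
  qed
  define f where "f N w = exp (- of_nat N * w\<^sup>2)" for N :: nat and w :: complex
  have bound: "\<exists>\<eta>>0. \<forall>N. norm (contour_integral (linepath 1 w) (f N)) \<le> exp (- \<eta> * real N) * norm (w - 1)" if "w \<in> Sec" for w
  proof -
    have one: "1 \<in> Sec" by (auto simp: Sec_def)
    have seg: "closed_segment 1 w \<subseteq> Sec" using convSec one that by (rule convex_contains_segment[THEN iffD1, rule_format])
    have "continuous_on (closed_segment 1 w) (\<lambda>w. Re (w\<^sup>2))" by (intro continuous_intros)
    then obtain w' where w': "w' \<in> closed_segment 1 w" "\<And>y. y \<in> closed_segment 1 w \<Longrightarrow> Re (w'\<^sup>2) \<le> Re (y\<^sup>2)"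
      using continuous_attains_inf[of "closed_segment 1 w" "\<lambda>w. Re (w\<^sup>2)"] by auto
    show ?thesis
    proof (intro exI[of _ "Re (w'\<^sup>2)"] conjI allI)
      show "Re (w'\<^sup>2) > 0" using w' seg SecRe by blast
      fix N
      show "norm (contour_integral (linepath 1 w) (f N)) \<le> exp (- Re (w'\<^sup>2) * real N) * norm (w - 1)"
      proof (rule contour_integral_bound_linepath)
        show "f N contour_integrable_on linepath 1 w"
          unfolding f_def by (intro contour_integrable_continuous_linepath continuous_intros)
        fix y assume "y \<in> closed_segment 1 w"
        hence "real N * Re (w'\<^sup>2) \<le> real N * Re (y\<^sup>2)" using w' by (intro mult_left_mono) auto
        thus "norm (f N y) \<le> exp (- Re (w'\<^sup>2) * real N)"
          by (simp add: f_def mult.commute)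
      qed auto
    qed
  qed
  obtain \<eta>2 where \<eta>2: "\<eta>2 > 0" "\<And>N. norm (contour_integral (linepath 1 w2) (f N)) \<le> exp (- \<eta>2 * real N) * norm (w2 - 1)"
    using bound[OF inSec[of w2]] assms by blast
  obtain \<eta>1 where \<eta>1: "\<eta>1 > 0" "\<And>N. norm (contour_integral (linepath 1 (- w1)) (f N)) \<le> exp (- \<eta>1 * real N) * norm (- w1 - 1)"
    using bound[OF inSec[of "- w1"]] assms by auto
  define \<eta> where "\<eta> = min (1/2) (min \<eta>1 \<eta>2)"
  have \<eta>: "\<eta> > 0" "\<eta> \<le> 1/2" "\<eta> \<le> \<eta>1" "\<eta> \<le> \<eta>2" using \<eta>1 \<eta>2 by (auto simp: \<eta>_def)
  define C where "C = sqrt (2 * pi) + norm (w2 - 1) + norm (- w1 - 1)"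
  have "norm (sqrt (real N) * contour_integral (linepath w1 w2) (\<lambda>w. exp (- of_nat N * w\<^sup>2)) - sqrt pi) \<le> C * real N * exp (- \<eta> * real N)"
    if N: "N \<ge> 1" for N
  proof -
    have "f N holomorphic_on UNIV" unfolding f_def[abs_def] by (intro holomorphic_intros)
    then obtain E where E: "\<And>w. (E has_field_derivative f N w) (at w)"
      using holomorphic_convex_primitive'[of UNIV "f N"] by auto
    have prim: "contour_integral (linepath u w) (f N) = E w - E u" for u w
      using contour_integral_primitive[of UNIV E "f N" "linepath u w"] E
      by (intro contour_integral_unique) auto
    \<comment> \<open>The integrand is even, so its primitive is odd up to a constant. This moves
      the left outer part into the right sector, where \<open>bound\<close> applies.\<close>
    have odd: "E (- 1) - E w1 = E (- w1) - E 1"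
    proof -
      have "((\<lambda>w. E w + E (- w)) has_field_derivative 0) (at w)" for w
      proof -
        have "((\<lambda>w. E (- w)) has_field_derivative f N (- w) * (-1)) (at w)"
          by (rule DERIV_chain'[where f = uminus and g = E]) (auto intro!: derivative_eq_intros E)
        from DERIV_add[OF E this] show ?thesis by (simp add: f_def)
      qed
      hence "(\<lambda>w. E w + E (- w)) constant_on UNIV"
        by (intro has_field_derivative_0_imp_constant_on) auto
      hence "E 1 + E (- 1) = E w1 + E (- w1)" by (auto simp: constant_on_def)
      thus ?thesis by (simp add: algebra_simps)
    qed
    have mid: "E 1 - E (-1) = of_real (integral {-1..1} (\<lambda>s. exp (- real N * s\<^sup>2)))"
    proof -
      have "contour_integral (linepath (of_real (-1)) (of_real 1)) (f N) = integral {-1..1} (\<lambda>s. f N (of_real s))"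
        by (subst contour_integral_linepath_Reals_eq) auto
      also have "(\<lambda>s::real. f N (of_real s)) = (\<lambda>s. of_real (exp (- real N * s\<^sup>2)))"
        by (auto simp: f_def exp_of_real[symmetric])
      also have "integral {-1..1} (\<lambda>s. of_real (exp (- real N * s\<^sup>2))) = (of_real (integral {-1..1} (\<lambda>s. exp (- real N * s\<^sup>2))) :: complex)"
        by (intro integral_unique has_integral_of_real integrable_integral integrable_continuous_interval continuous_intros)
      finally show ?thesis by (simp add: prim)
    qed
    let ?I = "integral {-1..1} (\<lambda>s. exp (- real N * s\<^sup>2))"
    have "contour_integral (linepath w1 w2) (f N) = contour_integral (linepath 1 w2) (f N) + of_real ?I + contour_integral (linepath 1 (- w1)) (f N)"
      unfolding prim mid[symmetric] using odd by (simp add: algebra_simps)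
    hence eq: "sqrt (real N) * contour_integral (linepath w1 w2) (f N) - sqrt pi = 
       sqrt (real N) * contour_integral (linepath 1 w2) (f N) + (of_real (sqrt (real N) * ?I - sqrt pi) + sqrt (real N) * contour_integral (linepath 1 (- w1)) (f N))"
      by (simp add: algebra_simps)
    have sN: "sqrt (real N) \<le> real N" using N by (simp add: real_le_lsqrt self_le_power)
    have e: "exp (- \<eta>' * real N) \<le> exp (- \<eta> * real N)" if "\<eta> \<le> \<eta>'" for \<eta>'
      using that by (simp add: mult_right_mono)
    have p: "norm (sqrt (real N) * contour_integral (linepath 1 w) (f N)) \<le> real N * (exp (- \<eta> * real N) * norm (w - 1))"
      if "norm (contour_integral (linepath 1 w) (f N)) \<le> exp (- \<eta>' * real N) * norm (w - 1)" "\<eta> \<le> \<eta>'" for w \<eta>'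
    proof -
      have "norm (contour_integral (linepath 1 w) (f N)) \<le> exp (- \<eta> * real N) * norm (w - 1)"
        using that(1) mult_right_mono[OF e[OF that(2)], of "norm (w - 1)"] by simp
      thus ?thesis unfolding norm_mult using sN by (intro mult_mono) auto
    qed
    have q: "norm (of_real (sqrt (real N) * ?I - sqrt pi) :: complex) \<le> real N * (exp (- \<eta> * real N) * sqrt (2 * pi))"
    proof -
      have "norm (of_real (sqrt (real N) * ?I - sqrt pi) :: complex) = \<bar>sqrt (real N) * ?I - sqrt pi\<bar>"
        by (simp only: norm_of_real real_norm_def)
      also have "\<dots> \<le> sqrt (2 * pi) * exp (- (1\<^sup>2 / 2) * real N)"
        using gauss_truncated[of 1 "real N"] N by simp
      also have "\<dots> \<le> sqrt (2 * pi) * exp (- \<eta> * real N)"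
        using e[of "1/2"] \<eta> by (intro mult_left_mono) auto
      also have "\<dots> \<le> real N * (sqrt (2 * pi) * exp (- \<eta> * real N))"
        using N mult_right_mono[of 1 "real N" "sqrt (2 * pi) * exp (- \<eta> * real N)"] by simp
      finally show ?thesis by (simp add: mult.commute)
    qed
    have "norm (sqrt (real N) * contour_integral (linepath w1 w2) (f N) - sqrt pi) \<le>
        real N * (exp (- \<eta> * real N) * norm (w2 - 1)) + (real N * (exp (- \<eta> * real N) * sqrt (2 * pi)) + real N * (exp (- \<eta> * real N) * norm (- w1 - 1)))"
      unfolding eq by (intro norm_triangle_le add_mono p[OF \<eta>2(2)] p[OF \<eta>1(2)] q \<eta>)
    thus ?thesis by (simp add: C_def f_def[abs_def] algebra_simps)
  qed
  with \<eta>(1) show ?thesis by (rule that)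
qed

lemma complex_solve_linear:
  fixes n A B C :: complex
  assumes "n * A + B = C" "n \<noteq> 0"
  shows "A = C / n - B / n"
  using assms by (auto simp: field_simps)

text \<open>With \<open>v\<^sup>2 = p t0 - p\<close> near \<open>t0\<close>, the integral of
  \<open>exp (N * p) * deriv v\<close> is exactly a Gaussian between complex endpoints. Any other
  amplitude is a multiple of \<open>deriv v\<close> plus a function vanishing at \<open>t0\<close>,
  and the latter is divisible by \<open>deriv p\<close>, so one integration by parts gains a factor
  \<open>1/N\<close>. Iteration gives all orders without inverting \<open>v\<close> and without
  Gaussian moments.\<close>

lemma laplace_asy:
  fixes p c :: "complex \<Rightarrow> complex" and g :: "nat \<Rightarrow> complex \<Rightarrow> complex" and a b t0 :: real
  assumes F: "F \<le> sequentially" and S: "open S" and seg: "complex_of_real ` {a..b} \<subseteq> S"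
    and p: "p holomorphic_on S" and t0: "a < t0" "t0 < b"
    and crit: "deriv p t0 = 0" and max2: "Re (deriv (deriv p) t0) < 0"
    and max: "\<And>t. t \<in> {a..b} \<Longrightarrow> t \<noteq> t0 \<Longrightarrow> Re (p t) < Re (p t0)"
    and g: "\<And>r. asy F S r g c" and gcont: "\<And>N. continuous_on S (g N)"
  shows "asy F UNIV r (\<lambda>N _. sqrt (real N) * (exp (- of_nat N * p t0) *
            contour_integral (linepath (complex_of_real a) (complex_of_real b)) (\<lambda>t. exp (of_nat N * p t) * g N t)))
          (\<lambda>_. sqrt pi * c t0 / csqrt (- deriv (deriv p) t0 / 2))"
proof -
  have evN: "\<forall>\<^sub>F N in F. N \<ge> 1"
    using F eventually_ge_at_top[of 1] by (auto simp: le_filter_def)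
  define T where "T = complex_of_real t0"
  have TS: "T \<in> S" using seg t0 by (auto simp: T_def)
  define W where "W t = p t - p T" for t
  have W: "W holomorphic_on S" unfolding W_def by (intro holomorphic_intros p)
  have dW: "deriv W t = deriv p t" if "t \<in> S" for t
    unfolding W_def[abs_def] using holomorphic_derivI[OF p S that]
    by (intro DERIV_imp_deriv) (auto intro!: derivative_eq_intros)
  have ddW: "deriv (deriv W) T = deriv (deriv p) T"
    using eventually_nhds_in_open[OF S TS]
    by (intro deriv_cong_ev refl) (auto elim!: eventually_mono simp: dW)
  \<comment> \<open>Removing the zero of \<open>W\<close> at \<open>T\<close> twice: both
    \<open>W\<close> and its derivative vanish there, so \<open>W\<close> is
    \<open>(t - T)\<^sup>2\<close> times a holomorphic \<open>q\<close>.\<close>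
  define q0 where "q0 t = (if t = T then deriv W T else (W t - W T) / (t - T))" for t
  have q0: "q0 holomorphic_on S" unfolding q0_def by (rule pole_lemma_open[OF W S])
  have q0T: "q0 T = 0" using crit dW[OF TS] by (simp add: q0_def T_def)
  define q where "q t = (if t = T then deriv q0 T else (q0 t - q0 T) / (t - T))" for t
  have q: "q holomorphic_on S" unfolding q_def by (rule pole_lemma_open[OF q0 S])
  have Wq: "W t = (t - T)\<^sup>2 * q t" for t
  proof (cases "t = T")
    case False
    hence "q t = q0 t / (t - T)" "q0 t = W t / (t - T)"
      by (simp_all only: q_def q0T) (simp_all add: q0_def W_def)
    thus ?thesis using False by (simp add: power2_eq_square)
  qed (simp add: W_def)
  \<comment> \<open>The cofactor of \<open>t - T\<close> in \<open>deriv W\<close>. It is nonzero at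
    \<open>T\<close>, hence on a small ball, which makes division by \<open>deriv W\<close>
    legitimate for functions that vanish at \<open>T\<close>.\<close>
  define k1 where "k1 t = 2 * q t + (t - T) * deriv q t" for t
  have k1: "k1 holomorphic_on S" unfolding k1_def by (intro holomorphic_intros q S)
  have dWk: "deriv W t = (t - T) * k1 t" if "t \<in> S" for t
  proof -
    have "((\<lambda>t. (t - T)\<^sup>2 * q t) has_field_derivative (t - T) * k1 t) (at t)"
      using holomorphic_derivI[OF q S that]
      by (auto intro!: derivative_eq_intros simp: k1_def power2_eq_square algebra_simps)
    thus ?thesis by (intro DERIV_imp_deriv) (simp add: Wq[abs_def])
  qed
  have "deriv (deriv W) T = k1 T"
  proof -
    have "((\<lambda>t. (t - T) * k1 t) has_field_derivative k1 T) (at T)"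
      using holomorphic_derivI[OF k1 S TS] by (auto intro!: derivative_eq_intros)
    hence "(deriv W has_field_derivative k1 T) (at T)"
      by (rule has_field_derivative_transform_within_open[OF _ S TS]) (simp add: dWk)
    thus ?thesis by (rule DERIV_imp_deriv)
  qed
  hence qT: "q T = deriv (deriv p) T / 2" using ddW by (simp add: k1_def)
  have RqT: "Re (- q T) > 0" using max2 unfolding T_def[symmetric] by (simp add: qT)
  have k1T: "k1 T \<noteq> 0" using RqT by (auto simp: k1_def)

  have "continuous_on S (\<lambda>t. Re (- q t))" "continuous_on S k1"
    by (intro continuous_intros holomorphic_on_imp_continuous_on q k1)+
  hence "open (S \<inter> (\<lambda>t. Re (- q t)) -` {0<..})" "open (S \<inter> k1 -` (- {0}))"
    by (intro continuous_open_preimage S; simp add: open_Compl)+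
  hence "open ((S \<inter> (\<lambda>t. Re (- q t)) -` {0<..}) \<inter> (S \<inter> k1 -` (- {0})))" by (rule open_Int)
  moreover have "T \<in> (S \<inter> (\<lambda>t. Re (- q t)) -` {0<..}) \<inter> (S \<inter> k1 -` (- {0}))"
    using TS RqT k1T by auto
  ultimately obtain \<epsilon> where \<epsilon>: "\<epsilon> > 0" "ball T \<epsilon> \<subseteq> (S \<inter> (\<lambda>t. Re (- q t)) -` {0<..}) \<inter> (S \<inter> k1 -` (- {0}))"
    by (rule openE)
  define B where "B = ball T \<epsilon>"
  have oB: "open B" "T \<in> B" "convex B" using \<epsilon> by (auto simp: B_def)
  have BS: "B \<subseteq> S" using \<epsilon> by (auto simp: B_def)
  have ReqB: "Re (- q t) > 0" if "t \<in> B" for t using \<epsilon> that by (auto simp: B_def)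
  have k1B: "k1 t \<noteq> 0" if "t \<in> B" for t using \<epsilon> that by (auto simp: B_def)
  \<comment> \<open>The principal root is holomorphic on \<open>B\<close> because
    \<open>Re (- q) > 0\<close> there; it also has positive real part, which sends the two ends of
    the segment into opposite sectors.\<close>
  define v where "v t = (t - T) * csqrt (- q t)" for t
  have cs: "(\<lambda>t. csqrt (- q t)) holomorphic_on B"
  proof (rule holomorphic_on_csqrt')
    show "(\<lambda>t. - q t) holomorphic_on B" by (intro holomorphic_intros holomorphic_on_subset[OF q BS])
    fix t assume "t \<in> B"
    thus "- q t \<notin> \<real>\<^sub>\<le>\<^sub>0" using ReqB[of t] by (auto simp: complex_nonpos_Reals_iff)
  qed
  have v: "v holomorphic_on B" unfolding v_def by (intro holomorphic_intros cs)
  have v2: "(v t)\<^sup>2 = - W t" for t by (simp add: v_def Wq power_mult_distrib)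
  have dvT: "deriv v T = csqrt (- q T)"
  proof -
    have "((\<lambda>t. (t - T) * csqrt (- q t)) has_field_derivative csqrt (- q T)) (at T)"
      using DERIV_mult[OF DERIV_diff[OF DERIV_ident DERIV_const[of T]] holomorphic_derivI[OF cs oB(1,2)]] by simp
    thus ?thesis by (intro DERIV_imp_deriv) (simp add: v_def[abs_def])
  qed
  have vT0: "deriv v T \<noteq> 0" using RqT by (auto simp: dvT)
  define \<delta> where "\<delta> = min (\<epsilon>/2) (min ((t0 - a)/2) ((b - t0)/2))"
  have \<delta>: "\<delta> > 0" "\<delta> < \<epsilon>" "a < t0 - \<delta>" "t0 + \<delta> < b" using \<epsilon> t0 by (auto simp: \<delta>_def min_def field_simps)
  define \<alpha> \<beta> where "\<alpha> = complex_of_real (t0 - \<delta>)" and "\<beta> = complex_of_real (t0 + \<delta>)"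
  have \<alpha>B: "\<alpha> \<in> B" "\<beta> \<in> B" using \<delta> by (auto simp: \<alpha>_def \<beta>_def B_def T_def dist_norm simp flip: of_real_diff)
  have segB: "closed_segment \<alpha> \<beta> \<subseteq> B" using oB \<alpha>B by (simp add: closed_segment_subset)
  have segr: "closed_segment (complex_of_real s) (of_real t) = of_real ` {s..t}" if "s \<le> t" for s t
    using that by (simp add: closed_segment_of_real closed_segment_eq_real_ivl)
  have ReW: "Re (W (of_real t)) < 0" if "t \<in> {a..b}" "t \<noteq> t0" for t
    using max[OF that] by (simp add: W_def T_def)
  have ReW0: "Re (W (of_real t)) \<le> 0" if "t \<in> {a..b}" for t
    using ReW[OF that] by (cases "t = t0") (auto simp: W_def T_def)
  define ex where "ex N t = exp (of_nat N * W t)" for N :: nat and t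
  have exhol: "ex N holomorphic_on S" for N unfolding ex_def by (intro holomorphic_intros W)
  define I where "I N f = sqrt (real N) * contour_integral (linepath \<alpha> \<beta>) (\<lambda>t. ex N t * f t)" for N :: nat and f :: "complex \<Rightarrow> complex"
  have intB: "f contour_integrable_on linepath \<alpha> \<beta>" if "f holomorphic_on B" for f
    by (intro contour_integrable_continuous_linepath holomorphic_on_imp_continuous_on holomorphic_on_subset[OF that segB])
  have exholB: "ex N holomorphic_on B" for N by (rule holomorphic_on_subset[OF exhol BS])

  have exsmall: "\<exists>\<eta>>0. (\<forall>N. norm (ex N \<alpha>) \<le> exp (- \<eta> * real N)) \<and> (\<forall>N. norm (ex N \<beta>) \<le> exp (- \<eta> * real N))"
  proof -
    define \<eta> where "\<eta> = min (- Re (W \<alpha>)) (- Re (W \<beta>))"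
    have "Re (W \<alpha>) < 0" "Re (W \<beta>) < 0" unfolding \<alpha>_def \<beta>_def using \<delta> by (intro ReW; simp)+
    hence "\<eta> > 0" by (auto simp: \<eta>_def)
    moreover have "norm (ex N z) \<le> exp (- \<eta> * real N)" if "Re (W z) \<le> - \<eta>" for N z
      using mult_left_mono[OF that, of "real N"] by (simp add: ex_def algebra_simps)
    ultimately show ?thesis by (intro exI[of _ \<eta>]) (auto simp: \<eta>_def)
  qed
  then obtain \<eta> where \<eta>: "\<eta> > 0" "\<And>N. norm (ex N \<alpha>) \<le> exp (- \<eta> * real N)" "\<And>N. norm (ex N \<beta>) \<le> exp (- \<eta> * real N)"
    by blast

  \<comment> \<open>For the amplitude \<open>deriv v\<close> there is no further expansion: up to an
    exponentially small error the value is \<open>sqrt pi\<close>.\<close>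
  have Iv: "asy F UNIV r (\<lambda>N _. I N (deriv v)) (\<lambda>_. sqrt pi)" for r
  proof -
    have vab: "Re (v \<alpha>) < 0" "Re ((v \<alpha>)\<^sup>2) > 0" "Re (v \<beta>) > 0" "Re ((v \<beta>)\<^sup>2) > 0"
    proof -
      have cp: "Re (csqrt (- q t)) > 0" if "t \<in> B" for t
      proof -
        have "norm (- q t) + Re (- q t) > 0" using ReqB[OF that] norm_ge_zero[of "- q t"] by linarith
        thus ?thesis by simp
      qed
      have "v \<alpha> = - of_real \<delta> * csqrt (- q \<alpha>)" "v \<beta> = of_real \<delta> * csqrt (- q \<beta>)"
        by (simp_all add: v_def \<alpha>_def \<beta>_def T_def)
      thus "Re (v \<alpha>) < 0" "Re (v \<beta>) > 0" using cp[OF \<alpha>B(1)] cp[OF \<alpha>B(2)] \<delta> by auto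
      have "Re (W \<alpha>) < 0" "Re (W \<beta>) < 0" unfolding \<alpha>_def \<beta>_def using \<delta> by (intro ReW; simp)+
      thus "Re ((v \<alpha>)\<^sup>2) > 0" "Re ((v \<beta>)\<^sup>2) > 0" by (auto simp: v2)
    qed
    obtain C \<eta>' where \<eta>': "\<eta>' > 0" "\<And>N. N \<ge> 1 \<Longrightarrow>
       norm (sqrt (real N) * contour_integral (linepath (v \<alpha>) (v \<beta>)) (\<lambda>w. exp (- of_nat N * w\<^sup>2)) - sqrt pi) \<le> C * real N * exp (- \<eta>' * real N)"
      using gauss_complex_endpoints[OF vab] by blast
    have eq: "contour_integral (linepath \<alpha> \<beta>) (\<lambda>t. ex N t * deriv v t) = contour_integral (linepath (v \<alpha>) (v \<beta>)) (\<lambda>w. exp (- of_nat N * w\<^sup>2))" for N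
    proof -
      have "(\<lambda>w. exp (- of_nat N * w\<^sup>2)) holomorphic_on (UNIV :: complex set)" by (intro holomorphic_intros)
      then obtain E :: "complex \<Rightarrow> complex" where E: "\<And>w. (E has_field_derivative exp (- of_nat N * w\<^sup>2)) (at w)"
        using holomorphic_convex_primitive'[of UNIV "\<lambda>w. exp (- of_nat N * w\<^sup>2)"] by auto
      have "contour_integral (linepath (v \<alpha>) (v \<beta>)) (\<lambda>w. exp (- of_nat N * w\<^sup>2)) = E (v \<beta>) - E (v \<alpha>)"
        using contour_integral_primitive[of UNIV E "\<lambda>w. exp (- of_nat N * w\<^sup>2)" "linepath (v \<alpha>) (v \<beta>)"] E
        by (intro contour_integral_unique) auto
      moreover have "contour_integral (linepath \<alpha> \<beta>) (\<lambda>t. ex N t * deriv v t) = E (v \<beta>) - E (v \<alpha>)"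
      proof (rule contour_integral_unique)
        have der: "((\<lambda>t. E (v t)) has_field_derivative ex N t * deriv v t) (at t within B)" if "t \<in> B" for t
        proof -
          have "((\<lambda>t. E (v t)) has_field_derivative exp (- of_nat N * (v t)\<^sup>2) * deriv v t) (at t)"
            by (rule DERIV_chain'[OF holomorphic_derivI[OF v oB(1) that] E])
          thus ?thesis by (simp add: v2 ex_def has_field_derivative_at_within)
        qed
        show "((\<lambda>t. ex N t * deriv v t) has_contour_integral E (v \<beta>) - E (v \<alpha>)) (linepath \<alpha> \<beta>)"
          using contour_integral_primitive[of B "\<lambda>t. E (v t)", OF der, of "linepath \<alpha> \<beta>"] segB by simp
      qed
      ultimately show ?thesis by simp
    qed
    have "unif_O F UNIV r (\<lambda>N _. I N (deriv v) - sqrt pi)"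
    proof (rule unif_O_exp_small[OF F \<eta>'(1), of _ C])
      show "\<forall>\<^sub>F N in F. norm (I N (deriv v) - sqrt pi) \<le> C * real N * exp (- \<eta>' * real N)"
        using evN by eventually_elim (unfold I_def eq, rule \<eta>'(2))
    qed
    thus ?thesis by (rule asyI[OF lpoly.const, rotated]) auto
  qed

  \<comment> \<open>Subtracting the right multiple of \<open>deriv v\<close> leaves \<open>n\<close>
    with \<open>n T = 0\<close>, hence \<open>n = deriv W * k\<close>, and
    \<open>ex N * deriv W\<close> is \<open>1/N\<close> times the derivative of \<open>ex N\<close>.
    The boundary terms are exponentially small.\<close>
  have decomp: "\<exists>k. k holomorphic_on B \<and> (\<forall>N\<ge>1. I N f = f T / deriv v T * I N (deriv v)
        + sqrt (real N) * (ex N \<beta> * k \<beta> - ex N \<alpha> * k \<alpha>) / of_nat N - I N (deriv k) / of_nat N)"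
    if f: "f holomorphic_on B" for f
  proof -
    define n where "n t = f t - f T / deriv v T * deriv v t" for t
    have n: "n holomorphic_on B" unfolding n_def using vT0 by (intro holomorphic_intros f v oB) auto
    have nT: "n T = 0" using vT0 by (simp add: n_def)
    define m where "m t = (if t = T then deriv n T else (n t - n T) / (t - T))" for t
    have m: "m holomorphic_on B" unfolding m_def by (rule pole_lemma_open[OF n oB(1)])
    have nm: "n t = (t - T) * m t" for t by (cases "t = T") (auto simp: m_def nT)
    define k where "k t = m t / k1 t" for t
    have k: "k holomorphic_on B" unfolding k_def
      by (intro holomorphic_intros m holomorphic_on_subset[OF k1 BS] k1B)
    have nk: "n t = deriv W t * k t" if "t \<in> B" for t
      using k1B[OF that] dWk[of t] BS that by (auto simp: k_def nm)
    have "I N f = f T / deriv v T * I N (deriv v)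
        + sqrt (real N) * (ex N \<beta> * k \<beta> - ex N \<alpha> * k \<alpha>) / of_nat N - I N (deriv k) / of_nat N" if N: "N \<ge> 1" for N
    proof -
      have der: "((\<lambda>t. ex N t * k t) has_field_derivative of_nat N * (ex N t * n t) + ex N t * deriv k t) (at t within B)" if "t \<in> B" for t
      proof -
        have tS: "t \<in> S" using that BS by auto
        have "((\<lambda>t. exp (of_nat N * W t) * k t) has_field_derivative of_nat N * (ex N t * n t) + ex N t * deriv k t) (at t)"
          using holomorphic_derivI[OF W S tS] holomorphic_derivI[OF k oB(1) that]
          by (auto intro!: derivative_eq_intros simp: ex_def nk[OF that] algebra_simps)
        thus ?thesis by (simp add: ex_def has_field_derivative_at_within)
      qed
      have hc: "((\<lambda>t. of_nat N * (ex N t * n t) + ex N t * deriv k t) has_contour_integral ex N \<beta> * k \<beta> - ex N \<alpha> * k \<alpha>) (linepath \<alpha> \<beta>)"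
        using contour_integral_primitive[of B "\<lambda>t. ex N t * k t", OF der, of "linepath \<alpha> \<beta>"] segB by simp
      have i1: "(\<lambda>t. ex N t * n t) contour_integrable_on linepath \<alpha> \<beta>"
        and i2: "(\<lambda>t. ex N t * deriv k t) contour_integrable_on linepath \<alpha> \<beta>"
        and i3: "(\<lambda>t. ex N t * deriv v t) contour_integrable_on linepath \<alpha> \<beta>"
        by (intro intB holomorphic_intros exholB n k v oB)+
      let ?c = "contour_integral (linepath \<alpha> \<beta>)"
      have "of_nat N * ?c (\<lambda>t. ex N t * n t) + ?c (\<lambda>t. ex N t * deriv k t) = ex N \<beta> * k \<beta> - ex N \<alpha> * k \<alpha>"
        using contour_integral_unique[OF hc] i1 i2
        by (simp add: contour_integral_add contour_integral_lmul contour_integrable_lmul)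
      hence cn: "?c (\<lambda>t. ex N t * n t) = (ex N \<beta> * k \<beta> - ex N \<alpha> * k \<alpha>) / of_nat N - ?c (\<lambda>t. ex N t * deriv k t) / of_nat N"
        using N by (intro complex_solve_linear) auto
      have "(\<lambda>t. ex N t * f t) = (\<lambda>t. f T / deriv v T * (ex N t * deriv v t) + ex N t * n t)"
        by (auto simp: n_def algebra_simps)
      hence cf: "?c (\<lambda>t. ex N t * f t) = f T / deriv v T * ?c (\<lambda>t. ex N t * deriv v t) + ?c (\<lambda>t. ex N t * n t)"
        using i1 i3 by (simp only: contour_integral_add contour_integral_lmul contour_integrable_lmul)
      have dist: "s * (x * c1 + (b / n - c2 / n)) = x * (s * c1) + s * b / n - s * c2 / n" for s x c1 b n c2 :: complex
        by (simp add: algebra_simps)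
      show ?thesis unfolding I_def cf cn by (rule dist)
    qed
    thus ?thesis using k by blast
  qed

  have bdry: "unif_O F UNIV r (\<lambda>N _. sqrt (real N) * (ex N \<beta> * k \<beta> - ex N \<alpha> * k \<alpha>) / of_nat N)" for r and k :: "complex \<Rightarrow> complex"
  proof (rule unif_O_exp_small[OF F \<eta>(1), of _ "norm (k \<beta>) + norm (k \<alpha>)"])
    show "\<forall>\<^sub>F N in F. norm (sqrt (real N) * (ex N \<beta> * k \<beta> - ex N \<alpha> * k \<alpha>) / of_nat N) \<le> (norm (k \<beta>) + norm (k \<alpha>)) * real N * exp (- \<eta> * real N)"
      using evN
    proof eventually_elim
      case (elim N)
      have "norm (ex N \<beta> * k \<beta> - ex N \<alpha> * k \<alpha>) \<le> exp (- \<eta> * real N) * norm (k \<beta>) + exp (- \<eta> * real N) * norm (k \<alpha>)"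
        using \<eta>(2,3)[of N] by (intro norm_triangle_le_diff add_mono) (auto simp: norm_mult intro!: mult_right_mono)
      moreover have "sqrt (real N) / real N \<le> real N"
      proof -
        have "sqrt (real N) \<le> real N" using elim by (simp add: real_le_lsqrt self_le_power)
        also have "\<dots> \<le> real N * real N" using elim by simp
        finally show ?thesis using elim by (simp add: field_simps)
      qed
      ultimately have "(sqrt (real N) / real N) * norm (ex N \<beta> * k \<beta> - ex N \<alpha> * k \<alpha>) \<le> real N * (exp (- \<eta> * real N) * norm (k \<beta>) + exp (- \<eta> * real N) * norm (k \<alpha>))"
        by (intro mult_mono) auto
      moreover have "norm (sqrt (real N) * (ex N \<beta> * k \<beta> - ex N \<alpha> * k \<alpha>) / of_nat N) = (sqrt (real N) / real N) * norm (ex N \<beta> * k \<beta> - ex N \<alpha> * k \<alpha>)"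
        by (simp add: norm_mult norm_divide)
      moreover have "real N * (exp (- \<eta> * real N) * norm (k \<beta>) + exp (- \<eta> * real N) * norm (k \<alpha>)) = (norm (k \<beta>) + norm (k \<alpha>)) * real N * exp (- \<eta> * real N)"
        by (simp add: algebra_simps)
      ultimately show ?case by linarith
    qed
  qed

  \<comment> \<open>A bootstrap: the trivial estimate is only \<open>O(sqrt N)\<close> because of
    the normalising factor, but after one integration by parts that loss meets a factor
    \<open>1/N\<close>.\<close>
  have IO: "unif_O F UNIV 0 (\<lambda>N _. I N f)" if f: "f holomorphic_on B" for f
  proof -
    have crude: "\<exists>C. \<forall>N. norm (I N h) \<le> C * sqrt (real N)" if h: "h holomorphic_on B" for h
    proof -
      have "bounded (h ` closed_segment \<alpha> \<beta>)"
        by (intro compact_imp_bounded compact_continuous_image holomorphic_on_imp_continuous_on holomorphic_on_subset[OF h segB]) auto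
      then obtain C where C: "\<And>t. t \<in> closed_segment \<alpha> \<beta> \<Longrightarrow> norm (h t) \<le> C" by (auto simp: bounded_iff)
      have C0: "C \<ge> 0" using C[of \<alpha>] norm_ge_zero[of "h \<alpha>"] by (meson ends_in_segment(1) order_trans)
      have hb: "norm (contour_integral (linepath \<alpha> \<beta>) (\<lambda>t. ex N t * h t)) \<le> C * norm (\<beta> - \<alpha>)" for N
      proof (rule contour_integral_bound_linepath)
        show "(\<lambda>t. ex N t * h t) contour_integrable_on linepath \<alpha> \<beta>" by (intro intB holomorphic_intros exholB h)
        fix x assume x: "x \<in> closed_segment \<alpha> \<beta>"
        then obtain t where t: "x = of_real t" "t \<in> {t0 - \<delta>..t0 + \<delta>}"
          using segr[of "t0-\<delta>" "t0+\<delta>"] \<delta> by (auto simp: \<alpha>_def \<beta>_def simp del: of_real_add of_real_diff)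
        have "Re (W x) \<le> 0" unfolding t using t \<delta> by (intro ReW0) auto
        hence "norm (ex N x) \<le> 1" by (simp add: ex_def mult_nonneg_nonpos)
        thus "norm (ex N x * h x) \<le> C" using C[OF x] mult_mono[of "norm (ex N x)" 1 "norm (h x)" C] by (simp add: norm_mult)
      qed (use C0 in auto)
      hence "norm (I N h) \<le> (C * norm (\<beta> - \<alpha>)) * sqrt (real N)" for N
      proof -
        have "norm (I N h) = sqrt (real N) * norm (contour_integral (linepath \<alpha> \<beta>) (\<lambda>t. ex N t * h t))"
          by (simp add: I_def norm_mult)
        also have "\<dots> \<le> sqrt (real N) * (C * norm (\<beta> - \<alpha>))"
          by (intro mult_left_mono hb) auto
        finally show ?thesis by (simp add: mult.commute)
      qed
      thus ?thesis by blast
    qed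
    obtain k where k: "k holomorphic_on B" "\<And>N. N \<ge> 1 \<Longrightarrow> I N f = f T / deriv v T * I N (deriv v)
        + sqrt (real N) * (ex N \<beta> * k \<beta> - ex N \<alpha> * k \<alpha>) / of_nat N - I N (deriv k) / of_nat N"
      using decomp[OF f] by blast
    have dk: "deriv k holomorphic_on B" by (intro holomorphic_intros k oB)
    obtain C where C: "\<And>N. norm (I N (deriv k)) \<le> C * sqrt (real N)" using crude[OF dk] by blast
    have "unif_O F UNIV 0 (\<lambda>N _. I N (deriv k) / of_nat N)"
    proof (rule unif_OI)
      fix K :: "complex set"
      have "\<forall>\<^sub>F N in F. \<forall>x\<in>K. norm (I N (deriv k) / of_nat N) \<le> \<bar>C\<bar> / real N ^ 0"
        using evN
      proof eventually_elim
        case (elim N)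
        have "norm (I N (deriv k)) \<le> \<bar>C\<bar> * sqrt (real N)" using C[of N] by (smt (verit) mult_right_mono real_sqrt_ge_zero of_nat_0_le_iff)
        also have "\<dots> \<le> \<bar>C\<bar> * real N" using elim by (intro mult_left_mono) (auto simp: real_le_lsqrt self_le_power)
        finally show ?case using elim by (simp add: norm_divide field_simps)
      qed
      thus "\<exists>C. \<forall>\<^sub>F N in F. \<forall>x\<in>K. norm (I N (deriv k) / of_nat N) \<le> C / real N ^ 0" ..
    qed
    hence "unif_O F UNIV 0 (\<lambda>N _. f T / deriv v T * I N (deriv v)
        + sqrt (real N) * (ex N \<beta> * k \<beta> - ex N \<alpha> * k \<alpha>) / of_nat N - I N (deriv k) / of_nat N)"
      using asy_O0[OF asy_cmult[OF Iv[of 0], of "\<lambda>_. f T / deriv v T"] F] F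
      by (intro unif_O_diff unif_O_add bdry) auto
    thus ?thesis
      by (rule unif_O_cong) (use evN in \<open>eventually_elim, simp add: k(2)\<close>)
  qed

  have Iasy: "asy F UNIV r (\<lambda>N _. I N f) (\<lambda>_. sqrt pi * f T / deriv v T)" if f: "f holomorphic_on B" for f :: "complex \<Rightarrow> complex" and r
    using f
  proof (induction r arbitrary: f)
    case 0
    have "unif_O F UNIV 0 (\<lambda>N _. I N f - sqrt pi * f T / deriv v T)"
      by (intro unif_O_diff IO unif_O_const continuous_intros 0)
    thus ?case by (rule asyI[OF lpoly.const, rotated]) auto
  next
    case (Suc r)
    obtain k where k: "k holomorphic_on B" "\<And>N. N \<ge> 1 \<Longrightarrow> I N f = f T / deriv v T * I N (deriv v)
        + sqrt (real N) * (ex N \<beta> * k \<beta> - ex N \<alpha> * k \<alpha>) / of_nat N - I N (deriv k) / of_nat N"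
      using decomp[OF Suc.prems] by blast
    have dk: "deriv k holomorphic_on B" by (intro holomorphic_intros k oB)
    have "asy F UNIV (Suc r) (\<lambda>N x. f T / deriv v T * I N (deriv v)
        + (sqrt (real N) * (ex N \<beta> * k \<beta> - ex N \<alpha> * k \<alpha>) / of_nat N + -1 * (I N (deriv k) / of_nat N)))
      (\<lambda>x. f T / deriv v T * sqrt pi + (0 + -1 * 0))"
      by (intro asy_add asy_cmult[OF Iv] asy_small[OF bdry] asy_cmult[OF asy_shift[OF Suc.IH[OF dk]]] F holomorphic_intros)
    hence "asy F UNIV (Suc r) (\<lambda>N x. f T / deriv v T * I N (deriv v)
        + (sqrt (real N) * (ex N \<beta> * k \<beta> - ex N \<alpha> * k \<alpha>) / of_nat N + -1 * (I N (deriv k) / of_nat N)))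
      (\<lambda>x. sqrt pi * f T / deriv v T)" by (simp add: mult.commute)
    thus ?case
      by (rule asy_cong) (use evN in \<open>eventually_elim, simp add: k(2)\<close>)
  qed

  define J where "J N f = sqrt (real N) * contour_integral (linepath (complex_of_real a) (complex_of_real b)) (\<lambda>t. ex N t * f t)" for N :: nat and f :: "complex \<Rightarrow> complex"
  have abS: "closed_segment (complex_of_real a) (of_real b) \<subseteq> S" using seg t0 by (simp add: segr)
  have intS: "f contour_integrable_on linepath (complex_of_real a) (complex_of_real b)" if "continuous_on S f" for f
    by (intro contour_integrable_continuous_linepath continuous_on_subset[OF that abS])

  have outer: "\<exists>\<eta>>0. \<exists>C. \<forall>N\<ge>1. norm (sqrt (real N) * contour_integral (linepath (of_real s) (of_real t)) (\<lambda>t. ex N t * f t)) \<le> C * real N * exp (- \<eta> * real N)"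
    if st: "s \<le> t" "{s..t} \<subseteq> {a..b}" "t0 \<notin> {s..t}" and f: "f holomorphic_on S" for s t :: real and f :: "complex \<Rightarrow> complex"
  proof -
    have sS: "closed_segment (complex_of_real s) (of_real t) \<subseteq> S" using seg st by (auto simp: segr)
    have "continuous_on {s..t} (\<lambda>u. Re (W (of_real u)))"
      using sS st by (intro continuous_intros continuous_on_compose2[OF holomorphic_on_imp_continuous_on[OF W]]) (auto simp: segr)
    then obtain u where u: "u \<in> {s..t}" "\<And>y. y \<in> {s..t} \<Longrightarrow> Re (W (of_real y)) \<le> Re (W (of_real u))"
      using continuous_attains_sup[of "{s..t}" "\<lambda>u. Re (W (of_real u))"] st by auto
    define \<eta>0 where "\<eta>0 = - Re (W (of_real u))"
    have \<eta>0: "\<eta>0 > 0" using ReW[of u] u st by (auto simp: \<eta>0_def)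
    have "bounded (f ` closed_segment (complex_of_real s) (of_real t))"
      by (intro compact_imp_bounded compact_continuous_image holomorphic_on_imp_continuous_on holomorphic_on_subset[OF f sS]) auto
    then obtain C where C: "\<And>x. x \<in> closed_segment (complex_of_real s) (of_real t) \<Longrightarrow> norm (f x) \<le> C" by (auto simp: bounded_iff)
    have C0: "C \<ge> 0" using C[of "of_real s"] norm_ge_zero[of "f (of_real s)"] by (meson ends_in_segment(1) order_trans)
    have ob: "norm (contour_integral (linepath (of_real s) (of_real t)) (\<lambda>t. ex N t * f t)) \<le> exp (- \<eta>0 * real N) * C * norm (complex_of_real t - of_real s)" for N
    proof (rule contour_integral_bound_linepath)
      show "(\<lambda>t. ex N t * f t) contour_integrable_on linepath (of_real s) (of_real t)"
        by (intro contour_integrable_continuous_linepath holomorphic_on_imp_continuous_on holomorphic_on_subset[OF _ sS] holomorphic_intros exhol f)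
      fix x assume x: "x \<in> closed_segment (complex_of_real s) (of_real t)"
      then obtain y where y: "x = of_real y" "y \<in> {s..t}" using st by (auto simp: segr)
      have "Re (W x) \<le> - \<eta>0" using u(2)[OF y(2)] y by (simp add: \<eta>0_def)
      hence "real N * Re (W x) \<le> real N * (- \<eta>0)" by (intro mult_left_mono) auto
      hence "norm (ex N x) \<le> exp (- \<eta>0 * real N)" by (simp add: ex_def mult.commute)
      thus "norm (ex N x * f x) \<le> exp (- \<eta>0 * real N) * C"
        unfolding norm_mult using C[OF x] by (intro mult_mono) auto
    qed (use C0 in auto)
    have "norm (sqrt (real N) * contour_integral (linepath (of_real s) (of_real t)) (\<lambda>t. ex N t * f t)) \<le> (C * norm (complex_of_real t - of_real s)) * real N * exp (- \<eta>0 * real N)" if "N \<ge> 1" for N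
    proof -
      have "sqrt (real N) \<le> real N" using that by (simp add: real_le_lsqrt self_le_power)
      hence "sqrt (real N) * norm (contour_integral (linepath (of_real s) (of_real t)) (\<lambda>t. ex N t * f t)) \<le> real N * (exp (- \<eta>0 * real N) * C * norm (complex_of_real t - of_real s))"
        using ob[of N] by (intro mult_mono) auto
      thus ?thesis by (simp add: norm_mult mult_ac)
    qed
    thus ?thesis using \<eta>0 by blast
  qed

  have Jasy: "asy F UNIV r (\<lambda>N _. J N f) (\<lambda>_. sqrt pi * f T / deriv v T)" if f: "f holomorphic_on S" for f :: "complex \<Rightarrow> complex" and r
  proof -
    define J1 J2 where "J1 N = sqrt (real N) * contour_integral (linepath (of_real a) \<alpha>) (\<lambda>t. ex N t * f t)"
      and "J2 N = sqrt (real N) * contour_integral (linepath \<beta> (of_real b)) (\<lambda>t. ex N t * f t)" for N :: nat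
    have cont: "continuous_on S (\<lambda>t. ex N t * f t)" for N
      by (intro holomorphic_on_imp_continuous_on holomorphic_intros exhol f)
    have JJ: "J N f = I N f + (J1 N + J2 N)" for N
    proof -
      have s1: "\<alpha> \<in> closed_segment (of_real a) (of_real b)" "\<beta> \<in> closed_segment \<alpha> (of_real b)"
        unfolding \<alpha>_def \<beta>_def using \<delta> by (auto simp: segr simp del: of_real_add of_real_diff)
      have c1: "continuous_on (closed_segment (complex_of_real a) (of_real b)) (\<lambda>t. ex N t * f t)"
        by (rule continuous_on_subset[OF cont abS])
      have c2: "continuous_on (closed_segment \<alpha> (of_real b)) (\<lambda>t. ex N t * f t)"
        by (rule continuous_on_subset[OF c1]) (use s1 in \<open>auto simp: subset_closed_segment\<close>)
      show ?thesis
        unfolding J_def I_def J1_def J2_def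
        using contour_integral_split_linepath[OF c1 s1(1)] contour_integral_split_linepath[OF c2 s1(2)]
        by (simp add: algebra_simps)
    qed
    have "unif_O F UNIV r (\<lambda>N _. J1 N)"
    proof -
      obtain \<eta>1 C where "\<eta>1 > 0" "\<And>N. N \<ge> 1 \<Longrightarrow> norm (J1 N) \<le> C * real N * exp (- \<eta>1 * real N)"
        using outer[of a "t0 - \<delta>" f] f \<delta> t0 unfolding J1_def \<alpha>_def by auto
      thus ?thesis using evN by (intro unif_O_exp_small[OF F, of \<eta>1 _ C]) (auto elim: eventually_mono)
    qed
    moreover have "unif_O F UNIV r (\<lambda>N _. J2 N)"
    proof -
      obtain \<eta>1 C where "\<eta>1 > 0" "\<And>N. N \<ge> 1 \<Longrightarrow> norm (J2 N) \<le> C * real N * exp (- \<eta>1 * real N)"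
        using outer[of "t0 + \<delta>" b f] f \<delta> t0 unfolding J2_def \<beta>_def by auto
      thus ?thesis using evN by (intro unif_O_exp_small[OF F, of \<eta>1 _ C]) (auto elim: eventually_mono)
    qed
    ultimately have "asy F UNIV r (\<lambda>N _. I N f + (J1 N + J2 N)) (\<lambda>_. sqrt pi * f T / deriv v T + 0)"
      by (intro asy_add[OF Iasy asy_small] unif_O_add holomorphic_on_subset[OF f BS])
    thus ?thesis by (simp add: JJ)
  qed

  \<comment> \<open>One order more than requested: the factor \<open>sqrt (real N)\<close> in
    \<open>J\<close> costs at most one power of \<open>N\<close>.\<close>
  obtain G where G: "lpoly S G c" "unif_O F S (Suc r) (\<lambda>N x. g N x - G N x)"
    using g[of "Suc r"] unfolding asy_def by blast
  have JG: "asy F UNIV r (\<lambda>N _. J N (G N)) (\<lambda>_. sqrt pi * c T / deriv v T)"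
    using G(1)
  proof (induction rule: lpoly.induct)
    case (const h)
    thus ?case by (rule Jasy)
  next
    case (shift G c)
    have "J N (\<lambda>x. G N x / of_nat N) = J N (G N) / of_nat N" for N
    proof -
      have "(\<lambda>t. ex N t * G N t) contour_integrable_on linepath (complex_of_real a) (complex_of_real b)"
        using lpoly_holomorphic[OF shift.hyps] by (intro intS holomorphic_on_imp_continuous_on holomorphic_intros exhol) auto
      thus ?thesis using contour_integral_div[of "\<lambda>t. ex N t * G N t" "linepath (complex_of_real a) (complex_of_real b)" "of_nat N"] by (simp add: J_def)
    qed
    thus ?case using asy_mono[OF asy_shift[OF shift.IH], of r] F by simp
  next
    case (add G c G' c')
    have "J N (\<lambda>x. G N x + G' N x) = J N (G N) + J N (G' N)" for N
    proof -
      have "(\<lambda>t. ex N t * G N t) contour_integrable_on linepath (complex_of_real a) (complex_of_real b)" "(\<lambda>t. ex N t * G' N t) contour_integrable_on linepath (complex_of_real a) (complex_of_real b)"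
        using lpoly_holomorphic[OF add.hyps(1)] lpoly_holomorphic[OF add.hyps(2)]
        by (intro intS holomorphic_on_imp_continuous_on holomorphic_intros exhol; simp)+
      thus ?thesis by (simp add: J_def contour_integral_add distrib_left)
    qed
    thus ?case using asy_add[OF add.IH] by (simp add: add_divide_distrib distrib_left)
  qed
  have err: "unif_O F UNIV r (\<lambda>N _. J N (\<lambda>x. g N x - G N x))"
  proof (rule unif_OI)
    fix K :: "complex set"
    obtain C where C: "C \<ge> 0" "\<forall>\<^sub>F N in F. \<forall>x\<in>closed_segment (complex_of_real a) (of_real b). norm (g N x - G N x) \<le> C / real N ^ Suc r"
      using unif_OE[OF G(2) compact_segment abS] by blast
    have "\<forall>\<^sub>F N in F. \<forall>x\<in>K. norm (J N (\<lambda>x. g N x - G N x)) \<le> (C * (b - a)) / real N ^ r"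
      using C(2) evN
    proof eventually_elim
      case (elim N)
      have "norm (contour_integral (linepath (complex_of_real a) (complex_of_real b)) (\<lambda>t. ex N t * (g N t - G N t))) \<le> C / real N ^ Suc r * norm (complex_of_real b - of_real a)"
      proof (rule contour_integral_bound_linepath)
        have "continuous_on S (\<lambda>t. g N t - G N t)"
          using lpoly_holomorphic[OF G(1)] by (intro continuous_intros gcont holomorphic_on_imp_continuous_on) auto
        thus "(\<lambda>t. ex N t * (g N t - G N t)) contour_integrable_on linepath (complex_of_real a) (complex_of_real b)"
          by (intro intS continuous_on_mult[OF holomorphic_on_imp_continuous_on[OF exhol]])
        fix x assume x: "x \<in> closed_segment (complex_of_real a) (of_real b)"
        then obtain t where t: "x = of_real t" "t \<in> {a..b}" using t0 by (auto simp: segr)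
        have "Re (W x) \<le> 0" unfolding t using t by (intro ReW0) auto
        hence "norm (ex N x) \<le> 1" by (simp add: ex_def mult_nonneg_nonpos)
        thus "norm (ex N x * (g N x - G N x)) \<le> C / real N ^ Suc r"
          using elim(1) x mult_mono[of "norm (ex N x)" 1 "norm (g N x - G N x)" "C / real N ^ Suc r"] by (simp add: norm_mult)
      qed (use C in auto)
      also have "norm (complex_of_real b - of_real a) = b - a" using t0 by (metis abs_of_pos diff_gt_0_iff_gt less_trans norm_of_real of_real_diff)
      finally have "norm (J N (\<lambda>x. g N x - G N x)) \<le> real N * (C / real N ^ Suc r * (b - a))"
        unfolding J_def norm_mult using elim(2) by (intro mult_mono) (auto simp: real_le_lsqrt self_le_power)
      also have "\<dots> = (C * (b - a)) / real N ^ r" using elim(2) by simp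
      finally show ?case by simp
    qed
    thus "\<exists>C. \<forall>\<^sub>F N in F. \<forall>x\<in>K. norm (J N (\<lambda>x. g N x - G N x)) \<le> C / real N ^ r" ..
  qed
  have "J N (G N) + J N (\<lambda>x. g N x - G N x) = sqrt (real N) * (exp (- of_nat N * p t0) *
            contour_integral (linepath (complex_of_real a) (complex_of_real b)) (\<lambda>t. exp (of_nat N * p t) * g N t))" for N
  proof -
    have i1: "(\<lambda>t. ex N t * G N t) contour_integrable_on linepath (complex_of_real a) (complex_of_real b)" 
      using lpoly_holomorphic[OF G(1)] by (intro intS holomorphic_on_imp_continuous_on holomorphic_intros exhol) auto
    have "continuous_on S (\<lambda>t. g N t - G N t)"
      using lpoly_holomorphic[OF G(1)] by (intro continuous_intros gcont holomorphic_on_imp_continuous_on) auto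
    hence i2: "(\<lambda>t. ex N t * (g N t - G N t)) contour_integrable_on linepath (complex_of_real a) (complex_of_real b)"
      by (intro intS continuous_on_mult[OF holomorphic_on_imp_continuous_on[OF exhol]])
    have i3: "(\<lambda>t. exp (of_nat N * p t) * g N t) contour_integrable_on linepath (complex_of_real a) (complex_of_real b)"
      by (intro intS continuous_intros holomorphic_on_imp_continuous_on[OF p] gcont)
    have "J N (G N) + J N (\<lambda>x. g N x - G N x) = sqrt (real N) * contour_integral (linepath (complex_of_real a) (complex_of_real b)) (\<lambda>t. ex N t * G N t + ex N t * (g N t - G N t))"
      unfolding J_def by (subst contour_integral_add[OF i1 i2]) (simp add: distrib_left)
    also have "(\<lambda>t. ex N t * G N t + ex N t * (g N t - G N t)) = (\<lambda>t. exp (- of_nat N * p t0) * (exp (of_nat N * p t) * g N t))"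
      by (auto simp: ex_def W_def T_def algebra_simps exp_diff exp_minus field_simps)
    also have "contour_integral (linepath (complex_of_real a) (complex_of_real b)) \<dots> = exp (- of_nat N * p t0) * contour_integral (linepath (complex_of_real a) (complex_of_real b)) (\<lambda>t. exp (of_nat N * p t) * g N t)"
      by (rule contour_integral_lmul[OF i3])
    finally show ?thesis .
  qed
  moreover have "asy F UNIV r (\<lambda>N _. J N (G N) + J N (\<lambda>x. g N x - G N x)) (\<lambda>_. sqrt pi * c T / deriv v T + 0)"
    by (intro asy_add JG asy_small err)
  ultimately show ?thesis unfolding T_def[symmetric] by (simp add: dvT qT)
qed

section \<open>The asymptotic form of the inverse q-Pochhammer symbol\<close>

text \<open>The set is star-shaped about 0, so sample points of radial Riemann sums stay inside, and
  on it the principal logarithms of \<open>expm1_over\<close> and \<open>1 + exp\<close> are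
  holomorphic. Apart from 0 it contains no zero of the substituted product.\<close>

definition slit_dom :: "complex set" where
  "slit_dom = {u. Re u < 0 \<or> \<bar>Im u\<bar> < pi}"

lemma open_slit_dom: "open slit_dom"
proof -
  have eq: "slit_dom = {u. Re u < 0} \<union> ({u. Im u < pi} \<inter> {u. Im u > - pi})"
    by (auto simp: slit_dom_def)
  show ?thesis unfolding eq
    by (intro open_Un open_Int open_halfspace_Re_lt open_halfspace_Im_lt open_halfspace_Im_gt)
qed

lemma slit_dom_scale:
  assumes "x \<in> slit_dom" "t \<in> {0..1::real}"
  shows "of_real t * x \<in> slit_dom"
proof (cases "t = 0")
  case False
  hence t: "t > 0" "t \<le> 1" using assms by auto
  have "\<bar>t * Im x\<bar> \<le> \<bar>Im x\<bar>" using t by (simp add: abs_mult mult_left_le_one_le)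
  thus ?thesis using assms(1) t by (auto simp: slit_dom_def mult_pos_neg)
qed (simp add: slit_dom_def)

lemma slit_dom_segment: "x \<in> slit_dom \<Longrightarrow> closed_segment 0 x \<subseteq> slit_dom"
  using slit_dom_scale by (auto simp: closed_segment_def scaleR_conv_of_real)

definition expm1_over :: "complex \<Rightarrow> complex" where
  "expm1_over u = (if u = 0 then 1 else (exp u - 1) / u)"

lemma expm1_over_holomorphic: "expm1_over holomorphic_on S"
proof -
  have "(\<lambda>z. if z = 0 then deriv exp 0 else (exp z - exp 0) / (z - 0)) holomorphic_on (UNIV :: complex set)"
    by (intro pole_lemma_open holomorphic_intros) auto
  moreover have "deriv exp (0::complex) = 1" using DERIV_imp_deriv[OF DERIV_exp[of 0]] by simp
  hence "expm1_over = (\<lambda>z. if z = 0 then deriv exp 0 else (exp z - exp 0) / (z - 0))"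
    by (intro ext) (simp add: expm1_over_def)
  ultimately have "expm1_over holomorphic_on UNIV" by simp
  thus ?thesis by (rule holomorphic_on_subset) auto
qed

lemma one_minus_exp: "1 - exp u = - u * expm1_over u"
  by (simp add: expm1_over_def)

lemma one_minus_exp_Re_pos:
  assumes "Re u < 0"
  shows "Re (1 - exp u) > 0" "Re (1 + exp u) > 0"
proof -
  have "\<bar>Re (exp u)\<bar> \<le> norm (exp u)" by (rule abs_Re_le_cmod)
  also have "\<dots> < 1" using assms by simp
  finally show "Re (1 - exp u) > 0" "Re (1 + exp u) > 0" by auto
qed

text \<open>Both \<open>1 - exp u\<close> and \<open>- u\<close> have positive real part, so their
  arguments differ by less than \<open>pi\<close> and the principal logarithm of the quotient is the
  difference of the logarithms.\<close>

lemma Ln_expm1_over_left: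
  assumes "Re u < 0"
  shows "expm1_over u \<notin> \<real>\<^sub>\<le>\<^sub>0" "Ln (expm1_over u) = Ln (1 - exp u) - Ln (- u)"
proof -
  have u0: "u \<noteq> 0" using assms by auto
  have nz: "1 - exp u \<noteq> 0" using one_minus_exp_Re_pos[OF assms] by auto
  have i1: "\<bar>Im (Ln (1 - exp u))\<bar> < pi / 2" 
    using Re_Ln_pos_lt[OF nz] one_minus_exp_Re_pos(1)[OF assms] by (rule iffD2)
  have i2: "\<bar>Im (Ln (- u))\<bar> < pi / 2" using assms u0 by (subst Re_Ln_pos_lt) auto
  have ex: "expm1_over u = exp (Ln (1 - exp u) - Ln (- u))"
    using u0 nz by (simp add: exp_diff expm1_over_def) (simp add: field_simps)
  have im: "\<bar>Im (Ln (1 - exp u) - Ln (- u))\<bar> < pi" using i1 i2 by auto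
  show L: "Ln (expm1_over u) = Ln (1 - exp u) - Ln (- u)"
    unfolding ex by (rule Ln_exp) (use im in auto)
  show "expm1_over u \<notin> \<real>\<^sub>\<le>\<^sub>0"
  proof
    assume a: "expm1_over u \<in> \<real>\<^sub>\<le>\<^sub>0"
    define w where "w = Ln (1 - exp u) - Ln (- u)"
    have "sin (Im w) = 0" using a by (simp add: ex w_def[symmetric] complex_nonpos_Reals_iff Im_exp)
    hence "Im w = 0" using im sin_eq_0_pi unfolding w_def[symmetric] by auto
    hence "Re (exp w) > 0" by (simp add: Re_exp)
    thus False using a by (simp add: ex w_def[symmetric] complex_nonpos_Reals_iff)
  qed
qed

lemma x_cos_less_sin: "x * cos x < sin x" if "0 < x" "x < pi" for x :: real
proof -
  have "(\<lambda>t. sin t - t * cos t) 0 < (\<lambda>t. sin t - t * cos t) x"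
  proof (rule DERIV_pos_imp_increasing_open[OF that(1)])
    fix t assume t: "0 < t" "t < x"
    have "((\<lambda>t. sin t - t * cos t) has_real_derivative t * sin t) (at t)"
      by (auto intro!: derivative_eq_intros)
    moreover have "t * sin t > 0" using t that by (intro mult_pos_pos sin_gt_zero) auto
    ultimately show "\<exists>d. ((\<lambda>t. sin t - t * cos t) has_real_derivative d) (at t) \<and> d > 0" by blast
  qed (intro continuous_intros)
  thus ?thesis by simp
qed

text \<open>On the real axis the quotient is positive. Off it the imaginary part cannot vanish; this
  is tested on \<open>(exp u - 1) * cnj u\<close>, a positive multiple of the quotient.\<close>

lemma expm1_over_strip:
  assumes "Re u \<ge> 0" "\<bar>Im u\<bar> < pi"
  shows "expm1_over u \<notin> \<real>\<^sub>\<le>\<^sub>0"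
proof (cases "Im u = 0")
  case True
  then obtain s where s: "u = of_real s" "s \<ge> 0" using assms by (metis complex_is_Real_iff Reals_cases Re_complex_of_real)
  show ?thesis
  proof (cases "s = 0")
    case False
    have "expm1_over u = of_real ((exp s - 1) / s)" using s False by (simp add: expm1_over_def exp_of_real)
    moreover have "(exp s - 1) / s > 0" using s False by (intro divide_pos_pos) auto
    ultimately show ?thesis by (simp add: nonpos_Reals_of_real_iff del: of_real_divide of_real_diff)
  qed (use s in \<open>auto simp: expm1_over_def\<close>)
next
  case False
  define s y where "s = Re u" and "y = Im u"
  have u: "u = Complex s y" by (simp add: s_def y_def)
  have u0: "u \<noteq> 0" using False by auto
  \<comment> \<open>After division by \<open>exp s\<close> the claim reads
    \<open>y * exp (- s) + s * sin y > y * cos y\<close>. The first summand is at least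
    \<open>(1 - s) * sin y\<close>, which reduces it to \<open>sin y > y * cos y\<close>.\<close>
  have key: "s * exp s * sin y - y * (exp s * cos y - 1) > 0" if y: "0 < y" "y < pi" for y
  proof -
    have siny: "sin y > 0" using y by (simp add: sin_gt_zero)
    have "sin y > y * cos y" by (rule x_cos_less_sin[OF y])
    moreover have "y * exp (- s) \<ge> sin y * (1 - s)"
    proof -
      have "sin y * (1 - s) \<le> sin y * exp (- s)" using siny exp_ge_add_one_self[of "- s"] by (intro mult_left_mono) auto
      also have "\<dots> \<le> y * exp (- s)" using y sin_x_le_x[of y] by (intro mult_right_mono) auto
      finally show ?thesis .
    qed
    ultimately have "y * exp (- s) + s * sin y - y * cos y > 0" by (simp add: algebra_simps)
    hence "exp s * (y * exp (- s) + s * sin y - y * cos y) > 0" by simp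
    moreover have "exp s * exp (- s) = 1" by (simp flip: exp_add)
    hence "exp s * (y * exp (- s) + s * sin y - y * cos y) = s * exp s * sin y - y * (exp s * cos y - 1)"
      by (simp add: algebra_simps)
    ultimately show ?thesis by simp
  qed
  have "Im ((exp u - 1) * cnj u) = s * exp s * sin y - y * (exp s * cos y - 1)"
    by (simp add: u Re_exp Im_exp)
  moreover have "s * exp s * sin y - y * (exp s * cos y - 1) \<noteq> 0"
  proof (cases "y > 0")
    case True
    thus ?thesis using key[of y] assms by (simp add: y_def)
  next
    case False
    hence "- y > 0" "- y < pi" using \<open>Im u \<noteq> 0\<close> assms by (auto simp: y_def)
    from key[OF this] show ?thesis by simp
  qed
  ultimately have im: "Im ((exp u - 1) * cnj u) \<noteq> 0" by simp
  have "(exp u - 1) * cnj u = expm1_over u * of_real ((norm u)\<^sup>2)"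
  proof -
    have "of_real ((norm u)\<^sup>2) = u * cnj u" by (metis complex_norm_square of_real_power)
    thus ?thesis using u0 by (simp add: expm1_over_def)
  qed
  hence "Im ((exp u - 1) * cnj u) = Im (expm1_over u) * (norm u)\<^sup>2" by (simp del: of_real_power)
  thus ?thesis using im by (auto simp: complex_nonpos_Reals_iff)
qed

lemma expm1_over_not_nonpos: "u \<in> slit_dom \<Longrightarrow> expm1_over u \<notin> \<real>\<^sub>\<le>\<^sub>0"
  using expm1_over_strip[of u] Ln_expm1_over_left(1)[of u] by (cases "Re u < 0") (auto simp: slit_dom_def)

text \<open>A bad value forces \<open>exp u \<le> -1\<close>, hence \<open>Re u \<ge> 0\<close>; but
  then \<open>u\<close> lies in the strip, where a real value of \<open>exp u\<close> is
  positive.\<close>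

lemma one_plus_exp_not_nonpos:
  assumes "u \<in> slit_dom"
  shows "1 + exp u \<notin> \<real>\<^sub>\<le>\<^sub>0"
proof
  assume "1 + exp u \<in> \<real>\<^sub>\<le>\<^sub>0"
  hence re: "Re (exp u) \<le> -1" and im: "Im (exp u) = 0" by (auto simp: complex_nonpos_Reals_iff)
  have "\<bar>Re (exp u)\<bar> \<le> norm (exp u)" by (rule abs_Re_le_cmod)
  hence "exp (Re u) \<ge> 1" using re unfolding norm_exp_eq_Re by linarith
  hence "Re u \<ge> 0" by simp
  hence y: "\<bar>Im u\<bar> < pi" using assms by (auto simp: slit_dom_def)
  have "sin (Im u) = 0" using im by (simp add: Im_exp)
  hence "Im u = 0" using y sin_eq_0_pi by auto
  thus False using re by (simp add: Re_exp) (smt (verit) exp_gt_zero)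
qed

definition log_odd :: "complex \<Rightarrow> complex" where "log_odd u = Ln (1 + exp u)"
text \<open>The term \<open>log_odd\<close> will be summed over all \<open>k\<close> and not only
  the odd ones, because a full Riemann sum with step \<open>x / N\<close> is easier to expand. The
  even surplus is taken back here by the second logarithm.\<close>

definition log_even :: "complex \<Rightarrow> complex" where "log_even u = Ln (expm1_over u) - Ln (1 + exp u)"

lemma log_odd_holomorphic: "log_odd holomorphic_on slit_dom"
  unfolding log_odd_def[abs_def] using one_plus_exp_not_nonpos by (intro holomorphic_intros) auto

lemma log_even_holomorphic: "log_even holomorphic_on slit_dom"
  unfolding log_even_def[abs_def] using one_plus_exp_not_nonpos expm1_over_not_nonpos
  by (intro holomorphic_intros expm1_over_holomorphic) auto

lemma slit_dom_primitive:
  assumes "f holomorphic_on slit_dom"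
  shows "\<exists>g. (\<forall>u\<in>slit_dom. (g has_field_derivative f u) (at u)) \<and> g 0 = 0"
proof -
  have "starlike slit_dom" unfolding starlike_def
    using slit_dom_segment by (intro bexI[of _ 0]) (auto simp: slit_dom_def)
  then obtain g where g: "\<forall>u\<in>slit_dom. (g has_field_derivative f u) (at u)"
    using holomorphic_starlike_primitive[OF holomorphic_on_imp_continuous_on[OF assms] _ open_slit_dom, of "{}"]
      holomorphic_on_imp_differentiable_at[OF assms open_slit_dom] by blast
  have "((\<lambda>u. g u - g 0) has_field_derivative f u) (at u)" if "u \<in> slit_dom" for u
    using g that by (auto intro!: derivative_eq_intros)
  thus ?thesis by (intro exI[of _ "\<lambda>u. g u - g 0"]) auto
qed

definition slit_primitive :: "(complex \<Rightarrow> complex) \<Rightarrow> complex \<Rightarrow> complex" where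
  "slit_primitive f = (SOME g. (\<forall>u\<in>slit_dom. (g has_field_derivative f u) (at u)) \<and> g 0 = 0)"

lemma slit_primitive:
  assumes "f holomorphic_on slit_dom"
  shows "u \<in> slit_dom \<Longrightarrow> (slit_primitive f has_field_derivative f u) (at u)"
    "slit_primitive f 0 = 0" "slit_primitive f holomorphic_on slit_dom"
proof -
  have *: "(\<forall>u\<in>slit_dom. (slit_primitive f has_field_derivative f u) (at u)) \<and> slit_primitive f 0 = 0"
    unfolding slit_primitive_def by (rule someI_ex[OF slit_dom_primitive[OF assms]])
  thus "u \<in> slit_dom \<Longrightarrow> (slit_primitive f has_field_derivative f u) (at u)" "slit_primitive f 0 = 0" by auto
  show "slit_primitive f holomorphic_on slit_dom"
    using * open_slit_dom by (auto simp: holomorphic_on_open)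
qed

text \<open>The odd part is the full product of \<open>1 + y k\<close> divided by its even part; the
  identity is cross-multiplied, so that it holds for arbitrary \<open>y\<close> and admits a plain
  induction.\<close>

lemma qpoch_split_even_odd:
  fixes y :: "nat \<Rightarrow> complex"
  shows "(\<Prod>k=1..N. 1 - (-1) ^ k * y k) * (\<Prod>k=1..N div 2. 1 + y (2 * k))
       = (\<Prod>k=1..N div 2. 1 - y (2 * k)) * (\<Prod>k=1..N. 1 + y k)"
proof (induction N)
  case (Suc N)
  show ?case
  proof (cases "even N")
    case True
    hence "Suc N div 2 = N div 2" by simp
    thus ?thesis using Suc True by (simp add: mult_ac; simp add: mult.assoc[symmetric])
  next
    case False
    then obtain j where j: "N = 2 * j + 1" by (metis oddE)
    hence "Suc N div 2 = Suc (N div 2)" "2 * Suc (N div 2) = Suc N" "even (Suc N)" by auto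
    thus ?thesis using Suc by (simp add: mult_ac; simp add: mult.assoc[symmetric])
  qed
qed simp

text \<open>Each even factor is \<open>- w * expm1_over w\<close> with
  \<open>w = 2 * k * x / N\<close>. The product of the factors \<open>- w\<close> is the explicit
  prefactor with its factorial, and everything else is the exponential of holomorphic
  logarithms.\<close>

lemma qpoch_exp_formula:
  assumes x: "x \<in> slit_dom" and N: "N \<ge> 1"
  defines "n \<equiv> N div 2"
  shows "qpoch N (- exp (x / of_nat N)) = (- 2 * x / of_nat N) ^ n * fact n *
     exp ((\<Sum>k=1..n. log_even (of_nat k * (of_nat 2 * x / of_nat N))) + (\<Sum>k=1..N. log_odd (of_nat k * (of_nat 1 * x / of_nat N))))"
proof -
  define z where "z = x / of_nat N"
  have mem: "of_nat k * z \<in> slit_dom" if "k \<le> N" for k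
  proof -
    have "of_nat k * z = of_real (real k / real N) * x" by (simp add: z_def)
    thus ?thesis using slit_dom_scale[OF x, of "real k / real N"] that N by simp
  qed
  define y where "y k = exp (of_nat k * z)" for k
  have e1: "1 + y k = exp (log_odd (of_nat k * z))" if "k \<le> N" for k
  proof -
    have "1 + y k \<noteq> 0" using one_plus_exp_not_nonpos[OF mem[OF that]] by (auto simp: y_def)
    thus ?thesis by (simp add: log_odd_def y_def)
  qed
  have e2: "1 - y (2 * k) = (- 2 * x / of_nat N * of_nat k) * exp (log_even (of_nat k * (2 * z))) * (1 + y (2 * k))" if "2 * k \<le> N" for k
  proof -
    define w where "w = of_nat (2 * k) * z"
    have nz: "expm1_over w \<noteq> 0" "1 + exp w \<noteq> 0"
      using expm1_over_not_nonpos[OF mem[OF that]] one_plus_exp_not_nonpos[OF mem[OF that]] by (auto simp: w_def)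
    have w: "of_nat k * (2 * z) = w" "y (2 * k) = exp w" "- 2 * x / of_nat N * of_nat k = - w"
      by (simp_all add: w_def y_def z_def)
    have "exp (log_even w) * (1 + exp w) = expm1_over w"
      using nz by (simp add: log_even_def exp_diff)
    thus ?thesis unfolding w using one_minus_exp[of w] by (simp add: mult.assoc)
  qed
  have "qpoch N (- exp z) = (\<Prod>k=1..N. 1 - (-1) ^ k * y k)"
    unfolding qpoch_def
  proof (intro prod.cong refl)
    fix k
    have "(- exp z) ^ k = (-1) ^ k * exp z ^ k" by (rule power_minus)
    thus "1 - (- exp z) ^ k = 1 - (-1) ^ k * y k" by (simp add: y_def exp_of_nat_mult)
  qed
  moreover have "(\<Prod>k=1..n. 1 - y (2 * k)) = (\<Prod>k=1..n. (- 2 * x / of_nat N * of_nat k) * exp (log_even (of_nat k * (2 * z))) * (1 + y (2 * k)))"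
    by (intro prod.cong refl e2) (auto simp: n_def)
  moreover have "\<dots> = ((- 2 * x / of_nat N) ^ n * fact n * exp (\<Sum>k=1..n. log_even (of_nat k * (2 * z)))) * (\<Prod>k=1..n. 1 + y (2 * k))"
    by (simp only: prod.distrib prod_constant card_atLeastAtMost exp_sum finite_atLeastAtMost fact_prod of_nat_prod) simp
  moreover have "(\<Prod>k=1..N. 1 + y k) = exp (\<Sum>k=1..N. log_odd (of_nat k * z))"
    unfolding exp_sum[OF finite_atLeastAtMost] by (intro prod.cong refl e1) auto
  moreover have "(\<Prod>k=1..n. 1 + y (2 * k)) \<noteq> 0"
  proof -
    have "1 + y (2 * k) \<noteq> 0" if "k \<in> {1..n}" for k
    proof -
      have "2 * k \<le> N" using that unfolding n_def atLeastAtMost_iff by presburger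
      thus ?thesis using e1[of "2 * k"] by auto
    qed
    thus ?thesis by simp
  qed
  ultimately have "qpoch N (- exp z) = (- 2 * x / of_nat N) ^ n * fact n * exp (\<Sum>k=1..n. log_even (of_nat k * (2 * z))) * exp (\<Sum>k=1..N. log_odd (of_nat k * z))"
    using qpoch_split_even_odd[where y = y and N = N] unfolding n_def[symmetric] by (simp add: mult_ac)
  thus ?thesis by (simp add: z_def exp_add mult_ac)
qed

section \<open>Parity classes of N and Stirling's expansion\<close>

definition parity_filter :: "nat \<Rightarrow> nat filter" where
  "parity_filter a = inf sequentially (principal {N. N mod 2 = a})"

lemma parity_filter_le: "parity_filter a \<le> sequentially"
  by (simp add: parity_filter_def)

lemma eventually_parity_filter:
  "eventually P (parity_filter a) \<longleftrightarrow> (\<forall>\<^sub>F N in sequentially. N mod 2 = a \<longrightarrow> P N)"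
  by (simp add: parity_filter_def eventually_inf_principal)

lemma parity_filter_neq_bot: "a < 2 \<Longrightarrow> parity_filter a \<noteq> bot"
proof -
  assume a: "a < 2"
  show ?thesis
  proof
    assume "parity_filter a = bot"
    hence "eventually (\<lambda>_. False) (parity_filter a)" by simp
    then obtain M where "\<And>N. N \<ge> M \<Longrightarrow> N mod 2 \<noteq> a"
      by (auto simp: eventually_parity_filter eventually_sequentially)
    from this[of "2 * M + a"] a show False by simp
  qed
qed

lemma higher_deriv_exp_minus: "(deriv ^^ k) (\<lambda>s. exp (- s)) = (\<lambda>s. (-1) ^ k * exp (- s :: complex))"
proof (induction k)
  case (Suc k)
  have "deriv (\<lambda>s. (-1) ^ k * exp (- s :: complex)) = (\<lambda>s. (-1) ^ Suc k * exp (- s))"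
    by (rule ext, rule DERIV_imp_deriv) (auto intro!: derivative_eq_intros)
  thus ?case using Suc by simp
qed simp

text \<open>Stirling's expansion of \<open>(N/2)^n / fact n\<close> is itself obtained by Laplace's method, from the Cauchy integral of \<open>exp\<close> over a circle.\<close>

lemma power_over_fact_integral:
  assumes N: "N \<ge> 1" "N mod 2 = a"
  defines "n \<equiv> N div 2"
  shows "contour_integral (linepath (of_real 0) (of_real (2 * pi)))
           (\<lambda>\<theta>. exp (of_nat N * ((- exp (\<i> * \<theta>) - \<i> * \<theta> + \<i> * pi) / 2)) * exp (\<i> * of_nat a * (\<theta> - pi) / 2))
         = 2 * pi * ((of_nat N / 2) ^ n / fact n)"
proof -
  \<comment> \<open>The radius is \<open>N / 2\<close> rather than \<open>n\<close>, which gives one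
    phase for both parities; the mismatch \<open>a / 2\<close> goes into the amplitude. The function
    is \<open>exp (- u)\<close>, so that the saddle \<open>u = - R\<close> appears at
    \<open>\<theta> = pi\<close>, inside the parameter interval.\<close>
  define R where "R = real N / 2"
  have R: "R > 0" using N by (simp add: R_def)
  have Nn: "N = 2 * n + a" using N(2) mult_div_mod_eq[of 2 N] by (simp add: n_def)
  have "((\<lambda>u. exp (- u) / (u - 0) ^ Suc n) has_contour_integral (2 * pi * \<i> / fact n * (deriv ^^ n) (\<lambda>s. exp (- s)) 0)) (circlepath 0 R)"
    using R by (intro Cauchy_has_contour_integral_higher_derivative_circlepath continuous_intros holomorphic_intros) auto
  hence 1: "contour_integral (circlepath 0 R) (\<lambda>u. exp (- u) / u ^ Suc n) = 2 * pi * \<i> / fact n * (-1) ^ n"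
    by (intro contour_integral_unique) (simp add: higher_deriv_exp_minus)
  let ?g = "\<lambda>\<theta>. exp (of_nat N * ((- exp (\<i> * \<theta>) - \<i> * \<theta> + \<i> * pi) / 2)) * exp (\<i> * of_nat a * (\<theta> - pi) / 2)"
  have g: "?g \<theta> = exp (- (R * exp (\<i> * \<theta>))) * exp (- (\<i> * of_nat n * \<theta>)) * (-1) ^ n" for \<theta>
  proof -
    have "(-1 :: complex) ^ n = exp (\<i> * pi * of_nat n)"
      by (simp add: exp_of_nat2_mult exp_pi_i)
    moreover have "of_nat N * ((- exp (\<i> * \<theta>) - \<i> * \<theta> + \<i> * pi) / 2) + \<i> * of_nat a * (\<theta> - pi) / 2
       = - (R * exp (\<i> * \<theta>)) + - (\<i> * of_nat n * \<theta>) + \<i> * pi * of_nat n"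
      by (simp add: R_def Nn field_simps)
    ultimately show ?thesis by (simp only: exp_add[symmetric])
  qed
  have eq: "(\<lambda>u. exp (- u) / u ^ Suc n) (circlepath 0 R t) * vector_derivative (circlepath 0 R) (at t)
      = (\<i> * (-1) ^ n / of_real R ^ n) * (?g (linepath (of_real 0) (of_real (2 * pi)) t) * (of_real (2 * pi) - of_real 0))" for t
  proof -
    define \<theta> :: complex where "\<theta> = 2 * pi * t"
    have lp: "linepath (of_real 0) (of_real (2 * pi)) t = \<theta>" by (simp add: linepath_def \<theta>_def scaleR_conv_of_real)
    have cp: "circlepath 0 R t = R * exp (\<i> * \<theta>)" by (simp add: circlepath \<theta>_def mult_ac)
    have vd: "vector_derivative (circlepath 0 R) (at t) = 2 * pi * \<i> * (R * exp (\<i> * \<theta>))"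
      by (simp add: vector_derivative_circlepath \<theta>_def mult_ac)
    have en: "exp (\<i> * \<theta>) ^ n * exp (- (\<i> * of_nat n * \<theta>)) = 1"
      by (simp add: exp_of_nat_mult[symmetric] exp_add[symmetric] mult_ac)
    have en': "exp (- (\<i> * of_nat n * \<theta>)) = 1 / exp (\<i> * \<theta>) ^ n"
      using en by (simp add: field_simps)
    have m1: "(-1 :: complex) ^ n * (-1) ^ n = 1" by (simp flip: power_mult_distrib)
    have "(\<i> * (-1) ^ n / of_real R ^ n) * (?g \<theta> * (of_real (2 * pi) - of_real 0))
       = ((-1) ^ n * (-1) ^ n) * (\<i> / of_real R ^ n * exp (- (R * exp (\<i> * \<theta>))) * exp (- (\<i> * of_nat n * \<theta>)) * (2 * pi))"
      unfolding g by (simp add: mult_ac)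
    also have "\<dots> = exp (- (R * exp (\<i> * \<theta>))) / (R * exp (\<i> * \<theta>)) ^ Suc n * (2 * pi * \<i> * (R * exp (\<i> * \<theta>)))"
      unfolding m1 en' using R by (simp add: power_mult_distrib field_simps)
    finally show ?thesis unfolding lp cp vd by simp
  qed
  have "contour_integral (circlepath 0 R) (\<lambda>u. exp (- u) / u ^ Suc n) = 
     integral {0..1} (\<lambda>t. (\<i> * (-1) ^ n / of_real R ^ n) * (?g (linepath (of_real 0) (of_real (2 * pi)) t) * (of_real (2 * pi) - of_real 0)))"
    unfolding contour_integral_integral eq ..
  also have "\<dots> = (\<i> * (-1) ^ n / of_real R ^ n) * integral {0..1} (\<lambda>t. ?g (linepath (of_real 0) (of_real (2 * pi)) t) * (of_real (2 * pi) - of_real 0))"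
    by (rule integral_mult_right)
  also have "integral {0..1} (\<lambda>t. ?g (linepath (of_real 0) (of_real (2 * pi)) t) * (of_real (2 * pi) - of_real 0))
     = contour_integral (linepath (of_real 0) (of_real (2 * pi))) ?g"
    by (simp add: contour_integral_integral)
  finally have "(\<i> * (-1) ^ n / of_real R ^ n) * contour_integral (linepath (of_real 0) (of_real (2 * pi))) ?g = 2 * pi * \<i> / fact n * (-1) ^ n"
    using 1 by simp
  hence "contour_integral (linepath (of_real 0) (of_real (2 * pi))) ?g = 2 * pi * (of_real R ^ n / fact n)"
    using R by (simp add: field_simps)
  thus ?thesis by (simp add: R_def)
qed

text \<open>The second derivative of the phase at \<open>pi\<close> is \<open>- 1/2\<close>, which
  produces the root \<open>csqrt (1/4)\<close>. The parity factor equals 1 at the saddle, so the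
  leading constant is the same for both classes.\<close>

lemma power_over_fact_asy:
  "asy (parity_filter a) UNIV r (\<lambda>N _. complex_of_real (sqrt (real N)) * (exp (- (of_nat N / 2)) * ((of_nat N / 2) ^ (N div 2) / fact (N div 2))))
      (\<lambda>_. 1 / sqrt pi)"
proof -
  let ?p = "\<lambda>\<theta>::complex. (- exp (\<i> * \<theta>) - \<i> * \<theta> + \<i> * pi) / 2"
  let ?g = "\<lambda>N::nat. \<lambda>\<theta>::complex. exp (\<i> * of_nat a * (\<theta> - pi) / 2)"
  have d1: "deriv ?p = (\<lambda>\<theta>. (- \<i> * exp (\<i> * \<theta>) - \<i>) / 2)"
    by (rule ext, rule DERIV_imp_deriv) (auto intro!: derivative_eq_intros)
  have d2: "deriv (\<lambda>\<theta>. (- \<i> * exp (\<i> * \<theta>) - \<i>) / 2) = (\<lambda>\<theta>. exp (\<i> * \<theta>) / 2)"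
    by (rule ext, rule DERIV_imp_deriv) (auto intro!: derivative_eq_intros)
  have expi: "exp (\<i> * complex_of_real pi) = -1" by (simp add: exp_pi_i')
  have "asy (parity_filter a) UNIV r (\<lambda>N _. sqrt (real N) * (exp (- of_nat N * ?p (of_real pi)) *
            contour_integral (linepath (of_real 0) (of_real (2 * pi))) (\<lambda>t. exp (of_nat N * ?p t) * ?g N t)))
          (\<lambda>_. sqrt pi * ?g 0 (of_real pi) / csqrt (- deriv (deriv ?p) (of_real pi) / 2))"
  proof (rule laplace_asy[where S = UNIV and c = "?g 0" and g = ?g])
    show "deriv ?p (of_real pi) = 0" by (simp add: d1 expi)
    show "Re (deriv (deriv ?p) (of_real pi)) < 0" unfolding d1 d2 expi by simp
    fix t assume t: "t \<in> {0..2*pi}" "t \<noteq> pi"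
    have "cos t > -1"
    proof (rule ccontr)
      assume "\<not> cos t > -1"
      hence "cos t = -1" using cos_ge_minus_one[of t] by linarith
      hence "cos (t - pi) = 1" by (simp add: cos_diff)
      then obtain k :: int where "t - pi = of_int k * 2 * pi" using cos_one_2pi_int by blast
      hence "\<bar>of_int k * 2 * pi\<bar> \<le> pi" "k \<noteq> 0" using t by auto
      hence "\<bar>of_int k :: real\<bar> * 2 \<le> 1" by (simp add: abs_mult)
      thus False using \<open>k \<noteq> 0\<close> by linarith
    qed
    moreover have "exp (\<i> * complex_of_real t) = Complex (cos t) (sin t)" by (simp add: cis_conv_exp[symmetric] cis.ctr)
    ultimately show "Re (?p (of_real t)) < Re (?p (of_real pi))" by (simp add: expi)
  qed (auto intro!: parity_filter_le holomorphic_intros continuous_intros asy_const)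
  hence "asy (parity_filter a) UNIV r (\<lambda>N _. complex_of_real (sqrt (real N)) * (exp (- (of_nat N / 2)) *
            contour_integral (linepath (of_real 0) (of_real (2 * pi))) (\<lambda>t. exp (of_nat N * ?p t) * ?g N t)))
          (\<lambda>_. sqrt pi / csqrt (1 / 4))"
    unfolding d1 d2 expi by simp
  hence "asy (parity_filter a) UNIV r (\<lambda>N _. 1 / (2 * pi) * (complex_of_real (sqrt (real N)) * (exp (- (of_nat N / 2)) *
            contour_integral (linepath (of_real 0) (of_real (2 * pi))) (\<lambda>t. exp (of_nat N * ?p t) * ?g N t))))
          (\<lambda>_. 1 / (2 * pi) * (sqrt pi / csqrt (1 / 4)))"
    by (intro asy_cmult parity_filter_le holomorphic_intros)
  moreover have "1 / (2 * pi) * (complex_of_real (sqrt pi) / csqrt (1 / 4)) = 1 / sqrt pi"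
  proof -
    have "csqrt (1 / 4) = csqrt (of_real (1/4))" by simp
    also have "\<dots> = of_real (sqrt (1/4))" by (rule of_real_sqrt[symmetric]) simp
    also have "sqrt (1/4) = 1/2" by (simp add: real_sqrt_divide)
    finally have c: "csqrt (1 / 4) = 1 / 2" by simp
    have "complex_of_real (sqrt pi) * sqrt pi = pi" by (simp flip: of_real_mult)
    thus ?thesis unfolding c by (simp add: field_simps)
  qed
  ultimately have *: "asy (parity_filter a) UNIV r (\<lambda>N _. 1 / (2 * pi) * (complex_of_real (sqrt (real N)) * (exp (- (of_nat N / 2)) *
            contour_integral (linepath (of_real 0) (of_real (2 * pi))) (\<lambda>t. exp (of_nat N * ?p t) * ?g N t))))
          (\<lambda>_. 1 / sqrt pi)" by simp
  show ?thesis
  proof (rule asy_cong[OF *])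
    have "\<forall>\<^sub>F N in sequentially. N \<ge> (1::nat)" by (rule eventually_ge_at_top)
    thus "\<forall>\<^sub>F N in parity_filter a. \<forall>x\<in>UNIV. 1 / (2 * pi) * (complex_of_real (sqrt (real N)) * (exp (- (of_nat N / 2)) *
            contour_integral (linepath (of_real 0) (of_real (2 * pi))) (\<lambda>t. exp (of_nat N * ?p t) * ?g N t)))
        = complex_of_real (sqrt (real N)) * (exp (- (of_nat N / 2)) * ((of_nat N / 2) ^ (N div 2) / fact (N div 2)))"
      unfolding eventually_parity_filter
    proof eventually_elim
      case (elim N)
      thus ?case using power_over_fact_integral[of N a] by simp
    qed
  qed
qed

text \<open>Leading coefficients are functions on all of the plane, whereas only their values on
  \<open>D\<close> matter; the difference, which is 0 on \<open>D\<close>, is added as a constant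
  term.\<close>

lemma asy_cong_leading:
  assumes "asy F D r f c" "\<And>x. x \<in> D \<Longrightarrow> c x = c' x"
  shows "asy F D r f c'"
proof -
  obtain g where g: "lpoly D g c" "unif_O F D r (\<lambda>N x. f N x - g N x)"
    using assms(1) unfolding asy_def by blast
  have "(\<lambda>x. c' x - c x) holomorphic_on D"
    by (rule holomorphic_transform[of "\<lambda>_. 0"]) (use assms(2) in auto)
  from lpoly.add[OF g(1) lpoly.const[OF this]]
  have "lpoly D (\<lambda>N x. g N x + (c' x - c x)) c'" by simp
  moreover have "unif_O F D r (\<lambda>N x. f N x - (g N x + (c' x - c x)))"
    by (rule unif_O_cong[OF g(2)]) (use assms(2) in auto)
  ultimately show ?thesis by (rule asyI)
qed

section \<open>Amplitude and growth of the inverse q-Pochhammer symbol\<close>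

abbreviation even_prim :: "complex \<Rightarrow> complex" where "even_prim \<equiv> slit_primitive log_even"
abbreviation odd_prim :: "complex \<Rightarrow> complex" where "odd_prim \<equiv> slit_primitive log_odd"

text \<open>The even part carries the weight \<open>1/2\<close> because its Riemann sum has the
  doubled step \<open>2 * x / N\<close>.\<close>

definition log_prim :: "complex \<Rightarrow> complex" where
  "log_prim x = even_prim x / 2 + odd_prim x"

lemma log_prim_deriv:
  "x \<in> slit_dom \<Longrightarrow> (log_prim has_field_derivative (log_even x / 2 + log_odd x)) (at x)"
  unfolding log_prim_def[abs_def]
  using slit_primitive(1)[OF log_even_holomorphic, of x] slit_primitive(1)[OF log_odd_holomorphic, of x]
  by (auto intro!: derivative_eq_intros)

lemma log_prim_holomorphic: "log_prim holomorphic_on slit_dom"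
  unfolding log_prim_def[abs_def]
  by (intro holomorphic_intros slit_primitive(3) log_even_holomorphic log_odd_holomorphic) auto

lemma log_prim_0: "log_prim 0 = 0"
  by (simp add: log_prim_def slit_primitive(2) log_even_holomorphic log_odd_holomorphic)

text \<open>All that has an expansion in powers of \<open>1/N\<close> with nothing exponential left:
  the normalised Stirling factor and the two Riemann defects.\<close>

definition amp :: "nat \<Rightarrow> complex \<Rightarrow> complex" where
  "amp N x = (complex_of_real (sqrt (real N)) * (exp (- (of_nat N / 2)) * ((of_nat N / 2) ^ (N div 2) / fact (N div 2)))) *
      exp (- (riemann_defect 2 (\<lambda>N. N div 2) even_prim N x + riemann_defect 1 (\<lambda>N. N) odd_prim N x))"

lemma amp_asy:
  "asy (parity_filter a) (slit_dom - {0}) r amp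
     (\<lambda>x. 1 / sqrt pi * exp (- ((1/2 - of_nat a / 2) * log_even x + log_odd x / 2)))"
proof -
  have dE: "deriv even_prim x = log_even x" "deriv odd_prim x = log_odd x" if "x \<in> slit_dom" for x
    using slit_primitive(1)[OF log_even_holomorphic that] slit_primitive(1)[OF log_odd_holomorphic that]
    by (auto intro: DERIV_imp_deriv)
  have zero: "0 \<in> slit_dom" by (simp add: slit_dom_def)
  have ev: "\<forall>\<^sub>F N in parity_filter a. 2 * (N div 2) + a = N"
    unfolding eventually_parity_filter by (rule always_eventually) auto
  have 1: "asy (parity_filter a) (slit_dom - {0}) r (riemann_defect 2 (\<lambda>N. N div 2) even_prim)
      (\<lambda>x. (1/2 - of_nat a / of_nat 2) * deriv even_prim x - deriv even_prim 0 / 2)"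
    by (rule riemann_defect_asy[OF open_slit_dom slit_dom_segment parity_filter_le _ ev])
       (auto intro: slit_primitive(3) log_even_holomorphic)
  have 2: "asy (parity_filter a) (slit_dom - {0}) r (riemann_defect 1 (\<lambda>N. N) odd_prim)
      (\<lambda>x. (1/2 - of_nat 0 / of_nat 1) * deriv odd_prim x - deriv odd_prim 0 / 2)"
    by (rule riemann_defect_asy[OF open_slit_dom slit_dom_segment parity_filter_le])
       (auto intro: slit_primitive(3) log_odd_holomorphic)
  have "asy (parity_filter a) (slit_dom - {0}) r
     (\<lambda>N x. exp (-1 * (riemann_defect 2 (\<lambda>N. N div 2) even_prim N x + riemann_defect 1 (\<lambda>N. N) odd_prim N x)))
     (\<lambda>x. exp (-1 * (((1/2 - of_nat a / of_nat 2) * deriv even_prim x - deriv even_prim 0 / 2) +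
        ((1/2 - of_nat 0 / of_nat 1) * deriv odd_prim x - deriv odd_prim 0 / 2))))"
    by (intro asy_exp asy_cmult asy_add 1 2 parity_filter_le holomorphic_intros)
  hence "asy (parity_filter a) (slit_dom - {0}) r
     (\<lambda>N x. (complex_of_real (sqrt (real N)) * (exp (- (of_nat N / 2)) * ((of_nat N / 2) ^ (N div 2) / fact (N div 2)))) *
        exp (-1 * (riemann_defect 2 (\<lambda>N. N div 2) even_prim N x + riemann_defect 1 (\<lambda>N. N) odd_prim N x)))
     (\<lambda>x. 1 / sqrt pi * exp (-1 * (((1/2 - of_nat a / of_nat 2) * deriv even_prim x - deriv even_prim 0 / 2) +
        ((1/2 - of_nat 0 / of_nat 1) * deriv odd_prim x - deriv odd_prim 0 / 2))))"
    by (intro asy_mult parity_filter_le asy_subset[OF power_over_fact_asy]) auto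
  hence *: "asy (parity_filter a) (slit_dom - {0}) r amp
     (\<lambda>x. 1 / sqrt pi * exp (-1 * (((1/2 - of_nat a / of_nat 2) * deriv even_prim x - deriv even_prim 0 / 2) +
        ((1/2 - of_nat 0 / of_nat 1) * deriv odd_prim x - deriv odd_prim 0 / 2))))"
    by (simp add: amp_def[abs_def])
  show ?thesis
  proof (rule asy_cong_leading[OF *])
    fix x assume "x \<in> slit_dom - {0}"
    hence x: "x \<in> slit_dom" by auto
    \<comment> \<open>The endpoint contributions at 0 of the two Riemann sums cancel, so no factor 2
      survives in the leading coefficient.\<close>
    have "log_even 0 = - Ln 2" "log_odd 0 = Ln 2"
      by (simp_all add: log_even_def log_odd_def expm1_over_def)
    hence "-1 * (((1/2 - of_nat a / of_nat 2) * deriv even_prim x - deriv even_prim 0 / 2) +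
        ((1/2 - of_nat 0 / of_nat 1) * deriv odd_prim x - deriv odd_prim 0 / 2))
      = - ((1/2 - of_nat a / 2) * log_even x + log_odd x / 2)"
      by (simp add: dE x zero field_simps)
    thus "1 / sqrt pi * exp (-1 * (((1/2 - of_nat a / of_nat 2) * deriv even_prim x - deriv even_prim 0 / 2) +
        ((1/2 - of_nat 0 / of_nat 1) * deriv odd_prim x - deriv odd_prim 0 / 2)))
      = 1 / sqrt pi * exp (- ((1/2 - of_nat a / 2) * log_even x + log_odd x / 2))" by (simp only:)
  qed
qed

text \<open>The power of \<open>- x\<close> keeps its integer exponent: writing it through
  \<open>Ln (- x)\<close> would introduce a cut along the positive axis, which the contour
  crosses.\<close>

lemma inverse_qpoch_formula:
  fixes x :: complex
  assumes x: "x \<in> slit_dom" "x \<noteq> 0" and N: "N \<ge> 1"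
  shows "inverse (qpoch N (- exp (x / of_nat N))) =
     exp (complex_of_nat N / 2) / complex_of_real (sqrt (real N)) * (1 / (- x)) ^ (N div 2) * exp (- (of_nat N * (log_prim x / x))) * amp N x"
proof -
  define n where "n = N div 2"
  have mem: "of_nat k * (of_nat c * x / of_nat N) \<in> slit_dom" if "c * k \<le> N" for k c
  proof -
    have "of_nat k * (of_nat c * x / of_nat N) = of_real (real (c * k) / real N) * x" by simp
    moreover have "real (c * k) / real N \<in> {0..1}" using that N by (simp add: divide_le_eq del: of_nat_mult)
    ultimately show ?thesis using slit_dom_scale[OF x(1)] by metis
  qed
  have dE: "deriv even_prim x = log_even x" "deriv odd_prim x = log_odd x" if "x \<in> slit_dom" for x
    using slit_primitive(1)[OF log_even_holomorphic that] slit_primitive(1)[OF log_odd_holomorphic that]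
    by (auto intro: DERIV_imp_deriv)
  define R1 R2 where "R1 = riemann_defect 2 (\<lambda>N. N div 2) even_prim N x" and "R2 = riemann_defect 1 (\<lambda>N. N) odd_prim N x"
  have "(\<Sum>k=1..n. log_even (of_nat k * (of_nat 2 * x / of_nat N))) = (\<Sum>k=1..n. deriv even_prim (of_nat k * (of_nat 2 * x / of_nat N)))"
  proof (intro sum.cong refl)
    fix k assume "k \<in> {1..n}"
    hence "2 * k \<le> N" unfolding n_def atLeastAtMost_iff by presburger
    thus "log_even (of_nat k * (of_nat 2 * x / of_nat N)) = deriv even_prim (of_nat k * (of_nat 2 * x / of_nat N))"
      using dE(1)[OF mem[where c = 2 and k = k]] by simp
  qed
  hence S1: "(\<Sum>k=1..n. log_even (of_nat k * (of_nat 2 * x / of_nat N))) = R1 + of_nat N / (of_nat 2 * x) * even_prim x"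
    by (simp add: R1_def riemann_defect_def n_def slit_primitive(2) log_even_holomorphic)
  have "(\<Sum>k=1..N. log_odd (of_nat k * (of_nat 1 * x / of_nat N))) = (\<Sum>k=1..N. deriv odd_prim (of_nat k * (of_nat 1 * x / of_nat N)))"
    by (intro sum.cong refl dE(2)[symmetric] mem) auto
  hence S2: "(\<Sum>k=1..N. log_odd (of_nat k * (of_nat 1 * x / of_nat N))) = R2 + of_nat N / (of_nat 1 * x) * odd_prim x"
    by (simp add: R2_def riemann_defect_def slit_primitive(2) log_odd_holomorphic)
  have S: "R1 + of_nat N / (of_nat 2 * x) * even_prim x + (R2 + of_nat N / (of_nat 1 * x) * odd_prim x) = (R1 + R2) + of_nat N * (log_prim x / x)"
    using x by (simp add: log_prim_def field_simps)
  have "qpoch N (- exp (x / of_nat N)) = (- 2 * x / of_nat N) ^ n * fact n * exp ((R1 + R2) + of_nat N * (log_prim x / x))"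
    using qpoch_exp_formula[OF x(1) N] unfolding n_def[symmetric] S1 S2 S .
  hence "inverse (qpoch N (- exp (x / of_nat N))) = inverse ((- 2 * x / of_nat N) ^ n) * inverse (fact n) * (exp (- (R1 + R2)) * exp (- (of_nat N * (log_prim x / x))))"
    by (simp only: inverse_mult_distrib exp_add exp_minus mult.assoc)
  also have "inverse ((- 2 * x / of_nat N) ^ n) = (of_nat N / 2) ^ n * (1 / (- x)) ^ n"
    using x N by (simp add: power_inverse[symmetric] power_mult_distrib[symmetric] field_simps)
  finally have eq: "inverse (qpoch N (- exp (x / of_nat N))) = (of_nat N / 2) ^ n * (1 / (- x)) ^ n * inverse (fact n) * (exp (- (R1 + R2)) * exp (- (of_nat N * (log_prim x / x))))" .
  have sN: "complex_of_real (sqrt (real N)) \<noteq> 0" using N by simp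
  have ee: "exp (of_nat N / 2) * exp (- (of_nat N / 2)) = (1::complex)" by (simp flip: exp_add)
  have "exp (complex_of_nat N / 2) / complex_of_real (sqrt (real N)) * (1 / (- x)) ^ n * exp (- (of_nat N * (log_prim x / x))) * amp N x
     = (exp (complex_of_nat N / 2) * exp (- (of_nat N / 2))) * (complex_of_real (sqrt (real N)) / complex_of_real (sqrt (real N))) * ((of_nat N / 2) ^ n * (1 / (- x)) ^ n * inverse (fact n) * (exp (- (R1 + R2)) * exp (- (of_nat N * (log_prim x / x)))))"
  proof -
    have d: "e1 / s * p * E * (s * (e2 * (k / f)) * R) = (e1 * e2) * (s / s) * (k * p * inverse f * (R * E))"
      for e1 e2 s p E k f R :: complex by (simp only: divide_inverse mult_ac)
    show ?thesis unfolding amp_def n_def[symmetric] R1_def[symmetric] R2_def[symmetric] by (rule d)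
  qed
  also have "\<dots> = inverse (qpoch N (- exp (x / of_nat N)))"
    unfolding eq ee using sN by simp
  finally show ?thesis by (simp add: n_def)
qed

text \<open>The exponential growth rate of \<open>1 / qpoch\<close>; for \<open>Re x < 0\<close> it equals \<open>Re (phase x)\<close>, but \<open>phase\<close> itself has a branch cut on the positive real axis.\<close>

definition growth :: "complex \<Rightarrow> real" where
  "growth x = 1 / 2 - ln (norm x) / 2 - Re (log_prim x / x)"

lemma inverse_qpoch_bound:
  assumes K: "compact K" "K \<subseteq> slit_dom - {0}"
  obtains C where "\<forall>\<^sub>F N in parity_filter a. \<forall>x\<in>K.
      norm (inverse (qpoch N (- exp (x / of_nat N)))) \<le> C * exp (real N * growth x)"
proof -
  \<comment> \<open>The exponent of \<open>norm x\<close> is \<open>N div 2 = (N - a) / 2\<close>,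
    while \<open>growth\<close> is written with \<open>N / 2\<close>; \<open>h\<close> is the
    bounded factor that makes up the difference.\<close>
  define h where "h x = complex_of_real (exp (real a / 2 * ln (norm x)))" for x :: complex
  have h: "continuous_on (slit_dom - {0}) h" unfolding h_def
    by (intro continuous_intros) auto
  have "unif_O (parity_filter a) (slit_dom - {0}) (0 + 0) (\<lambda>N x. h x * amp N x)"
    by (intro unif_O_mult unif_O_const h asy_O0[OF amp_asy] parity_filter_le)
  then obtain C where C: "C \<ge> 0" "\<forall>\<^sub>F N in parity_filter a. \<forall>x\<in>K. norm (h x * amp N x) \<le> C / real N ^ (0 + 0)"
    using unif_OE[OF _ K] by blast
  have ev: "\<forall>\<^sub>F N in parity_filter a. N \<ge> 1 \<and> N mod 2 = a"
    unfolding eventually_parity_filter using eventually_ge_at_top[of 1] by eventually_elim simp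
  have "\<forall>\<^sub>F N in parity_filter a. \<forall>x\<in>K. norm (inverse (qpoch N (- exp (x / of_nat N)))) \<le> C * exp (real N * growth x)"
    using C(2) ev
  proof eventually_elim
    case (elim N)
    show ?case
    proof
      fix x assume xK: "x \<in> K"
      hence x: "x \<in> slit_dom" "x \<noteq> 0" using K by auto
      have nx: "norm x > 0" using x by simp
      define n where "n = N div 2"
      have Nn: "real N = 2 * real n + real a"
      proof -
        have "N = 2 * n + a" using elim(2) mult_div_mod_eq[of 2 N] by (simp add: n_def)
        thus ?thesis by simp
      qed
      have "norm ((1 / (- x)) ^ n) = exp (- (real n * ln (norm x)))"
        using nx by (simp add: norm_power norm_divide exp_minus exp_of_nat_mult power_divide inverse_eq_divide)
      hence pw: "norm ((1 / (- x)) ^ n) = exp (- (real N / 2 * ln (norm x))) * exp (real a / 2 * ln (norm x))"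
        by (simp add: Nn field_simps flip: exp_add)
      define y where "y = log_prim x / x"
      have "norm (inverse (qpoch N (- exp (x / of_nat N)))) = 
         exp (real N / 2) / sqrt (real N) * norm ((1 / (- x)) ^ n) * exp (- (real N * Re (log_prim x / x))) * norm (amp N x)"
        using elim(2) inverse_qpoch_formula[OF x, of N] unfolding y_def[symmetric] n_def[symmetric] by (simp add: norm_mult norm_divide)
      also have "\<dots> = (exp (real N / 2) * exp (- (real N / 2 * ln (norm x))) * exp (- (real N * Re (log_prim x / x)))) * norm (h x * amp N x) / sqrt (real N)"
        unfolding pw by (simp add: norm_mult h_def)
      also have "exp (real N / 2) * exp (- (real N / 2 * ln (norm x))) * exp (- (real N * Re (log_prim x / x))) = exp (real N * growth x)"
        by (simp add: growth_def algebra_simps flip: exp_add)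
      also have "exp (real N * growth x) * norm (h x * amp N x) / sqrt (real N) \<le> exp (real N * growth x) * C / 1"
      proof (intro frac_le mult_left_mono)
        show "1 \<le> sqrt (real N)" using elim(2) by simp
        show "norm (h x * amp N x) \<le> C" using elim(1) xK by simp
      qed (use C in auto)
      finally show "norm (inverse (qpoch N (- exp (x / of_nat N)))) \<le> C * exp (real N * growth x)" by (simp add: mult.commute)
    qed
  qed
  thus ?thesis by (rule that)
qed

definition phase :: "complex \<Rightarrow> complex" where
  "phase x = 1 / 2 - Ln (- x) / 2 - log_prim x / x"

text \<open>The parity correction from \<open>N div 2\<close> to \<open>N / 2\<close>, now as a
  holomorphic factor, which the half plane permits.\<close>

definition amp_left :: "nat \<Rightarrow> nat \<Rightarrow> complex \<Rightarrow> complex" where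
  "amp_left a N x = exp (of_nat a / 2 * Ln (- x)) * amp N x"

section \<open>Phase and leading amplitude in the left half plane\<close>

lemma Re_neg_slit: "Re x < 0 \<Longrightarrow> x \<in> slit_dom - {0}"
  by (auto simp: slit_dom_def)

lemma Ln_one_minus_exp_double:
  assumes "Re x < 0"
  shows "Ln (1 - exp (2 * x)) = Ln (1 - exp x) + Ln (1 + exp x)"
proof -
  have nz: "1 - exp x \<noteq> 0" "1 + exp x \<noteq> 0" 
    using one_minus_exp_Re_pos[OF assms] by (metis less_irrefl zero_complex.simps(1))+
  have "\<bar>Im (Ln (1 - exp x))\<bar> < pi / 2" "\<bar>Im (Ln (1 + exp x))\<bar> < pi / 2"
    using Re_Ln_pos_lt[OF nz(1)] Re_Ln_pos_lt[OF nz(2)] one_minus_exp_Re_pos[OF assms] by auto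
  hence "Ln ((1 - exp x) * (1 + exp x)) = Ln (1 - exp x) + Ln (1 + exp x)"
    using nz by (intro Ln_times_simple) auto
  moreover have "(1 - exp x) * (1 + exp x) = 1 - exp (2 * x)"
    unfolding mult_2 exp_add by (simp add: algebra_simps)
  ultimately show ?thesis by simp
qed

lemma phase_holomorphic: "phase holomorphic_on {x. Re x < 0}"
proof -
  have "log_prim holomorphic_on {x. Re x < 0}"
    by (rule holomorphic_on_subset[OF log_prim_holomorphic]) (auto simp: slit_dom_def)
  thus ?thesis unfolding phase_def[abs_def]
    by (intro holomorphic_intros) (auto simp: complex_nonpos_Reals_iff)
qed

text \<open>Differentiation produces \<open>- Ln (- x) / 2\<close>, and this cancels the
  \<open>Ln (- x)\<close> hidden in \<open>log_even\<close>. What remains are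
  \<open>Ln (1 - exp x)\<close> and \<open>Ln (1 + exp x)\<close>, which combine to one logarithm
  since both arguments have positive real part.\<close>

lemma x_phase_deriv:
  assumes "Re x < 0"
  shows "((\<lambda>x. x * phase x) has_field_derivative (- Ln (1 - exp (2 * x)) / 2)) (at x)"
proof -
  have x: "x \<in> slit_dom" "x \<noteq> 0" using Re_neg_slit[OF assms] by auto
  have nn: "- x \<notin> \<real>\<^sub>\<le>\<^sub>0" using assms by (auto simp: complex_nonpos_Reals_iff)
  have "((\<lambda>x. x / 2 - x * Ln (- x) / 2 - log_prim x) has_field_derivative (- Ln (1 - exp (2 * x)) / 2)) (at x)"
  proof -
    have dL: "((\<lambda>x. Ln (- x)) has_field_derivative 1 / x) (at x)"
    proof -
      have "(uminus has_field_derivative (-1 :: complex)) (at x)" by (auto intro!: derivative_eq_intros)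
      from DERIV_chain'[OF this has_field_derivative_Ln[OF nn]] show ?thesis by (simp add: divide_inverse)
    qed
    have "((\<lambda>x. x / 2 - x * Ln (- x) / 2 - log_prim x) has_field_derivative
        (1 / 2 - (1 * Ln (- x) + 1 / x * x) / 2 - (log_even x / 2 + log_odd x))) (at x)"
      by (intro DERIV_diff DERIV_cdivide DERIV_mult DERIV_ident dL log_prim_deriv x)
    moreover have "1 / 2 - (1 * Ln (- x) + 1 / x * x) / 2 - (log_even x / 2 + log_odd x) = - Ln (1 - exp (2 * x)) / 2"
    proof -
      have g: "1 / 2 - (1 * A + 1) / 2 - ((B - A - C) / 2 + C) = - (B + C) / 2" for A B C :: complex
        by (simp add: field_simps)
      have "1 / x * x = 1" using x(2) by simp
      thus ?thesis
        unfolding Ln_one_minus_exp_double[OF assms] log_even_def log_odd_def Ln_expm1_over_left(2)[OF assms]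
        by (simp only: g)
    qed
    ultimately show ?thesis by (rule DERIV_cong)
  qed
  thus ?thesis
    by (rule has_field_derivative_transform_within_open[of _ _ _ "{x. Re x < 0}"])
       (use assms in \<open>auto simp: phase_def open_halfspace_Re_lt algebra_simps\<close>)
qed

lemma Re_phase: "Re x < 0 \<Longrightarrow> Re (phase x) = growth x"
  by (cases "x = 0") (auto simp: phase_def growth_def)

lemma inverse_qpoch_left:
  assumes x: "Re x < 0" and N: "N \<ge> 1" "N mod 2 = a"
  shows "inverse (qpoch N (- exp (x / of_nat N))) = exp (of_nat N * phase x) * amp_left a N x / sqrt (real N)"
proof -
  define n where "n = N div 2"
  have Nn: "of_nat N = 2 * of_nat n + (of_nat a :: complex)"
  proof -
    have "N = 2 * n + a" using N mult_div_mod_eq[of 2 N] by (simp add: n_def)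
    thus ?thesis by simp
  qed
  have x0: "x \<noteq> 0" "x \<in> slit_dom" using Re_neg_slit[OF x] by auto
  have "exp (of_nat n * Ln (- x)) = (- x) ^ n" using x0 by (simp add: exp_of_nat_mult)
  hence "(1 / (- x)) ^ n = exp (- (of_nat n * Ln (- x)))"
    by (simp only: power_one_over exp_minus inverse_eq_divide)
  hence pw: "(1 / (- x)) ^ n = exp (- (of_nat N / 2 * Ln (- x))) * exp (of_nat a / 2 * Ln (- x))"
    by (simp add: Nn field_simps flip: exp_add)
  have "exp (of_nat N / 2) * exp (- (of_nat N / 2 * Ln (- x))) * exp (- (of_nat N * (log_prim x / x))) = exp (of_nat N * phase x)"
    by (simp add: phase_def algebra_simps flip: exp_add)
  thus ?thesis
    using inverse_qpoch_formula[OF x0(2,1) N(1)] unfolding n_def[symmetric] pw amp_left_def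
    by (simp add: mult_ac)
qed

text \<open>For even \<open>N\<close> the two logarithms of \<open>1 + exp x\<close> cancel and only
  \<open>expm1_over\<close> is left; for odd \<open>N\<close> the term \<open>log_even\<close> has
  weight 0 and \<open>1 + exp x\<close> is left. The sign \<open>(-1) ^ a\<close> merges the two
  cases.\<close>

lemma amp_left_asy:
  assumes a: "a \<in> {0, 1}"
  shows "asy (parity_filter a) {x. Re x < 0} r (amp_left a)
     (\<lambda>x. 1 / sqrt pi * exp ((Ln (- x) - Ln (1 - (-1) ^ a * exp x)) / 2))"
proof -
  have sub: "{x. Re x < 0} \<subseteq> slit_dom - {0}" using Re_neg_slit by auto
  have *: "asy (parity_filter a) {x. Re x < 0} r (amp_left a)
     (\<lambda>x. exp (of_nat a / 2 * Ln (- x)) * (1 / sqrt pi * exp (- ((1/2 - of_nat a / 2) * log_even x + log_odd x / 2))))"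
    unfolding amp_left_def[abs_def]
    by (intro asy_cmult asy_subset[OF amp_asy sub] holomorphic_intros parity_filter_le)
       (auto simp: complex_nonpos_Reals_iff)
  show ?thesis
  proof (rule asy_cong_leading[OF *])
    fix x :: complex assume "x \<in> {x. Re x < 0}"
    hence x: "Re x < 0" by simp
    have E: "of_nat a / 2 * Ln (- x) + - ((1/2 - of_nat a / 2) * log_even x + log_odd x / 2) = (Ln (- x) - Ln (1 - (-1) ^ a * exp x)) / 2"
      using a by (auto simp: log_even_def log_odd_def Ln_expm1_over_left(2)[OF x] field_simps)
    show "exp (of_nat a / 2 * Ln (- x)) * (1 / sqrt pi * exp (- ((1/2 - of_nat a / 2) * log_even x + log_odd x / 2)))
       = 1 / sqrt pi * exp ((Ln (- x) - Ln (1 - (-1) ^ a * exp x)) / 2)"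
      unfolding E[symmetric] exp_add by (simp only: mult_ac)
  qed
qed

text \<open>Multiplying \<open>growth\<close> by the ray parameter makes its derivative elementary, which reduces bounds on \<open>growth\<close> to bounds on \<open>norm (1 - exp (2 * t * x))\<close>.\<close>

definition ray :: "complex \<Rightarrow> real \<Rightarrow> real" where
  "ray x t = t - t * ln (t * norm x) - 2 * Re (log_prim (of_real t * x) / x)"

lemma ray_eq_growth:
  assumes "x \<noteq> 0" "t > 0"
  shows "ray x t = 2 * t * growth (of_real t * x)"
proof -
  have "Re (log_prim (of_real t * x) / (of_real t * x)) = Re (log_prim (of_real t * x) / x) / t"
    using assms by (metis Re_divide_of_real divide_divide_eq_left mult.commute)
  thus ?thesis using assms by (simp add: ray_def growth_def norm_mult field_simps)
qed

text \<open>With \<open>u = t * x\<close>, the factorisation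
  \<open>1 - exp (2 * u) = - u * expm1_over u * (1 + exp u)\<close> splits the logarithm: the factor
  \<open>u\<close> matches the term \<open>t * ln (t * norm x)\<close>, and the other two match the
  derivative of \<open>log_prim\<close>.\<close>

lemma ray_deriv:
  assumes x: "x \<noteq> 0" and t: "t > 0" "of_real t * x \<in> slit_dom"
  shows "(ray x has_real_derivative (- ln (norm (1 - exp (2 * of_real t * x))))) (at t)"
proof -
  define u where "u = of_real t * x"
  have u0: "u \<noteq> 0" using x t by (simp add: u_def)
  define l where "l = log_even u / 2 + log_odd u"
  have "((\<lambda>s. log_prim (s * x) / x) has_field_derivative l) (at (of_real t))"
  proof -
    have "((\<lambda>s. log_prim (s * x)) has_field_derivative l * x) (at (of_real t))"
      by (rule DERIV_chain'[where f = "\<lambda>s. s * x" and g = log_prim])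
         (use log_prim_deriv[OF t(2)] in \<open>auto intro!: derivative_eq_intros simp: l_def u_def\<close>)
    thus ?thesis using x by (auto intro!: derivative_eq_intros)
  qed
  hence "((\<lambda>s. log_prim (of_real s * x) / x) has_vector_derivative l) (at t)"
    by (rule has_vector_derivative_real_field)
  hence "((\<lambda>s. Re (log_prim (of_real s * x) / x)) has_vector_derivative Re l) (at t)"
    by (rule bounded_linear.has_vector_derivative[OF bounded_linear_Re])
  hence d: "((\<lambda>s. Re (log_prim (of_real s * x) / x)) has_real_derivative Re l) (at t)"
    by (simp add: has_real_derivative_iff_has_vector_derivative)
  have nz: "expm1_over u \<noteq> 0" "1 + exp u \<noteq> 0"
    using expm1_over_not_nonpos[OF t(2)] one_plus_exp_not_nonpos[OF t(2)] by (auto simp: u_def)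
  have "1 - exp (2 * u) = (- u * expm1_over u) * (1 + exp u)"
    unfolding one_minus_exp[symmetric] mult_2 exp_add by (simp add: algebra_simps)
  hence "ln (norm (1 - exp (2 * u))) = ln (norm u) + ln (norm (expm1_over u)) + ln (norm (1 + exp u))"
    using nz u0 by (simp add: norm_mult ln_mult)
  moreover have "2 * Re l = ln (norm (expm1_over u)) + ln (norm (1 + exp u))"
    using nz by (simp add: l_def log_even_def log_odd_def field_simps)
  ultimately have e: "ln (norm (1 - exp (2 * u))) = ln (norm u) + 2 * Re l" by simp
  have "((\<lambda>t. t - t * ln (t * norm x) - 2 * Re (log_prim (of_real t * x) / x)) has_real_derivative
      (1 - (ln (t * norm x) + 1) - 2 * Re l)) (at t)"
  proof (intro DERIV_diff DERIV_cmult d)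
    show "((\<lambda>t. t) has_real_derivative 1) (at t)" by (rule DERIV_ident)
    show "((\<lambda>t. t * ln (t * norm x)) has_real_derivative ln (t * norm x) + 1) (at t)"
      using t x by (auto intro!: derivative_eq_intros)
  qed
  thus ?thesis using e t by (simp add: ray_def[abs_def] u_def norm_mult mult.assoc)
qed

lemma ray_at_0: "x \<in> slit_dom \<Longrightarrow> x \<noteq> 0 \<Longrightarrow> (ray x \<longlongrightarrow> 0) (at_right 0)"
proof -
  assume x: "x \<in> slit_dom" "x \<noteq> 0"
  have "isCont log_prim 0"
    using log_prim_deriv[of 0] DERIV_isCont by (force simp: slit_dom_def)
  hence "(log_prim \<longlongrightarrow> log_prim 0) (nhds 0)" by (simp add: continuous_at tendsto_nhds_iff)
  moreover have "filterlim (\<lambda>t::real. of_real t * x) (nhds 0) (at_right 0)"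
    by (auto intro!: tendsto_eq_intros)
  ultimately have "((\<lambda>t::real. log_prim (of_real t * x)) \<longlongrightarrow> 0) (at_right 0)"
    using log_prim_0 by (metis filterlim_compose)
  hence "((\<lambda>t::real. 2 * Re (log_prim (of_real t * x) / x)) \<longlongrightarrow> 2 * Re (0 / x)) (at_right 0)"
    by (intro tendsto_intros) (use x in auto)
  moreover have "((\<lambda>t::real. t - t * ln (t * norm x)) \<longlongrightarrow> 0) (at_right 0)"
    using x by real_asymp
  ultimately have "((\<lambda>t. (t - t * ln (t * norm x)) - 2 * Re (log_prim (of_real t * x) / x)) \<longlongrightarrow> 0 - 2 * Re (0 / x)) (at_right 0)"
    by (intro tendsto_diff)
  thus ?thesis by (simp add: ray_def[abs_def])
qed

section \<open>The dilogarithm and the saddle point\<close>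

text \<open>The plane without the ray from 1 to infinity is star-shaped about 0 and the integrand
  extends holomorphically over 0, so the integral along the segment is a primitive.\<close>

lemma Li2_deriv:
  assumes w: "1 - w \<notin> \<real>\<^sub>\<le>\<^sub>0"
  shows "(Li2 has_field_derivative (if w = 0 then 1 else - Ln (1 - w) / w)) (at w)" and "Li2 0 = 0"
proof -
  define U where "U = {u::complex. 1 - u \<notin> \<real>\<^sub>\<le>\<^sub>0}"
  have U_eq: "U = (\<lambda>u. 1 - u) -` (- \<real>\<^sub>\<le>\<^sub>0)" by (auto simp: U_def)
  have oU: "open U" unfolding U_eq by (intro open_vimage continuous_intros) (auto simp: open_Compl)
  have segU: "closed_segment 0 u \<subseteq> U" if "u \<in> U" for u
  proof
    fix y assume "y \<in> closed_segment 0 u"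
    then obtain t where t: "t \<in> {0..1}" "y = of_real t * u" by (auto simp: closed_segment_def scaleR_conv_of_real)
    show "y \<in> U"
    proof (rule ccontr)
      assume "y \<notin> U"
      hence y: "t * Re u \<ge> 1" "t * Im u = 0" by (auto simp: U_def complex_nonpos_Reals_iff t)
      hence "t \<noteq> 0" by auto
      hence "Im u = 0" "t > 0" using y t by auto
      moreover have "Re u \<ge> 1"
      proof (rule ccontr)
        assume "\<not> Re u \<ge> 1"
        hence "t * Re u < t * 1" using \<open>t > 0\<close> by (intro mult_strict_left_mono) auto
        thus False using y t by auto
      qed
      ultimately show False using that by (auto simp: U_def complex_nonpos_Reals_iff)
    qed
  qed
  define g where "g u = (if u = 0 then deriv (\<lambda>u. - Ln (1 - u)) 0 else (- Ln (1 - u) - - Ln (1 - 0)) / (u - 0))" for u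
  have "(\<lambda>u. - Ln (1 - u)) holomorphic_on U" by (intro holomorphic_intros) (auto simp: U_def)
  hence g: "g holomorphic_on U" unfolding g_def by (rule pole_lemma_open[OF _ oU])
  have "((\<lambda>u. - Ln (1 - u)) has_field_derivative 1) (at 0)"
    by (auto intro!: derivative_eq_intros)
  hence g_eq: "g u = (if u = 0 then 1 else - Ln (1 - u) / u)" for u
    by (simp add: g_def DERIV_imp_deriv)
  have "starlike U" unfolding starlike_def using segU by (intro bexI[of _ 0]) (auto simp: U_def)
  then obtain G where G: "\<And>u. u \<in> U \<Longrightarrow> (G has_field_derivative g u) (at u)"
    using holomorphic_starlike_primitive[OF holomorphic_on_imp_continuous_on[OF g] _ oU, of "{}"]
      holomorphic_on_imp_differentiable_at[OF g oU] by blast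
  have Li2: "Li2 u = G u - G 0" if "u \<in> U" for u
  proof (cases "u = 0")
    case False
    \<comment> \<open>The integrand of \<open>Li2\<close> takes the value 0 at 0 by the convention
      for division, while \<open>g 0 = 1\<close>; one point does not affect the integral.\<close>
    have "Li2 u = contour_integral (linepath 0 u) g" unfolding Li2_def
      by (rule contour_integral_spike_finite_simple_path[of "{0}"])
         (use False in \<open>auto simp: g_eq intro: arc_imp_simple_path\<close>)
    also have "\<dots> = G u - G 0"
      using contour_integral_primitive[of U G g "linepath 0 u"] G segU[OF that]
      by (intro contour_integral_unique) (auto intro: has_field_derivative_at_within)
    finally show ?thesis .
  qed (simp add: Li2_def)
  have wU: "w \<in> U" using w by (simp add: U_def)
  have "((\<lambda>u. G u - G 0) has_field_derivative g w) (at w)"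
    using G[OF wU] by (auto intro!: derivative_eq_intros)
  hence "(Li2 has_field_derivative g w) (at w)"
    by (rule has_field_derivative_transform_within_open[OF _ oU wU]) (simp add: Li2)
  thus "(Li2 has_field_derivative (if w = 0 then 1 else - Ln (1 - w) / w)) (at w)" by (simp add: g_eq)
  show "Li2 0 = 0" by (simp add: Li2_def)
qed

text \<open>The derivative depends on \<open>x\<close> only through \<open>exp (2 * x)\<close>,
  which has period \<open>\<i> * pi\<close>, so the difference is constant; the constant is seen to
  vanish far to the left. The point \<open>x0\<close> lies one period above the region where the
  dilogarithm formula holds.\<close>

lemma x_phase_periodic:
  assumes "Re x < 0"
  shows "(x + \<i> * pi) * phase (x + \<i> * pi) = x * phase x"
proof -
  define H where "H = {x::complex. Re x < 0}"
  have H: "open H" "convex H" by (auto simp: H_def open_halfspace_Re_lt convex_halfspace_Re_lt)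
  define M where "M x = x * phase x" for x
  have dM: "(M has_field_derivative (- Ln (1 - exp (2 * x)) / 2)) (at x)" if "Re x < 0" for x
    unfolding M_def[abs_def] by (rule x_phase_deriv[OF that])
  have per: "exp (2 * (x + \<i> * pi)) = exp (2 * x)" for x :: complex
    using exp_plus_2pin[of "2 * x" 1] by (simp add: algebra_simps)
  have "((\<lambda>x. M (x + \<i> * pi) - M x) has_field_derivative 0) (at x)" if "x \<in> H" for x
  proof -
    have "((\<lambda>x. M (x + \<i> * pi)) has_field_derivative (- Ln (1 - exp (2 * (x + \<i> * pi))) / 2)) (at x)"
      using dM[of "x + \<i> * pi"] that DERIV_shift[of M _ x "\<i> * pi"] by (simp add: H_def)
    moreover have "Re x < 0" using that by (simp add: H_def)
    ultimately show ?thesis unfolding per using DERIV_diff[OF _ dM[of x]] by fastforce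
  qed
  hence "(\<lambda>x. M (x + \<i> * pi) - M x) constant_on H"
    using H by (intro has_field_derivative_0_imp_constant_on) (auto intro: convex_connected)
  then obtain c where c: "\<And>x. x \<in> H \<Longrightarrow> M (x + \<i> * pi) - M x = c" by (auto simp: constant_on_def)
  \<comment> \<open>The constant is the change of \<open>M\<close> along a vertical segment of
    length \<open>pi\<close> at real part \<open>- s\<close>, where the derivative is at most
    \<open>exp (- 2 * s)\<close>.\<close>
  have bound: "norm c \<le> pi * exp (- 2 * s)" if s: "s \<ge> 1" for s :: real
  proof -
    define x :: complex where "x = - of_real s"
    have "norm (M (x + \<i> * pi) - M x) \<le> exp (- 2 * s) * norm ((x + \<i> * pi) - x)"
    proof (rule field_differentiable_bound[of "{u. Re u = - s}"])
      show "convex {u. Re u = - s}"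
        using convex_hyperplane[of "1::complex" "- s"] by (simp add: inner_complex_def)
      fix u assume u: "u \<in> {u. Re u = - s}"
      hence Re: "Re u < 0" using s by auto
      show "(M has_field_derivative (- Ln (1 - exp (2 * u)) / 2)) (at u within {u. Re u = - s})"
        using dM[OF Re] by (rule has_field_derivative_at_within)
      have ne: "norm (- exp (2 * u)) = exp (- 2 * s)" using u by simp
      have "exp (- 2 * s) < 1 / 2"
      proof -
        have "2 < 1 + 2 * s" using s by simp
        also have "\<dots> \<le> exp (2 * s)" by (rule exp_ge_add_one_self)
        finally show ?thesis by (simp add: exp_minus field_simps)
      qed
      hence "norm (Ln (1 + - exp (2 * u))) \<le> 2 * norm (- exp (2 * u))"
        using ne by (intro norm_Ln_le) simp
      thus "norm (- Ln (1 - exp (2 * u)) / 2) \<le> exp (- 2 * s)" unfolding ne by (simp add: norm_divide)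
    qed (auto simp: x_def)
    moreover have "norm ((x + \<i> * pi) - x) = pi" by (simp add: norm_mult)
    moreover have "x \<in> H" using s by (simp add: x_def H_def)
    ultimately show ?thesis using c[of x] by (simp add: mult.commute)
  qed
  have "((\<lambda>s::real. pi * exp (- 2 * s)) \<longlongrightarrow> 0) at_top" by real_asymp
  moreover have "\<forall>\<^sub>F s in at_top. norm c \<le> pi * exp (- 2 * s)"
    using eventually_ge_at_top[of 1] by eventually_elim (rule bound)
  ultimately have "norm c \<le> 0"
    by (intro tendsto_lowerbound[where f = "\<lambda>s::real. pi * exp (- 2 * s)"]) auto
  thus ?thesis using c[of x] assms by (simp add: M_def H_def)
qed

text \<open>Both sides have the same derivative and the same limit at 0. The strip is the one where
  \<open>Ln (exp (2 * x)) = 2 * x\<close> and where \<open>1 - exp (2 * x)\<close> avoids the cut of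
  \<open>Li2\<close>.\<close>

lemma x_phase_Li2:
  assumes "Re x < 0" "\<bar>Im x\<bar> < pi / 2"
  shows "4 * (x * phase x) = - Li2 (1 - exp (2 * x)) - 2 * x * Ln (1 - exp (2 * x))"
proof -
  define S where "S = {x::complex. Re x < 0} \<inter> ({x. Im x < pi/2} \<inter> {x. Im x > - pi/2})"
  have S: "open S" "convex S"
    unfolding S_def by (intro convex_Int open_Int open_halfspace_Re_lt open_halfspace_Im_lt open_halfspace_Im_gt
          convex_halfspace_Re_lt convex_halfspace_Im_lt convex_halfspace_Im_gt)+
  define T where "T x = 4 * (x * phase x) + Li2 (1 - exp (2 * x)) + 2 * x * Ln (1 - exp (2 * x))" for x
  have dT: "(T has_field_derivative 0) (at x)" if "x \<in> S" for x
  proof -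
    have x: "Re x < 0" "\<bar>Im x\<bar> < pi/2" using that by (auto simp: S_def)
    define e where "e = exp (2 * x)"
    define w where "w = 1 - e"
    have Ree: "Re w > 0" using one_minus_exp_Re_pos(1)[of "2 * x"] x by (simp add: w_def e_def)
    hence w0: "w \<noteq> 0" by auto
    have wn: "w \<notin> \<real>\<^sub>\<le>\<^sub>0" using Ree by (auto simp: complex_nonpos_Reals_iff)
    have Lne: "Ln e = 2 * x" unfolding e_def using x by (intro Ln_exp) auto
    have en: "1 - w \<notin> \<real>\<^sub>\<le>\<^sub>0"
    proof
      assume "1 - w \<in> \<real>\<^sub>\<le>\<^sub>0"
      hence "Re e \<le> 0" "Im e = 0" by (auto simp: w_def complex_nonpos_Reals_iff)
      moreover have "Im e = exp (2 * Re x) * sin (2 * Im x)" "Re e = exp (2 * Re x) * cos (2 * Im x)"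
        by (simp_all add: e_def Im_exp Re_exp)
      ultimately have "sin (2 * Im x) = 0" "cos (2 * Im x) \<le> 0" by (auto simp: mult_le_0_iff)
      hence "2 * Im x = 0" using x sin_eq_0_pi[of "2 * Im x"] by auto
      thus False using \<open>cos (2 * Im x) \<le> 0\<close> by simp
    qed
    have d1: "((\<lambda>x. 1 - exp (2 * x)) has_field_derivative (- 2 * e)) (at x)"
      by (auto intro!: derivative_eq_intros simp: e_def)
    have "(Li2 has_field_derivative (- Ln (1 - w) / w)) (at (1 - exp (2 * x)))"
      unfolding e_def[symmetric] w_def[symmetric] using Li2_deriv(1)[OF en] w0 by simp
    from DERIV_chain'[OF d1 this]
    have d2: "((\<lambda>x. Li2 (1 - exp (2 * x))) has_field_derivative (- Ln (1 - w) / w) * (- 2 * e)) (at x)" .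
    have "(Ln has_field_derivative inverse w) (at (1 - exp (2 * x)))"
      unfolding e_def[symmetric] w_def[symmetric] by (rule has_field_derivative_Ln[OF wn])
    from DERIV_chain'[OF d1 this]
    have d3: "((\<lambda>x. Ln (1 - exp (2 * x))) has_field_derivative inverse w * (- 2 * e)) (at x)" .
    have "(T has_field_derivative 4 * (- Ln (1 - exp (2 * x)) / 2) + (- Ln (1 - w) / w) * (- 2 * e)
        + (2 * 1 * Ln (1 - exp (2 * x)) + inverse w * (- 2 * e) * (2 * x))) (at x)"
      unfolding T_def[abs_def]
      by (intro DERIV_add DERIV_cmult x_phase_deriv x d2 DERIV_mult d3 DERIV_ident)
    moreover have "4 * (- Ln (1 - exp (2 * x)) / 2) + (- Ln (1 - w) / w) * (- 2 * e)
        + (2 * 1 * Ln (1 - exp (2 * x)) + inverse w * (- 2 * e) * (2 * x)) = 0"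
    proof -
      have "Ln (1 - w) = 2 * x" using Lne by (simp add: w_def)
      thus ?thesis using w0 by (simp add: field_simps)
    qed
    ultimately show ?thesis by (rule DERIV_cong)
  qed
  have "T constant_on S"
    using S dT by (intro has_field_derivative_0_imp_constant_on) (auto intro: convex_connected)
  then obtain c where c: "\<And>x. x \<in> S \<Longrightarrow> T x = c" by (auto simp: constant_on_def)
  \<comment> \<open>The constant is read off on the negative real axis: \<open>s * ln s\<close> and
    \<open>s * ln (1 - exp (- 2 * s))\<close> tend to 0, and so do \<open>log_prim\<close> and
    \<open>Li2\<close> at their zeros.\<close>
  have "((\<lambda>s::real. T (- of_real s)) \<longlongrightarrow> 0) (at_right 0)"
  proof -
    have l0: "((\<lambda>s::real. complex_of_real s) \<longlongrightarrow> 0) (at_right 0)"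
      using tendsto_of_real[OF tendsto_ident_at[of "0::real" "{0<..}"]] by simp
    have "isCont log_prim 0"
      using log_prim_deriv[of 0] DERIV_isCont by (force simp: slit_dom_def)
    hence l1: "((\<lambda>s::real. log_prim (- of_real s)) \<longlongrightarrow> 0) (at_right 0)"
      using isCont_tendsto_compose[of 0 log_prim "\<lambda>s::real. - of_real s" "at_right 0"] tendsto_minus[OF l0] log_prim_0 by simp
    have e1: "((\<lambda>s::real. 1 - exp (2 * (- complex_of_real s))) \<longlongrightarrow> 1 - exp (2 * (- 0))) (at_right 0)"
      by (intro tendsto_intros l0)
    have "isCont Li2 0" using Li2_deriv(1)[of 0] DERIV_isCont by force
    hence l2: "((\<lambda>s::real. Li2 (1 - exp (2 * (- of_real s)))) \<longlongrightarrow> 0) (at_right 0)"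
      using isCont_tendsto_compose[of 0 Li2 _ "at_right 0", OF _ e1[simplified]] Li2_deriv(2)[of 0] by simp
    have "((\<lambda>s::real. s * ln s) \<longlongrightarrow> 0) (at_right 0)" by real_asymp
    from tendsto_of_real[OF this] have l3: "((\<lambda>s::real. complex_of_real (s * ln s)) \<longlongrightarrow> 0) (at_right 0)" by simp
    have "((\<lambda>s::real. s * ln (1 - exp (- 2 * s))) \<longlongrightarrow> 0) (at_right 0)" by real_asymp
    from tendsto_of_real[OF this] have l4: "((\<lambda>s::real. complex_of_real (s * ln (1 - exp (- 2 * s)))) \<longlongrightarrow> 0) (at_right 0)" by simp
    have "((\<lambda>s::real. 4 * (- of_real s / 2 + of_real (s * ln s) / 2 - log_prim (- of_real s)) + Li2 (1 - exp (2 * (- of_real s)))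
        - 2 * of_real (s * ln (1 - exp (- 2 * s)))) \<longlongrightarrow> 4 * (- 0 / 2 + 0 / 2 - 0) + 0 - 2 * 0) (at_right 0)"
      by (intro tendsto_intros l0 l1 l2 l3 l4) auto
    moreover have "\<forall>\<^sub>F s::real in at_right 0. 4 * (- of_real s / 2 + of_real (s * ln s) / 2 - log_prim (- of_real s)) + Li2 (1 - exp (2 * (- of_real s)))
        - 2 * of_real (s * ln (1 - exp (- 2 * s))) = T (- of_real s)"
      using eventually_at_right_less[of 0]
    proof eventually_elim
      case (elim s)
      have p: "(- complex_of_real s) * phase (- of_real s) = - of_real s / 2 + of_real (s * ln s) / 2 - log_prim (- of_real s)"
        using elim by (simp add: phase_def Ln_of_real field_simps)
      have "1 - exp (2 * (- complex_of_real s)) = of_real (1 - exp (- 2 * s))" by (simp add: exp_of_real[symmetric])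
      moreover have "1 - exp (- 2 * s) > 0" using elim by simp
      ultimately have q: "Ln (1 - exp (2 * (- complex_of_real s))) = of_real (ln (1 - exp (- 2 * s)))"
        by (simp only: Ln_of_real)
      show ?case unfolding T_def p q by simp
    qed
    ultimately show ?thesis by (force intro: Lim_transform_eventually)
  qed
  moreover have "\<forall>\<^sub>F s::real in at_right 0. T (- of_real s) = c"
    using eventually_at_right_less[of 0] by eventually_elim (auto intro!: c simp: S_def)
  ultimately have "((\<lambda>s::real. c) \<longlongrightarrow> 0) (at_right (0::real))"
    by (rule Lim_transform_eventually)
  hence "c = 0" by (simp add: tendsto_const_iff)
  moreover have "x \<in> S" using assms by (auto simp: S_def)
  ultimately have "T x = 0" using c by simp
  thus ?thesis by (simp add: T_def algebra_simps add_eq_0_iff)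
qed

text \<open>The period shift supplies the \<open>2 * pi * \<i>\<close> in \<open>z\<close>, so the
  equation for \<open>w\<close> turns the dilogarithm formula into
  \<open>2 * z * phase (z / 2) = - z * Ln w\<close>. By the formula for the derivative of
  \<open>x * phase x\<close>, this value of \<open>phase\<close> is precisely the condition for a
  critical point.\<close>

lemma phase_saddle:
  assumes eq: "Li2 w - 2 * pi * \<i> * Ln w = 0" and w: "norm (1 - w) < 1" "1 - w \<notin> \<real>\<^sub>\<le>\<^sub>0"
  defines "z \<equiv> 2 * pi * \<i> + Ln (1 - w)"
  shows "phase (z / 2) = - Ln w / 2" "Re z < 0" "exp z = 1 - w"
proof -
  have w1: "1 - w \<noteq> 0" using w by auto
  define x where "x = Ln (1 - w) / 2"
  have Rx: "Re x < 0" using w w1 by (simp add: x_def)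
  thus Rz: "Re z < 0" by (simp add: x_def z_def)
  show ez: "exp z = 1 - w" using w1 by (simp add: z_def exp_add exp_two_pi_i')
  have "Im (Ln (1 - w)) \<noteq> pi"
    using w(2) w1 Im_Ln_eq_pi[of "1 - w"] by (auto simp: complex_nonpos_Reals_iff)
  hence Ix: "\<bar>Im x\<bar> < pi / 2" using mpi_less_Im_Ln[OF w1] Im_Ln_le_pi[OF w1] by (simp add: x_def)
  have e2: "1 - exp (2 * x) = w" using w1 by (simp add: x_def)
  have zx: "z / 2 = x + \<i> * pi" by (simp add: z_def x_def field_simps)
  have "4 * (z / 2 * phase (z / 2)) = 4 * (x * phase x)"
    unfolding zx using x_phase_periodic[OF Rx] by simp
  also have "\<dots> = - Li2 w - 2 * x * Ln w" using x_phase_Li2[OF Rx Ix] unfolding e2 .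
  also have "\<dots> = - z * Ln w" using eq by (simp add: z_def x_def algebra_simps)
  finally have "z * (2 * phase (z / 2)) = z * (- Ln w)" by (simp add: mult_ac)
  moreover have "z \<noteq> 0" using Rz by auto
  ultimately have "2 * phase (z / 2) = - Ln w" by (metis mult_left_cancel)
  hence "(2 * phase (z / 2)) / 2 = - Ln w / 2" by (simp only:)
  thus "phase (z / 2) = - Ln w / 2" by simp
qed

section \<open>Contour representation of the Laurent coefficients\<close>

text \<open>The integrand for the coefficient, \<open>(q + 1) powi (- (m + 1)) / qpoch N q\<close>,
  pulled back by \<open>q = - exp (x / N)\<close>; then \<open>q + 1 = 1 - exp (x / N)\<close> and
  the first factor is \<open>dq / dx\<close>.\<close>

definition kern :: "int \<Rightarrow> nat \<Rightarrow> complex \<Rightarrow> complex" where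
  "kern m N x = - exp (x / of_nat N) / of_nat N *
     (inverse (qpoch N (- exp (x / of_nat N))) * (1 - exp (x / of_nat N)) powi (- (m + 1)))"

lemma qpoch_holomorphic [holomorphic_intros]:
  "f holomorphic_on S \<Longrightarrow> (\<lambda>x. qpoch N (f x)) holomorphic_on S"
  unfolding qpoch_def by (intro holomorphic_intros)

lemma slit_dom_divide:
  assumes "x \<in> slit_dom" "N \<ge> 1"
  shows "x / of_nat N \<in> slit_dom"
proof -
  have "x / of_nat N = of_real (1 / real N) * x" by simp
  thus ?thesis using slit_dom_scale[OF assms(1), of "1 / real N"] assms(2) by simp
qed

lemma one_minus_exp_nz:
  assumes "x \<in> slit_dom" "x \<noteq> 0" "N \<ge> 1"
  shows "1 - exp (x / of_nat N) \<noteq> 0"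
  using expm1_over_not_nonpos[OF slit_dom_divide[OF assms(1,3)]] assms
  by (auto simp: one_minus_exp)

lemma qpoch_exp_nz:
  assumes "x \<in> slit_dom" "x \<noteq> 0" "N \<ge> 1"
  shows "qpoch N (- exp (x / of_nat N)) \<noteq> 0"
  using qpoch_exp_formula[OF assms(1,3)] assms by simp

lemma kern_holomorphic:
  assumes "N \<ge> 1"
  shows "kern m N holomorphic_on slit_dom - {0}"
  unfolding kern_def[abs_def] using assms one_minus_exp_nz qpoch_exp_nz
  by (intro holomorphic_intros) auto

lemma kern_cnj: "kern m N (cnj x) = cnj (kern m N x)"
proof -
  have 1: "exp (cnj x / of_nat N) = cnj (exp (x / of_nat N))" by (simp add: exp_cnj)
  have 2: "qpoch N (cnj q) = cnj (qpoch N q)" for q by (simp add: qpoch_def)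
  have 3: "(1 - cnj q) powi k = cnj ((1 - q) powi k)" for q k
    by (simp add: power_int_def)
  show ?thesis unfolding kern_def 1 3 by (simp add: 2[symmetric])
qed

text \<open>The coefficient is a residue in \<open>q + 1\<close>. The substitution maps a small
  circle around 0 to a loop that winds once around 0, so the residue theorem carries the value over;
  homotopy invariance inside \<open>slit_dom\<close> then allows any radius below
  \<open>pi\<close>.\<close>

lemma A_coeff_residue:
  assumes N: "N \<ge> 1" and "0 < \<epsilon>'" "\<epsilon>' < pi"
  shows "contour_integral (circlepath 0 \<epsilon>') (kern m N) = 2 * pi * \<i> * A_coeff m (-1) N"
proof -
  define f where "f q = inverse (qpoch N q)" for q
  define \<phi> where "\<phi> y = f (-1 + y) * y powi (- (m + 1))" for y
  have hq: "qpoch N holomorphic_on UNIV" by (intro holomorphic_intros)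
  hence an: "qpoch N analytic_on {-1}" by (metis analytic_on_open analytic_on_subset open_UNIV subset_UNIV)
  have F: "(\<lambda>y. f (-1 + y)) has_laurent_expansion laurent_expansion f (-1)"
    unfolding f_def using an
    by (intro not_essential_has_laurent_expansion isolated_singularity_at_inverse not_essential_inverse
          isolated_singularity_at_analytic not_essential_analytic)
  have "{q. qpoch N q = 0} \<subseteq> (\<Union>k\<in>{1..N}. {q. q ^ k = 1})"
    by (auto simp: qpoch_def)
  moreover have "finite (\<Union>k\<in>{1..N}. {q::complex. q ^ k = 1})"
    by (intro finite_UN_I finite_roots_unity) auto
  ultimately have "finite {q. qpoch N q = 0}" by (rule finite_subset)
  from finite_set_avoid[OF this, of "-1"] obtain r where r: "r > 0" "\<And>q. qpoch N q = 0 \<Longrightarrow> q \<noteq> -1 \<Longrightarrow> r \<le> dist (-1) q"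
    by auto
  have nz: "qpoch N (-1 + y) \<noteq> 0" if "y \<in> ball 0 r - {0}" for y
    using r(2)[of "-1 + y"] that by (auto simp: dist_norm)
  have hf: "(\<lambda>y. f (-1 + y)) holomorphic_on ball 0 r - {0}"
    unfolding f_def using nz by (intro holomorphic_intros) auto
  have h\<phi>: "\<phi> holomorphic_on ball 0 r - {0}"
    unfolding \<phi>_def by (intro holomorphic_intros hf) auto
  have r1: "(\<phi> has_contour_integral complex_of_real (2 * pi) * \<i> * fls_nth (laurent_expansion f (-1)) m) (circlepath 0 (r/2))"
    unfolding \<phi>_def using r by (intro fls_nth_as_contour_integral[OF F hf]) auto
  have r2: "(\<phi> has_contour_integral 2 * pi * \<i> * residue \<phi> 0) (circlepath 0 (r/2))"
    using r by (intro base_residue[of "ball 0 r"] h\<phi>) auto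
  have res\<phi>: "residue \<phi> 0 = A_coeff m (-1) N"
    using has_contour_integral_unique[OF r1 r2] by (simp add: A_coeff_def f_def[abs_def])
  define h where "h x = 1 - exp (x / of_nat N)" for x :: complex
  have hh: "h holomorphic_on S" for S unfolding h_def by (intro holomorphic_intros) (use N in auto)
  have dh: "deriv h x = - exp (x / of_nat N) / of_nat N" for x
    unfolding h_def[abs_def] using N by (intro DERIV_imp_deriv) (auto intro!: derivative_eq_intros)
  have "isCont h 0" unfolding h_def[abs_def] using N by (intro continuous_intros) auto
  hence "\<exists>d>0. \<forall>x. dist x 0 < d \<longrightarrow> dist (h x) (h 0) < r"
    using r(1) unfolding continuous_at_eps_delta by blast
  then obtain d where d: "d > 0" "\<And>x. norm x < d \<Longrightarrow> norm (h x) < r"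
    by (auto simp: h_def dist_norm)
  define \<epsilon> where "\<epsilon> = min (d / 2) 1"
  have \<epsilon>: "\<epsilon> > 0" "\<epsilon> < d" "\<epsilon> \<le> 1" using d by (auto simp: \<epsilon>_def)
  have cb: "cball 0 \<epsilon>1 \<subseteq> slit_dom" if "\<epsilon>1 < pi" for \<epsilon>1
  proof
    fix x :: complex assume "x \<in> cball 0 \<epsilon>1"
    hence "\<bar>Im x\<bar> \<le> \<epsilon>1" using abs_Im_le_cmod[of x] by auto
    thus "x \<in> slit_dom" using that by (auto simp: slit_dom_def)
  qed
  have pi1: "(1::real) < pi" using pi_gt3 by simp
  define \<gamma> where "\<gamma> = circlepath (0::complex) \<epsilon>"
  have pimg: "path_image \<gamma> \<subseteq> cball 0 \<epsilon> - {0}" using \<epsilon> by (auto simp: \<gamma>_def)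
  have himg: "h x \<in> ball 0 r - {0}" if "x \<in> cball 0 \<epsilon> - {0}" for x
  proof -
    have "x \<in> slit_dom" using cb[of \<epsilon>] \<epsilon> pi1 that by auto
    thus ?thesis using one_minus_exp_nz[of x N] N that d(2)[of x] \<epsilon> by (auto simp: h_def)
  qed
  define g where "g = h \<circ> \<gamma>"
  have gv: "valid_path g" unfolding g_def
    by (intro valid_path_compose_holomorphic[of \<gamma> h UNIV] hh) (auto simp: \<gamma>_def)
  have gimg: "path_image g \<subseteq> ball 0 r - {0}"
    unfolding g_def path_image_compose using himg pimg by (intro image_subsetI) blast
  have gloop: "pathfinish g = pathstart g" by (simp add: g_def \<gamma>_def pathfinish_compose pathstart_compose)
  have anh: "h analytic_on UNIV" using hh[of UNIV] by (simp add: analytic_on_open)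
  \<comment> \<open>The logarithmic derivative of \<open>h\<close> is a function with value 1 at 0
    divided by \<open>u\<close>, so Cauchy's formula evaluates the winding number.\<close>
  have wn: "winding_number g 0 = 1"
  proof -
    have "winding_number g 0 = 1 / (2 * pi * \<i>) * contour_integral g (\<lambda>w. 1 / (w - 0))"
      by (rule winding_number_valid_path[OF gv]) (use gimg in auto)
    also have "contour_integral g (\<lambda>w. 1 / (w - 0)) = contour_integral \<gamma> (\<lambda>w. deriv h w * (1 / (h w - 0)))"
      unfolding g_def by (rule contour_integral_comp_analyticW[OF anh]) (auto simp: \<gamma>_def)
    also have "\<dots> = contour_integral \<gamma> (\<lambda>u. (exp (u / of_nat N) / expm1_over (u / of_nat N)) / (u - 0))"
    proof (rule contour_integral_cong[OF refl])
      fix u assume "u \<in> path_image \<gamma>"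
      hence "u \<noteq> 0" using pimg by auto
      thus "deriv h u * (1 / (h u - 0)) = (exp (u / of_nat N) / expm1_over (u / of_nat N)) / (u - 0)"
        unfolding dh using N by (simp add: h_def one_minus_exp field_simps)
    qed
    also have "\<dots> = 2 * of_real pi * \<i> * (exp (0 / of_nat N) / expm1_over (0 / of_nat N))"
    proof (rule contour_integral_unique, unfold \<gamma>_def, rule Cauchy_integral_circlepath_simple)
      have nz: "expm1_over (u / of_nat N) \<noteq> 0" if "u \<in> cball 0 \<epsilon>" for u
        using expm1_over_not_nonpos[OF slit_dom_divide[OF _ N, of u]] cb[of \<epsilon>] \<epsilon> pi1 that by auto
      have "(\<lambda>u. expm1_over (u / of_nat N)) holomorphic_on cball 0 \<epsilon>"
      proof -
        have "(\<lambda>u. u / of_nat N) holomorphic_on cball 0 \<epsilon>" using N by (intro holomorphic_intros) auto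
        from holomorphic_on_compose_gen[OF this expm1_over_holomorphic[of UNIV]] show ?thesis by (simp add: o_def)
      qed
      thus "(\<lambda>u. exp (u / of_nat N) / expm1_over (u / of_nat N)) holomorphic_on cball 0 \<epsilon>"
        using nz N by (intro holomorphic_intros) auto
    qed (use \<epsilon> in auto)
    finally show ?thesis by (simp add: expm1_over_def)
  qed
  have "contour_integral g \<phi> = 2 * pi * \<i> * (\<Sum>p\<in>{0}. winding_number g p * residue \<phi> p)"
  proof (rule Residue_theorem[OF _ _ _ h\<phi> gv gloop gimg])
    show "\<forall>z. z \<notin> ball 0 r \<longrightarrow> winding_number g z = 0"
      using gimg gv gloop by (auto intro!: winding_number_zero_outside[of g "ball 0 r"] valid_path_imp_path)
  qed auto
  hence 1: "contour_integral g \<phi> = 2 * pi * \<i> * A_coeff m (-1) N" by (simp add: wn res\<phi>)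
  have "contour_integral g \<phi> = contour_integral \<gamma> (\<lambda>w. deriv h w * \<phi> (h w))"
    unfolding g_def by (rule contour_integral_comp_analyticW[OF anh]) (auto simp: \<gamma>_def)
  also have "(\<lambda>w. deriv h w * \<phi> (h w)) = kern m N"
    by (rule ext) (simp add: dh kern_def \<phi>_def f_def h_def)
  finally have 2: "contour_integral (circlepath 0 \<epsilon>) (kern m N) = 2 * pi * \<i> * A_coeff m (-1) N"
    using 1 by (simp add: \<gamma>_def)
  have zero: "0 \<in> slit_dom" by (simp add: slit_dom_def)
  have "contour_integral (circlepath 0 \<epsilon>1) (kern m N) = 2 * pi * \<i> * residue (kern m N) 0" if "0 < \<epsilon>1" "\<epsilon>1 < pi" for \<epsilon>1
    by (intro contour_integral_unique base_residue[OF open_slit_dom zero _ kern_holomorphic[OF N]] cb that)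
  from this[OF assms(2,3)] this[OF \<epsilon>(1)] show ?thesis using 2 \<epsilon> pi1 by simp
qed

text \<open>The rectangle may extend arbitrarily far to the left and right as long as its height
  stays inside the strip: 0 is the only singularity it can enclose.\<close>

lemma A_coeff_rectpath:
  assumes N: "N \<ge> 1" and l: "l > 0" "R > 0" "0 < Y" "Y < pi"
  shows "contour_integral (rectpath (Complex (- l) (- Y)) (Complex R Y)) (kern m N) = 2 * pi * \<i> * A_coeff m (-1) N"
proof -
  let ?g = "rectpath (Complex (- l) (- Y)) (Complex R Y)"
  have zero: "0 \<in> slit_dom" by (simp add: slit_dom_def)
  have cboxs: "cbox (Complex (- l) (- Y)) (Complex R Y) \<subseteq> slit_dom"
    using l by (auto simp: in_cbox_complex_iff slit_dom_def)
  have box0: "0 \<in> box (Complex (- l) (- Y)) (Complex R Y)" using l by (auto simp: in_box_complex_iff)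
  have img: "path_image ?g \<subseteq> slit_dom - {0}"
    using path_image_rectpath_cbox_minus_box[of "Complex (- l) (- Y)" "Complex R Y"] l cboxs box0 by auto
  have conn: "connected slit_dom"
    using slit_dom_segment zero by (intro starlike_imp_connected) (auto simp: starlike_def)
  have "contour_integral ?g (kern m N) = 2 * pi * \<i> * (\<Sum>p\<in>{0}. winding_number ?g p * residue (kern m N) p)"
  proof (rule Residue_theorem[OF open_slit_dom conn _ kern_holomorphic[OF N]])
    show "\<forall>z. z \<notin> slit_dom \<longrightarrow> winding_number ?g z = 0"
      using cboxs l by (auto intro!: winding_number_rectpath_outside)
  qed (use img in auto)
  also have "\<dots> = 2 * pi * \<i> * residue (kern m N) 0"
    using winding_number_rectpath[OF box0] by simp
  also have "\<dots> = contour_integral (circlepath 0 1) (kern m N)"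
  proof -
    have "cball 0 1 \<subseteq> slit_dom"
    proof
      fix x :: complex assume "x \<in> cball 0 1"
      hence "\<bar>Im x\<bar> \<le> 1" using abs_Im_le_cmod[of x] by auto
      thus "x \<in> slit_dom" using pi_gt3 by (auto simp: slit_dom_def)
    qed
    thus ?thesis
      by (intro contour_integral_unique[symmetric] base_residue[OF open_slit_dom zero _ kern_holomorphic[OF N]]) auto
  qed
  also have "\<dots> = 2 * pi * \<i> * A_coeff m (-1) N"
    using pi_gt3 by (intro A_coeff_residue[OF N]) auto
  finally show ?thesis .
qed

lemma contour_integral_linepath_cnj:
  assumes "\<And>x. f (cnj x) = cnj (f x)"
  shows "contour_integral (linepath (cnj a) (cnj b)) f = cnj (contour_integral (linepath a b) f)"
proof -
  have "contour_integral (cnj \<circ> linepath a b) f = cnj (contour_integral (linepath a b) (cnj \<circ> f \<circ> cnj))"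
    by (rule contour_integral_cnj) simp
  moreover have "cnj \<circ> linepath a b = linepath (cnj a) (cnj b)"
    by (auto simp: linepath_def)
  moreover have "cnj \<circ> f \<circ> cnj = f" using assms by auto
  ultimately show ?thesis by simp
qed

text \<open>The left side of the rectangle is replaced by a detour through \<open>xT\<close> and its
  conjugate. The two long pieces are conjugate to each other and traversed in opposite directions,
  so together they give \<open>2 * pi * \<i>\<close> times a real part.\<close>

lemma A_coeff_decomposition:
  fixes xA xT :: complex
  assumes N: "N \<ge> 1" and R: "R > 0" and xA: "Re xA < 0" "0 < Im xA" "Im xA < pi" and xT: "Re xT < 0"
  shows "2 * pi * \<i> * (A_coeff m (-1) N - of_real (Re (contour_integral (linepath xA xT) (kern m N) / (pi * \<i>)))) =
     contour_integral (linepath (cnj xA) (Complex R (- Im xA))) (kern m N) +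
     contour_integral (linepath (Complex R (- Im xA)) (Complex R (Im xA))) (kern m N) +
     contour_integral (linepath (Complex R (Im xA)) xA) (kern m N) +
     contour_integral (linepath xT (cnj xT)) (kern m N)"
proof -
  let ?c = "\<lambda>a b. contour_integral (linepath a b) (kern m N)"
  define H where "H = {x::complex. Re x < 0}"
  have H: "open H" "convex H" "H \<subseteq> slit_dom - {0}"
    using Re_neg_slit by (auto simp: H_def open_halfspace_Re_lt convex_halfspace_Re_lt)
  obtain P where P: "\<And>x. x \<in> H \<Longrightarrow> (P has_field_derivative kern m N x) (at x within H)"
    using holomorphic_convex_primitive'[OF H(2,1) holomorphic_on_subset[OF kern_holomorphic[OF N] H(3)]] by blast
  have cP: "?c a b = P b - P a" if "a \<in> H" "b \<in> H" for a b
    using contour_integral_primitive[OF P, of "linepath a b"] that closed_segment_subset[OF that H(2)]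
    by (intro contour_integral_unique) auto
  define J where "J = ?c xA xT"
  have mem: "xA \<in> H" "xT \<in> H" "cnj xA \<in> H" "cnj xT \<in> H" using xA xT by (auto simp: H_def)
  have cJ: "?c (cnj xT) (cnj xA) = - cnj J"
  proof -
    have "?c (cnj xA) (cnj xT) = cnj J" unfolding J_def by (rule contour_integral_linepath_cnj[of "kern m N", OF kern_cnj])
    thus ?thesis using cP mem by (metis minus_diff_eq)
  qed
  \<comment> \<open>The half plane is convex and free of poles, so \<open>kern\<close> has a
    primitive there and the detour has the same integral as the side.\<close>
  have left: "?c xA (cnj xA) = J + ?c xT (cnj xT) - cnj J"
  proof -
    have "?c xA (cnj xA) = J + ?c xT (cnj xT) + ?c (cnj xT) (cnj xA)" using cP mem by (simp add: J_def)
    thus ?thesis using cJ by simp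
  qed
  have slit: "closed_segment a b \<subseteq> slit_dom - {0}" if "a \<in> {cnj xA, Complex R (- Im xA), Complex R (Im xA), xA}"
    "b \<in> {cnj xA, Complex R (- Im xA), Complex R (Im xA), xA}" "Im a \<noteq> Im b \<longrightarrow> Re a = Re b" for a b
  proof
    fix x assume "x \<in> closed_segment a b"
    then obtain t where t: "t \<in> {0..1}" "x = (1 - t) *\<^sub>R a + t *\<^sub>R b" by (auto simp: closed_segment_def)
    have ima: "\<bar>Im a\<bar> = Im xA" "\<bar>Im b\<bar> = Im xA" and rea: "Re a \<noteq> 0" using that(1,2) xA R by auto
    have reim: "Im x = (1 - t) * Im a + t * Im b" "Re x = (1 - t) * Re a + t * Re b" using t(2) by simp_all
    show "x \<in> slit_dom - {0}"
    proof (cases "Im a = Im b")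
      case True
      hence "Im x = Im a" using reim by (simp add: algebra_simps)
      hence "\<bar>Im x\<bar> = Im xA" using ima by simp
      thus ?thesis using xA by (auto simp: slit_dom_def)
    next
      case False
      hence ab: "Re a = Re b" using that(3) by simp
      hence "Re x = Re a" using reim by (simp add: algebra_simps)
      moreover note rea
      moreover have "\<bar>Im x\<bar> \<le> Im xA"
      proof -
        have "\<bar>Im x\<bar> \<le> (1 - t) * \<bar>Im a\<bar> + t * \<bar>Im b\<bar>"
          using t(1) reim abs_triangle_ineq[of "(1 - t) * Im a" "t * Im b"] by (simp add: abs_mult)
        thus ?thesis unfolding ima by (simp add: algebra_simps)
      qed
      ultimately show ?thesis using xA by (auto simp: slit_dom_def)
    qed
  qed
  have int: "kern m N contour_integrable_on linepath a b" if "closed_segment a b \<subseteq> slit_dom - {0}" for a b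
    by (intro contour_integrable_continuous_linepath holomorphic_on_imp_continuous_on
          holomorphic_on_subset[OF kern_holomorphic[OF N] that])
  have i1: "kern m N contour_integrable_on linepath (cnj xA) (Complex R (- Im xA))" by (intro int slit) auto
  have i2: "kern m N contour_integrable_on linepath (Complex R (- Im xA)) (Complex R (Im xA))" by (intro int slit) auto
  have i3: "kern m N contour_integrable_on linepath (Complex R (Im xA)) xA" by (intro int slit) auto
  have i4: "kern m N contour_integrable_on linepath xA (cnj xA)" by (intro int slit) auto
  have c1: "Complex (- (- Re xA)) (- Im xA) = cnj xA" "Complex (- (- Re xA)) (Im xA) = xA" by (simp_all add: complex_eq_iff)
  have "2 * pi * \<i> * A_coeff m (-1) N = contour_integral (rectpath (Complex (- (- Re xA)) (- Im xA)) (Complex R (Im xA))) (kern m N)"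
    by (rule A_coeff_rectpath[symmetric]) (use N R xA in auto)
  also have "\<dots> = ?c (cnj xA) (Complex R (- Im xA)) + (?c (Complex R (- Im xA)) (Complex R (Im xA)) + (?c (Complex R (Im xA)) xA + ?c xA (cnj xA)))"
    unfolding rectpath_def Let_def using i1 i2 i3 i4 
    by (simp add: c1[simplified] contour_integral_join contour_integrable_join)
  finally have eq: "2 * pi * \<i> * A_coeff m (-1) N = ?c (cnj xA) (Complex R (- Im xA)) + (?c (Complex R (- Im xA)) (Complex R (Im xA)) + (?c (Complex R (Im xA)) xA + (J + ?c xT (cnj xT) - cnj J)))"
    unfolding left .
  have Jeq: "2 * pi * \<i> * of_real (Re (J / (pi * \<i>))) = J - cnj J"
    by (simp add: complex_eq_iff Re_divide Im_divide power2_eq_square)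
  show ?thesis unfolding J_def[symmetric] right_diff_distrib eq Jeq by simp
qed

section \<open>Numerical bounds on the growth rate\<close>

lemma cos_ge_quadratic: "1 - x\<^sup>2 / 2 \<le> cos x" for x :: real
proof -
  have "\<bar>sin (x/2)\<bar> \<le> \<bar>x/2\<bar>" by (rule abs_sin_x_le_abs_x)
  hence "(sin (x/2))\<^sup>2 \<le> (x/2)\<^sup>2" by (rule abs_le_square_iff[THEN iffD1])
  moreover have "cos x = 1 - 2 * (sin (x/2))\<^sup>2" using cos_double_sin[of "x/2"] by simp
  ultimately show ?thesis by (simp add: power_divide)
qed

lemma sin_ge_cubic: "x - x ^ 3 / 6 \<le> sin x" if "x \<ge> 0" for x :: real
proof -
  have "(\<lambda>t. sin t - (t - t ^ 3 / 6)) 0 \<le> (\<lambda>t. sin t - (t - t ^ 3 / 6)) x"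
  proof (rule DERIV_nonneg_imp_nondecreasing[OF that])
    fix t assume t: "0 \<le> t" "t \<le> x"
    have "((\<lambda>t. sin t - (t - t ^ 3 / 6)) has_real_derivative cos t - (1 - t\<^sup>2 / 2)) (at t)"
      by (auto intro!: derivative_eq_intros simp: power2_eq_square)
    thus "\<exists>y. ((\<lambda>t. sin t - (t - t ^ 3 / 6)) has_real_derivative y) (at t) \<and> 0 \<le> y"
      using cos_ge_quadratic[of t] by (intro exI[of _ "cos t - (1 - t\<^sup>2 / 2)"]) auto
  qed
  thus ?thesis by simp
qed

text \<open>Splitting the exponent into \<open>n\<close> parts makes the quadratic Taylor bound
  sharp enough for the numerical estimates, which become evaluations of rational numbers.\<close>

lemma exp_ge_power: "(1 + x / real n + (x / real n)\<^sup>2 / 2) ^ n \<le> exp x" if "x \<ge> 0" "n > 0" for x :: real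
proof -
  have "(1 + x / real n + (x / real n)\<^sup>2 / 2) ^ n \<le> exp (x / real n) ^ n"
    using that by (intro power_mono exp_lower_Taylor_quadratic) auto
  also have "\<dots> = exp x" using that by (simp flip: exp_of_nat_mult)
  finally show ?thesis .
qed

text \<open>For a rational exponent the claim reduces, after taking \<open>q\<close>-th powers, to
  an inequality between rationals and the bound \<open>exp 1 < 2.72\<close>.\<close>

lemma exp_le_via_e:
  assumes "(272/100) ^ p \<le> (y::real) ^ q" "y > 0" "q > 0" "x = real p / real q"
  shows "exp x \<le> y"
proof -
  have "exp x ^ q = exp 1 ^ p" using assms(3,4) by (simp flip: exp_of_nat_mult)
  also have "\<dots> \<le> (272/100) ^ p" using e_less_272 by (intro power_mono) auto
  also have "\<dots> \<le> y ^ q" by (rule assms)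
  finally show ?thesis using assms(2,3) by (metis power_mono_iff exp_ge_zero less_imp_le)
qed

section \<open>Lower bounds for the norm of 1 - exp\<close>

lemma norm_one_minus_exp:
  "(norm (1 - exp (Complex \<alpha> \<beta>)))\<^sup>2 = 1 - 2 * exp \<alpha> * cos \<beta> + (exp \<alpha>)\<^sup>2"
proof -
  have "(norm (1 - exp (Complex \<alpha> \<beta>)))\<^sup>2 = (1 - exp \<alpha> * cos \<beta>)\<^sup>2 + (exp \<alpha> * sin \<beta>)\<^sup>2"
    by (simp add: cmod_power2 Re_exp Im_exp)
  also have "\<dots> = 1 - 2 * exp \<alpha> * cos \<beta> + (exp \<alpha>)\<^sup>2 * ((sin \<beta>)\<^sup>2 + (cos \<beta>)\<^sup>2)"
    by algebra
  finally show ?thesis by simp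
qed

text \<open>Dropping the square \<open>(1 - exp \<alpha>)\<^sup>2\<close> leaves the factor
  \<open>exp (\<alpha> / 2) * 2 * sin (\<beta> / 2)\<close>. The slope \<open>22/100\<close> bounds
  the ratio of real to imaginary part on the left part of the horizontal side, and the limit
  \<open>26/10\<close> keeps \<open>\<beta>\<^sup>2 / 24\<close> below \<open>2/7\<close>, as the
  estimate of the logarithm demands.\<close>

lemma norm_one_minus_exp_small_angle:
  assumes "0 < \<beta>" "\<beta> \<le> (26/10)" "\<alpha> \<ge> - (22/100) * \<beta>"
  shows "- ln (norm (1 - exp (Complex \<alpha> \<beta>))) \<le> (11/100) * \<beta> - ln \<beta> + \<beta>\<^sup>2 / 24 + (7/10) * (\<beta>\<^sup>2 / 24)\<^sup>2"
proof -
  define w where "w = \<beta>\<^sup>2 / 24"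
  have "\<beta>\<^sup>2 \<le> (26/10)\<^sup>2" using assms by (intro power_mono) auto
  hence w: "0 \<le> w" "w \<le> (282/1000)" by (auto simp: w_def power2_eq_square)
  have "(exp (\<alpha>/2) * (2 * sin (\<beta>/2)))\<^sup>2 = exp \<alpha> * (4 * (sin (\<beta>/2))\<^sup>2)"
    by (simp add: power_mult_distrib flip: exp_double)
  also have "4 * (sin (\<beta>/2))\<^sup>2 = 2 * (1 - cos \<beta>)" using cos_double_sin[of "\<beta>/2"] by simp
  also have "exp \<alpha> * (2 * (1 - cos \<beta>)) \<le> (norm (1 - exp (Complex \<alpha> \<beta>)))\<^sup>2"
  proof -
    have "0 \<le> (1 - exp \<alpha>)\<^sup>2" by simp
    thus ?thesis unfolding norm_one_minus_exp by (simp add: power2_eq_square algebra_simps)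
  qed
  finally have 1: "exp (\<alpha>/2) * (2 * sin (\<beta>/2)) \<le> norm (1 - exp (Complex \<alpha> \<beta>))"
    by (rule power2_le_imp_le) simp
  have "\<beta> * (1 - w) = 2 * (\<beta>/2 - (\<beta>/2) ^ 3 / 6)" by (simp add: w_def power2_eq_square power3_eq_cube algebra_simps)
  also have "\<dots> \<le> 2 * sin (\<beta>/2)" using sin_ge_cubic[of "\<beta>/2"] assms by simp
  finally have 2: "\<beta> * (1 - w) \<le> 2 * sin (\<beta>/2)" .
  have pos: "\<beta> * (1 - w) > 0" using assms w by simp
  have "exp (- (11/100) * \<beta>) * (\<beta> * (1 - w)) \<le> exp (\<alpha>/2) * (2 * sin (\<beta>/2))"
    using assms pos 2 mult_mono[of "exp (- (11/100) * \<beta>)" "exp (\<alpha>/2)" "\<beta> * (1 - w)" "2 * sin (\<beta>/2)"] by simp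
  hence 3: "exp (- (11/100) * \<beta>) * (\<beta> * (1 - w)) \<le> norm (1 - exp (Complex \<alpha> \<beta>))" using 1 by linarith
  have "ln (exp (- (11/100) * \<beta>) * (\<beta> * (1 - w))) \<le> ln (norm (1 - exp (Complex \<alpha> \<beta>)))"
    using pos by (intro ln_mono 3) simp
  moreover have "ln (exp (- (11/100) * \<beta>) * (\<beta> * (1 - w))) = - (11/100) * \<beta> + ln \<beta> + ln (1 - w)"
    using assms w by (simp add: ln_mult)
  \<comment> \<open>The difference has derivative \<open>u * (0.4 - 1.4 * u) / (1 - u)\<close>,
    nonnegative up to \<open>u = 2/7\<close>; \<open>w \<le> 0.282\<close> stays below.\<close>
  moreover have "- ln (1 - w) \<le> w + (7/10) * w\<^sup>2"
  proof -
    have "(\<lambda>u. u + (7/10) * u\<^sup>2 + ln (1 - u)) 0 \<le> (\<lambda>u. u + (7/10) * u\<^sup>2 + ln (1 - u)) w"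
    proof (rule DERIV_nonneg_imp_nondecreasing[OF w(1)])
      fix u assume u: "0 \<le> u" "u \<le> w"
      have "((\<lambda>u. u + (7/10) * u\<^sup>2 + ln (1 - u)) has_real_derivative 1 + (14/10) * u - 1 / (1 - u)) (at u)"
        using u w by (auto intro!: derivative_eq_intros)
      moreover have "1 + (14/10) * u - 1 / (1 - u) = u * ((4/10) - (14/10) * u) / (1 - u)"
        using u w by (simp add: field_simps)
      moreover have "u * ((4/10) - (14/10) * u) / (1 - u) \<ge> 0"
        using u w by (intro divide_nonneg_pos mult_nonneg_nonneg) auto
      ultimately show "\<exists>y. ((\<lambda>u. u + (7/10) * u\<^sup>2 + ln (1 - u)) has_real_derivative y) (at u) \<and> 0 \<le> y"
        by (intro exI[of _ "1 + (14/10) * u - 1 / (1 - u)"]) simp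
    qed
    thus ?thesis by simp
  qed
  ultimately show ?thesis by (simp add: w_def)
qed

text \<open>For an obtuse angle \<open>1 - exp \<alpha> * cos \<beta>\<close> exceeds 1, so the
  logarithm helps. It is kept as a multiple of \<open>exp (- 22/100 * \<beta>) * cos \<beta>\<close>
  because that has an elementary primitive.\<close>

lemma norm_one_minus_exp_obtuse:
  assumes "(26/10) \<le> \<beta>" "\<beta> \<le> 3 * pi / 2" "\<alpha> \<ge> - (22/100) * \<beta>"
  shows "- ln (norm (1 - exp (Complex \<alpha> \<beta>))) \<le> (7/10) * exp (- (22/100) * \<beta>) * cos \<beta>"
proof -
  have cneg: "cos \<beta> \<le> 0"
  proof -
    have "cos (\<beta> - pi) \<ge> 0" using assms pi_less_4 by (intro cos_ge_zero) auto
    thus ?thesis by (simp add: cos_diff)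
  qed
  define v where "v = exp (- (22/100) * \<beta>) * (- cos \<beta>)"
  have "exp ((22/100) * \<beta>) \<ge> 1 + (22/100) * \<beta> + ((22/100) * \<beta>)\<^sup>2 / 2"
    using exp_lower_Taylor_quadratic[of "(22/100) * \<beta>"] assms by simp
  moreover have "((572/1000))\<^sup>2 \<le> ((22/100) * \<beta>)\<^sup>2" using assms by (intro power_mono) auto
  ultimately have "exp ((22/100) * \<beta>) \<ge> (17/10)" using assms by (simp add: power2_eq_square)
  hence e: "exp (- (22/100) * \<beta>) \<le> (6/10)" by (simp add: exp_minus field_simps)
  have "0 \<le> v" unfolding v_def using cneg by (intro mult_nonneg_nonneg) auto
  moreover have "v \<le> (6/10) * 1"
    unfolding v_def using cneg e cos_ge_minus_one[of \<beta>] by (intro mult_mono) auto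
  ultimately have v: "0 \<le> v" "v \<le> (6/10)" by auto
  have ea: "exp \<alpha> * (- cos \<beta>) \<ge> v" unfolding v_def using assms cneg by (intro mult_right_mono) auto
  have "(1 + exp \<alpha> * (- cos \<beta>))\<^sup>2 \<le> (norm (1 - exp (Complex \<alpha> \<beta>)))\<^sup>2"
  proof -
    have "(exp \<alpha>)\<^sup>2 * (cos \<beta>)\<^sup>2 \<le> (exp \<alpha>)\<^sup>2 * 1" using abs_cos_le_one[of \<beta>] by (intro mult_left_mono) (auto simp: abs_square_le_1)
    thus ?thesis unfolding norm_one_minus_exp by (simp add: power2_eq_square algebra_simps)
  qed
  hence "1 + exp \<alpha> * (- cos \<beta>) \<le> norm (1 - exp (Complex \<alpha> \<beta>))" by (rule power2_le_imp_le) simp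
  hence "1 + v \<le> norm (1 - exp (Complex \<alpha> \<beta>))" using ea by linarith
  hence "ln (1 + v) \<le> ln (norm (1 - exp (Complex \<alpha> \<beta>)))" using v by (intro ln_mono) auto
  \<comment> \<open>The factor \<open>7/10\<close> works for \<open>v\<close> up to
    \<open>0.3 / 0.49\<close>, just above the available \<open>6/10\<close>.\<close>
  moreover have "(7/10) * v \<le> ln (1 + v)"
  proof -
    have "exp ((7/10) * v) \<le> 1 + (7/10) * v + ((7/10) * v)\<^sup>2" using v by (intro exp_bound) auto
    also have "\<dots> \<le> 1 + v"
    proof -
      have "v * ((49/100) * v) \<le> v * (3/10)" using v by (intro mult_left_mono) auto
      thus ?thesis by (simp add: power2_eq_square algebra_simps)
    qed
    finally show ?thesis using v by (subst ln_ge_iff) auto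
  qed
  ultimately show ?thesis by (simp add: v_def)
qed

text \<open>The left side is the distance from 1 to the line through 0 in direction
  \<open>\<beta>\<close>, which contains the value of \<open>exp\<close>.\<close>

lemma norm_one_minus_exp_ge_sin: "\<bar>sin \<beta>\<bar> \<le> norm (1 - exp (Complex \<alpha> \<beta>))"
proof -
  have "(sin \<beta>)\<^sup>2 \<le> (exp \<alpha> - cos \<beta>)\<^sup>2 + (sin \<beta>)\<^sup>2" by simp
  also have "\<dots> = (norm (1 - exp (Complex \<alpha> \<beta>)))\<^sup>2"
    unfolding norm_one_minus_exp using sin_cos_squared_add[of \<beta>] by (simp add: power2_eq_square algebra_simps)
  finally have "\<bar>sin \<beta>\<bar>\<^sup>2 \<le> (norm (1 - exp (Complex \<alpha> \<beta>)))\<^sup>2" by simp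
  thus ?thesis by (rule power2_le_imp_le) simp
qed

text \<open>The comparison principle behind all growth bounds: a primitive \<open>m\<close> of an
  upper bound for the derivative of \<open>ray\<close> dominates its increments.\<close>

lemma ray_mono:
  assumes x: "x \<in> slit_dom" "x \<noteq> 0" and st: "0 < s" "s \<le> t" and ts: "\<And>u. s \<le> u \<Longrightarrow> u \<le> t \<Longrightarrow> of_real u * x \<in> slit_dom"
    and m: "\<And>u. s \<le> u \<Longrightarrow> u \<le> t \<Longrightarrow> (m has_real_derivative m' u) (at u)"
    and le: "\<And>u. s \<le> u \<Longrightarrow> u \<le> t \<Longrightarrow> - ln (norm (1 - exp (2 * of_real u * x))) \<le> m' u"
  shows "ray x t - ray x s \<le> m t - m s"
proof -
  have "(\<lambda>u. ray x u - m u) t \<le> (\<lambda>u. ray x u - m u) s"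
  proof (rule DERIV_nonpos_imp_nonincreasing[OF st(2)])
    fix u assume u: "s \<le> u" "u \<le> t"
    have "((\<lambda>u. ray x u - m u) has_real_derivative - ln (norm (1 - exp (2 * of_real u * x))) - m' u) (at u)"
      using u st ts by (intro DERIV_diff ray_deriv x m) auto
    thus "\<exists>y. ((\<lambda>u. ray x u - m u) has_real_derivative y) (at u) \<and> y \<le> 0"
      using le[OF u] by (intro exI[of _ "- ln (norm (1 - exp (2 * of_real u * x))) - m' u"]) auto
  qed
  thus ?thesis by simp
qed

text \<open>At 0 the derivative of \<open>ray\<close> is logarithmically infinite, so the comparison
  starts at a small \<open>s\<close> and passes to the limit, where \<open>ray\<close> and
  \<open>m\<close> both tend to 0.\<close>

lemma ray_mono_from_0:
  assumes x: "x \<in> slit_dom" "x \<noteq> 0" and t: "0 < t" "t \<le> 1"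
    and m: "\<And>u. 0 < u \<Longrightarrow> u \<le> t \<Longrightarrow> (m has_real_derivative m' u) (at u)"
    and le: "\<And>u. 0 < u \<Longrightarrow> u \<le> t \<Longrightarrow> - ln (norm (1 - exp (2 * of_real u * x))) \<le> m' u"
    and m0: "(m \<longlongrightarrow> 0) (at_right 0)"
  shows "ray x t \<le> m t"
proof -
  have "((\<lambda>s. m t - m s + ray x s) \<longlongrightarrow> m t - 0 + 0) (at_right 0)"
    by (intro tendsto_intros m0 ray_at_0[OF x])
  moreover have "\<forall>\<^sub>F s in at_right 0. s \<in> {0<..<t}"
    using t by (intro eventually_at_right_real) auto
  hence "\<forall>\<^sub>F s in at_right 0. ray x t \<le> m t - m s + ray x s"
  proof eventually_elim
    case (elim s)
    have "ray x t - ray x s \<le> m t - m s"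
      by (rule ray_mono[OF x, where m' = m']) (use elim t m le slit_dom_scale[OF x(1)] in auto)
    thus ?case by simp
  qed
  ultimately have "ray x t \<le> m t - 0 + 0"
    by (intro tendsto_lowerbound[where f = "\<lambda>s. m t - m s + ray x s"]) auto
  thus ?thesis by simp
qed

section \<open>Growth on the right side and far to the left\<close>

lemma growth_eq_ray: "x \<noteq> 0 \<Longrightarrow> growth x = ray x 1 / 2"
  using ray_eq_growth[of x 1] by simp

text \<open>Since \<open>norm (exp (2 * u * x)) = exp (3 * u)\<close> on this line, the distance
  from 1 is at least \<open>3 * u\<close> whatever the imaginary part; integrating
  \<open>- ln (3 * t)\<close> gives the bound.\<close>

lemma growth_right_side:
  assumes "Re x = 3/2" "\<bar>Im x\<bar> < pi"
  shows "growth x \<le> (1 - ln 3) / 2"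
proof -
  have x: "x \<in> slit_dom" "x \<noteq> 0" using assms by (auto simp: slit_dom_def)
  have "ray x 1 \<le> (\<lambda>t. t - t * ln (3 * t)) 1"
  proof (rule ray_mono_from_0[OF x])
    fix u :: real assume u: "0 < u" "u \<le> 1"
    show "((\<lambda>t. t - t * ln (3 * t)) has_real_derivative - ln (3 * u)) (at u)"
      using u by (auto intro!: derivative_eq_intros)
    have "3 * u \<le> exp (3 * u) - 1" using exp_ge_add_one_self[of "3 * u"] by linarith
    also have "exp (3 * u) = norm (exp (2 * of_real u * x))" using assms by simp
    also have "norm (exp (2 * of_real u * x)) - 1 \<le> norm (1 - exp (2 * of_real u * x))"
      using norm_triangle_ineq2[of "exp (2 * of_real u * x)" 1] by (simp add: norm_minus_commute)
    finally have "3 * u \<le> norm (1 - exp (2 * of_real u * x))" .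
    hence "ln (3 * u) \<le> ln (norm (1 - exp (2 * of_real u * x)))" using u by (intro ln_mono) auto
    thus "- ln (norm (1 - exp (2 * of_real u * x))) \<le> - ln (3 * u)" by simp
  next
    show "((\<lambda>t::real. t - t * ln (3 * t)) \<longlongrightarrow> 0) (at_right 0)" by real_asymp
  qed auto
  thus ?thesis using growth_eq_ray[OF x(2)] by simp
qed

lemma ln_one_plus_square_le: "ln (1 + u\<^sup>2) \<le> u" if "u \<ge> 0" for u :: real
proof -
  have "(\<lambda>u. u - ln (1 + u\<^sup>2)) 0 \<le> (\<lambda>u. u - ln (1 + u\<^sup>2)) u"
  proof (rule DERIV_nonneg_imp_nondecreasing[OF that])
    fix t :: real assume "0 \<le> t" "t \<le> u"
    have p: "1 + t\<^sup>2 > 0" by (simp add: add_pos_nonneg)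
    have "((\<lambda>u. u - ln (1 + u\<^sup>2)) has_real_derivative 1 - 2 * t / (1 + t\<^sup>2)) (at t)"
      using p by (auto intro!: derivative_eq_intros)
    moreover have "2 * t \<le> 1 + t\<^sup>2" using zero_le_power2[of "t - 1"] by (simp add: power2_eq_square algebra_simps)
    hence "1 - 2 * t / (1 + t\<^sup>2) \<ge> 0" using p by (simp add: field_simps)
    ultimately show "\<exists>y. ((\<lambda>u. u - ln (1 + u\<^sup>2)) has_real_derivative y) (at t) \<and> 0 \<le> y" by blast
  qed
  thus ?thesis by simp
qed

text \<open>With \<open>v = 1600 * u\<close> the derivative of \<open>ray\<close> is at most
  \<open>ln (1 + 1 / v)\<close>, and \<open>ln (1 + s\<^sup>2) \<le> s\<close> turns this into the
  integrable \<open>1 / (40 * sqrt u)\<close>. The abscissa -800 is what makes the constant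
  \<open>1/40\<close>, below \<open>1/30\<close>.\<close>

lemma growth_far_left:
  assumes "Re x \<le> - 800"
  shows "growth x \<le> 1 / 40"
proof -
  have x: "x \<in> slit_dom" "x \<noteq> 0" using assms by (auto simp: slit_dom_def)
  have "ray x 1 \<le> (\<lambda>t. sqrt t / 20) 1"
  proof (rule ray_mono_from_0[OF x])
    fix u :: real assume u: "0 < u" "u \<le> 1"
    show "((\<lambda>t. sqrt t / 20) has_real_derivative 1 / (40 * sqrt u)) (at u)"
      using u by (auto intro!: derivative_eq_intros simp: field_simps)
    define v where "v = 1600 * u"
    have v: "v > 0" using u by (simp add: v_def)
    have "u * Re x \<le> u * (- 800)" using u assms by (intro mult_left_mono) auto
    hence "norm (exp (2 * of_real u * x)) \<le> exp (- v)" by (simp add: v_def)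
    moreover have "1 - norm (exp (2 * of_real u * x)) \<le> norm (1 - exp (2 * of_real u * x))"
      using norm_triangle_ineq2[of 1 "exp (2 * of_real u * x)"] by simp
    moreover have "exp (- v) \<le> 1 / (1 + v)" using exp_ge_add_one_self[of v] v
      by (simp add: exp_minus inverse_eq_divide frac_le)
    ultimately have "1 - 1 / (1 + v) \<le> norm (1 - exp (2 * of_real u * x))" by linarith
    moreover have "1 - 1 / (1 + v) = 1 / (1 + 1 / v)" using v by (simp add: field_simps)
    ultimately have "1 / (1 + 1 / v) \<le> norm (1 - exp (2 * of_real u * x))" by simp
    hence "ln (1 / (1 + 1 / v)) \<le> ln (norm (1 - exp (2 * of_real u * x)))"
      using v by (intro ln_mono) (auto intro!: divide_pos_pos add_pos_pos)
    moreover have "ln (1 / (1 + 1 / v)) = - ln (1 + (1 / sqrt v)\<^sup>2)"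
      using v by (simp add: ln_div power_divide add_pos_pos)
    moreover have "ln (1 + (1 / sqrt v)\<^sup>2) \<le> 1 / sqrt v" using v by (intro ln_one_plus_square_le) auto
    moreover have "1 / sqrt v = 1 / (40 * sqrt u)" by (simp add: v_def real_sqrt_mult)
    ultimately show "- ln (norm (1 - exp (2 * of_real u * x))) \<le> 1 / (40 * sqrt u)" by linarith
  next
    show "((\<lambda>t::real. sqrt t / 20) \<longlongrightarrow> 0) (at_right 0)" by real_asymp
  qed auto
  thus ?thesis using growth_eq_ray[OF x(2)] by simp
qed

section \<open>Rational bounds on pi\<close>

lemma arctan_bounds:
  fixes x :: real
  assumes "x \<ge> 0"
  shows "x - x ^ 3 / 3 + x ^ 5 / 5 - x ^ 7 / 7 \<le> arctan x" "arctan x \<le> x - x ^ 3 / 3 + x ^ 5 / 5"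
proof -
  have "(\<lambda>t. arctan t - (t - t ^ 3 / 3 + t ^ 5 / 5 - t ^ 7 / 7)) 0 \<le> (\<lambda>t. arctan t - (t - t ^ 3 / 3 + t ^ 5 / 5 - t ^ 7 / 7)) x"
  proof (rule DERIV_nonneg_imp_nondecreasing[OF assms])
    fix t :: real
    have p: "1 + t\<^sup>2 > 0" by (simp add: add_pos_nonneg)
    have "((\<lambda>t. arctan t - (t - t ^ 3 / 3 + t ^ 5 / 5 - t ^ 7 / 7)) has_real_derivative
       inverse (1 + t\<^sup>2) - (1 - t\<^sup>2 + t ^ 4 - t ^ 6)) (at t)"
      by (auto intro!: derivative_eq_intros)
    moreover have "(1 - t\<^sup>2 + t ^ 4 - t ^ 6) * (1 + t\<^sup>2) = 1 - (t ^ 4)\<^sup>2" by algebra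
    hence "(1 - t\<^sup>2 + t ^ 4 - t ^ 6) * (1 + t\<^sup>2) \<le> 1" by simp
    hence "inverse (1 + t\<^sup>2) - (1 - t\<^sup>2 + t ^ 4 - t ^ 6) \<ge> 0" using p by (simp add: inverse_eq_divide pos_le_divide_eq)
    ultimately show "\<exists>y. ((\<lambda>t. arctan t - (t - t ^ 3 / 3 + t ^ 5 / 5 - t ^ 7 / 7)) has_real_derivative y) (at t) \<and> 0 \<le> y" by blast
  qed
  thus "x - x ^ 3 / 3 + x ^ 5 / 5 - x ^ 7 / 7 \<le> arctan x" by simp
  have "(\<lambda>t. (t - t ^ 3 / 3 + t ^ 5 / 5) - arctan t) 0 \<le> (\<lambda>t. (t - t ^ 3 / 3 + t ^ 5 / 5) - arctan t) x"
  proof (rule DERIV_nonneg_imp_nondecreasing[OF assms])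
    fix t :: real
    have p: "1 + t\<^sup>2 > 0" by (simp add: add_pos_nonneg)
    have "((\<lambda>t. (t - t ^ 3 / 3 + t ^ 5 / 5) - arctan t) has_real_derivative
       (1 - t\<^sup>2 + t ^ 4) - inverse (1 + t\<^sup>2)) (at t)"
      by (auto intro!: derivative_eq_intros)
    moreover have "(1 - t\<^sup>2 + t ^ 4) * (1 + t\<^sup>2) = 1 + (t ^ 3)\<^sup>2" by algebra
    hence "1 \<le> (1 - t\<^sup>2 + t ^ 4) * (1 + t\<^sup>2)" by simp
    hence "(1 - t\<^sup>2 + t ^ 4) - inverse (1 + t\<^sup>2) \<ge> 0" using p by (simp add: inverse_eq_divide pos_divide_le_eq)
    ultimately show "\<exists>y. ((\<lambda>t. (t - t ^ 3 / 3 + t ^ 5 / 5) - arctan t) has_real_derivative y) (at t) \<and> 0 \<le> y" by blast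
  qed
  thus "arctan x \<le> x - x ^ 3 / 3 + x ^ 5 / 5" by simp
qed

lemma pi_bounds: "(31415/10000) < pi" "pi < (31417/10000)"
proof -
  have "pi = 16 * arctan (1 / 5) - 4 * arctan (1 / 239)" using machin by simp
  moreover have "arctan (1 / 5 :: real) \<le> (197398/1000000)" "arctan (1 / 5 :: real) \<ge> (197395/1000000)"
    using arctan_bounds[of "1/5"] by (simp_all add: power_divide)
  moreover have "arctan (1 / 239 :: real) \<le> (4185/1000000)" "arctan (1 / 239 :: real) \<ge> (4184/1000000)"
    using arctan_bounds[of "1/239"] by (simp_all add: power_divide)
  ultimately show "(31415/10000) < pi" "pi < (31417/10000)" by linarith+
qed

section \<open>Numerical data of the saddle point\<close>

locale dilog_zero =
  fixes w0 z0 :: complex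
  assumes w0_eq: "Li2 w0 - 2 * pi * \<i> * Ln w0 = 0"
    and w0_approx: "cmod (w0 - Complex 0.91619782 (-0.18245890)) < 0.0000001"
    and z0_def: "z0 = 2 * pi * \<i> + Ln (1 - w0)"
begin

definition \<theta> :: real where "\<theta> = Im (Ln (1 - w0))"
definition x0 :: complex where "x0 = z0 / 2"
definition lam :: real where "lam = - ln (norm w0)"

lemma w0_bounds:
  "(9161977/10000000) < Re w0" "Re w0 < (916198/1000000)" "- (1824591/10000000) < Im w0" "Im w0 < - (1824587/10000000)"
proof -
  have "\<bar>Re w0 - (91619782/100000000)\<bar> < (1/10000000)" "\<bar>Im w0 + (1824589/10000000)\<bar> < (1/10000000)"
    using w0_approx abs_Re_le_cmod[of "w0 - Complex 0.91619782 (-0.18245890)"]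
      abs_Im_le_cmod[of "w0 - Complex 0.91619782 (-0.18245890)"] by simp_all
  thus "(9161977/10000000) < Re w0" "Re w0 < (916198/1000000)" "- (1824591/10000000) < Im w0" "Im w0 < - (1824587/10000000)"
    unfolding abs_less_iff by linarith+
qed

lemma norm_bounds: "(2007/10000) < norm (1 - w0)" "norm (1 - w0) < (2008/10000)" "norm w0 < (9343/10000)"
proof -
  have sq: "(norm (1 - w0))\<^sup>2 = (1 - Re w0)\<^sup>2 + (- Im w0)\<^sup>2" "(norm w0)\<^sup>2 = (Re w0)\<^sup>2 + (- Im w0)\<^sup>2"
    by (simp_all add: cmod_power2)
  have 1: "(83802/1000000)\<^sup>2 \<le> (1 - Re w0)\<^sup>2" "(1 - Re w0)\<^sup>2 \<le> (838023/10000000)\<^sup>2"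
    using w0_bounds by (intro power_mono; simp)+
  have 2: "(1824587/10000000)\<^sup>2 \<le> (- Im w0)\<^sup>2" "(- Im w0)\<^sup>2 \<le> (1824591/10000000)\<^sup>2"
    using w0_bounds by (intro power_mono; simp)+
  have 3: "(Re w0)\<^sup>2 \<le> (916198/1000000)\<^sup>2"
    using w0_bounds by (intro power_mono) auto
  have "(2007/10000)\<^sup>2 < (norm (1 - w0))\<^sup>2" unfolding sq using 1(1) 2(1) by (simp add: power2_eq_square)
  thus "(2007/10000) < norm (1 - w0)" by (rule power_less_imp_less_base) simp
  have "(norm (1 - w0))\<^sup>2 < (2008/10000)\<^sup>2" unfolding sq using 1(2) 2(2) by (simp add: power2_eq_square)
  thus "norm (1 - w0) < (2008/10000)" by (rule power_less_imp_less_base) simp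
  have "(norm w0)\<^sup>2 < (9343/10000)\<^sup>2" unfolding sq using 3 2(2) by (simp add: power2_eq_square)
  thus "norm w0 < (9343/10000)" by (rule power_less_imp_less_base) simp
qed

lemma one_minus_w0: "1 - w0 \<notin> \<real>\<^sub>\<le>\<^sub>0" "1 - w0 \<noteq> 0" "w0 \<noteq> 0"
proof -
  show "1 - w0 \<notin> \<real>\<^sub>\<le>\<^sub>0" using w0_bounds by (auto simp: complex_nonpos_Reals_iff)
  thus "1 - w0 \<noteq> 0" by auto
  show "w0 \<noteq> 0" using w0_bounds by auto
qed

lemma phase_x0: "phase x0 = - Ln w0 / 2" and Re_z0_neg: "Re z0 < 0" and exp_z0: "exp z0 = 1 - w0"
proof -
  have "norm (1 - w0) < 1" using norm_bounds by linarith
  from phase_saddle[OF w0_eq this one_minus_w0(1)]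
  show "phase x0 = - Ln w0 / 2" "Re z0 < 0" "exp z0 = 1 - w0"
    unfolding z0_def[symmetric] x0_def by auto
qed

lemma Re_z0: "Re z0 = ln (norm (1 - w0))" and Im_z0: "Im z0 = 2 * pi + \<theta>"
  using one_minus_w0 by (simp_all add: z0_def \<theta>_def)

lemma exp_Re_z0: "exp (Re z0) = norm (1 - w0)"
  using one_minus_w0 by (simp add: Re_z0)

lemma polar: "norm (1 - w0) * cos \<theta> = 1 - Re w0" "norm (1 - w0) * sin \<theta> = - Im w0"
proof -
  have e: "exp (Ln (1 - w0)) = 1 - w0" using one_minus_w0 by simp
  have r: "exp (Re (Ln (1 - w0))) = norm (1 - w0)" using one_minus_w0 by simp
  show "norm (1 - w0) * cos \<theta> = 1 - Re w0" "norm (1 - w0) * sin \<theta> = - Im w0"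
    using arg_cong[OF e, of Re] arg_cong[OF e, of Im] unfolding Re_exp Im_exp r \<theta>_def by simp_all
qed

lemma theta_range: "0 < \<theta>" "\<theta> < pi / 2"
proof -
  have "\<bar>\<theta>\<bar> < pi / 2" unfolding \<theta>_def using Re_Ln_pos_lt[OF one_minus_w0(2)] w0_bounds by simp
  moreover have "0 < Im (Ln (1 - w0))" using Im_Ln_pos_lt[OF one_minus_w0(2)] w0_bounds by simp
  ultimately show "0 < \<theta>" "\<theta> < pi / 2" by (auto simp: \<theta>_def)
qed

lemma cos_sin_theta: "(4173/10000) < cos \<theta>" "cos \<theta> < (4176/10000)" "(9086/10000) < sin \<theta>"
proof -
  let ?r = "norm (1 - w0)"
  have r: "?r > 0" using norm_bounds by linarith
  have "(4173/10000) * ?r < cos \<theta> * ?r" using norm_bounds w0_bounds polar by (simp add: mult.commute)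
  thus "(4173/10000) < cos \<theta>" using r by simp
  have "cos \<theta> * ?r < (4176/10000) * ?r" using norm_bounds w0_bounds polar by (simp add: mult.commute)
  thus "cos \<theta> < (4176/10000)" using r by simp
  have "(9086/10000) * ?r < sin \<theta> * ?r" using norm_bounds w0_bounds polar by (simp add: mult.commute)
  thus "(9086/10000) < sin \<theta>" using r by simp
qed

text \<open>Both bounds come from the complementary angle \<open>f\<close>, for which
  \<open>sin f = cos \<theta>\<close> is known: \<open>sin f \<le> f\<close> on one side and
  \<open>f * cos f < sin f\<close> on the other.\<close>

lemma theta_bounds: "(1111/1000) < \<theta>" "\<theta> < (11536/10000)" "pi / 2 - \<theta> < (4597/10000)"
proof -
  define f where "f = pi / 2 - \<theta>"
  have f: "0 < f" "f < pi" using theta_range by (auto simp: f_def)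
  have sc: "sin f = cos \<theta>" "cos f = sin \<theta>" by (simp_all add: f_def sin_diff cos_diff)
  have "sin f \<le> f" using f by (intro sin_x_le_x) auto
  thus "\<theta> < (11536/10000)" using cos_sin_theta pi_bounds sc by (simp add: f_def)
  have "f * (9086/10000) \<le> f * sin \<theta>" using f cos_sin_theta by (intro mult_left_mono) auto
  hence "f * (9086/10000) < (4176/10000)" using x_cos_less_sin[OF f] sc cos_sin_theta by simp
  thus "pi / 2 - \<theta> < (4597/10000)" by (simp add: f_def)
  thus "(1111/1000) < \<theta>" using pi_bounds by simp
qed

lemma Re_z0_bounds: "- (162/100) \<le> Re z0" "Re z0 \<le> - (16/10)"
proof -
  have e2: "exp (2 * Re z0) = (norm (1 - w0))\<^sup>2" using exp_Re_z0 by (simp add: exp_double)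
  have n2: "(2007/10000)\<^sup>2 \<le> (norm (1 - w0))\<^sup>2" "(norm (1 - w0))\<^sup>2 \<le> (2008/10000)\<^sup>2"
    using norm_bounds by (intro power_mono; simp)+
  have "(249/10) \<le> (1 + (324/100) / real 16 + ((324/100) / real 16)\<^sup>2 / 2) ^ 16" by (simp add: power2_eq_square power_divide)
  also have "\<dots> \<le> exp (324/100)" by (rule exp_ge_power) auto
  finally have "(249/10) \<le> exp ((324/100)::real)" .
  hence "exp (- (324/100)) \<le> (1 / (249/10) :: real)" by (simp add: exp_minus field_simps)
  also have "\<dots> \<le> (2007/10000)\<^sup>2" by (simp add: power2_eq_square)
  finally have "exp (- (324/100)) \<le> exp (2 * Re z0)" using n2 e2 by linarith
  thus "- (162/100) \<le> Re z0" by simp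
  have "exp ((32/10)::real) \<le> (246/10)" by (rule exp_le_via_e[of 16 _ 5]) (auto simp: power_divide)
  hence "exp (- (32/10)) \<ge> (1 / (246/10) :: real)" by (simp add: exp_minus field_simps)
  moreover have "((2008/10000)::real)\<^sup>2 \<le> 1 / (246/10)" by (simp add: power2_eq_square)
  ultimately have "exp (2 * Re z0) \<le> exp (- (32/10))" using n2 e2 by linarith
  thus "Re z0 \<le> - (16/10)" by simp
qed

text \<open>The inequality \<open>ln y \<le> y - 1\<close> applied to \<open>norm w0\<close> itself
  would give only 0.0657, and \<open>2/30\<close> has to be exceeded. Applying it to the square root
  reduces the loss enough.\<close>

lemma lam_bound: "lam \<ge> (668/10000)"
proof -
  have n: "norm w0 > 0" using one_minus_w0 by simp
  have "norm w0 \<le> (9666/10000)\<^sup>2" using norm_bounds by (simp add: power2_eq_square)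
  hence "sqrt (norm w0) \<le> (9666/10000)" by (intro real_le_lsqrt) auto
  moreover have "ln (norm w0) = 2 * ln (sqrt (norm w0))" using n by (simp add: ln_sqrt)
  moreover have "ln (sqrt (norm w0)) \<le> sqrt (norm w0) - 1" using n by (intro ln_le_minus_one) simp
  ultimately show ?thesis by (simp add: lam_def)
qed

lemma growth_x0: "growth x0 = lam / 2"
proof -
  have "Re x0 < 0" using Re_z0_neg by (simp add: x0_def)
  from Re_phase[OF this] show ?thesis using phase_x0 one_minus_w0(3) by (simp add: lam_def)
qed

text \<open>On the radius to \<open>x\<close> the argument of \<open>exp (2 * u * x)\<close> is
  \<open>\<beta> = u * Y\<close>, running from 0 to \<open>Y\<close>. Three bounds on the norm are
  used: small angles up to 2.6, obtuse angles up to \<open>3 * pi / 2\<close>, and the distance to a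
  line beyond. The obtuse part contributes -0.497 and compensates most of the 0.775 collected
  before.\<close>

lemma growth_horizontal:
  assumes Im: "Im x = (2 * pi - \<theta>) / 2" and Re: "Re x \<ge> - (11/100) * (2 * pi - \<theta>)"
  shows "growth x \<le> (165/1000) / (2 * pi - \<theta>)"
proof -
  define Y where "Y = 2 * pi - \<theta>"
  have Y: "3 * pi / 2 < Y" "(26/10) < 3 * pi / 2" "Y < 2 * pi" "0 < Y"
    using theta_range pi_bounds by (auto simp: Y_def)
  have x: "x \<in> slit_dom" "x \<noteq> 0" using Im Y theta_range by (auto simp: slit_dom_def Y_def)
  have arg: "2 * of_real u * x = Complex (2 * u * Re x) (u * Y)" for u
    using Im by (simp add: complex_eq_iff Y_def)
  have al: "2 * u * Re x \<ge> - (22/100) * (u * Y)" if "u * Y > 0" for u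
  proof -
    have "u > 0" using that Y by (simp add: zero_less_mult_iff)
    hence "2 * u * Re x \<ge> 2 * u * (- (11/100) * Y)" using Re by (intro mult_left_mono) (auto simp: Y_def)
    thus ?thesis by (simp add: mult_ac)
  qed
  \<comment> \<open>\<open>m1\<close> and \<open>m2\<close> are primitives in \<open>\<beta>\<close>
    of the bounds from the small-angle and obtuse lemmas. In the variable \<open>u\<close> they have
    to be divided by \<open>Y\<close>, which \<open>scale\<close> provides.\<close>
  define m1 where "m1 \<beta> = (55/1000) * \<beta>\<^sup>2 + (\<beta> - \<beta> * ln \<beta>) + \<beta> ^ 3 / 72 + (7/10) * \<beta> ^ 5 / 2880" for \<beta> :: real
  define m2 where "m2 \<beta> = (7/10) / (1 + (22/100)\<^sup>2) * (exp (- (22/100) * \<beta>) * (sin \<beta> - (22/100) * cos \<beta>))" for \<beta> :: real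
  have scale: "((\<lambda>u. m (u * Y) / Y) has_real_derivative m' (u * Y)) (at u)" if "(m has_real_derivative m' (u * Y)) (at (u * Y))" for m m' u
  proof -
    have "((\<lambda>u. m (u * Y)) has_real_derivative m' (u * Y) * Y) (at u)"
      by (rule DERIV_chain2[where g = "\<lambda>u. u * Y" and f = m and x = u, OF that]) (auto intro!: derivative_eq_intros)
    from DERIV_cdivide[OF this, of Y] show ?thesis using Y by simp
  qed
  have s1: "ray x ((26/10) / Y) \<le> (\<lambda>u. m1 (u * Y) / Y) ((26/10) / Y)"
  proof (rule ray_mono_from_0[OF x, where m' = "\<lambda>u. (11/100) * (u * Y) - ln (u * Y) + (u * Y)\<^sup>2 / 24 + (7/10) * ((u * Y)\<^sup>2 / 24)\<^sup>2"])
    show "0 < (26/10) / Y" "(26/10) / Y \<le> 1" using Y by auto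
    fix u assume u: "0 < u" "u \<le> (26/10) / Y"
    hence b: "0 < u * Y" "u * Y \<le> (26/10)" using Y by (auto simp: field_simps)
    have "(m1 has_real_derivative (11/100) * \<beta> - ln \<beta> + \<beta>\<^sup>2 / 24 + (7/10) * (\<beta>\<^sup>2 / 24)\<^sup>2) (at \<beta>)" if "\<beta> > 0" for \<beta>
      unfolding m1_def[abs_def] using that
      by (auto intro!: derivative_eq_intros simp: power2_eq_square power4_eq_xxxx)
    from scale[where m' = "\<lambda>\<beta>. (11/100) * \<beta> - ln \<beta> + \<beta>\<^sup>2 / 24 + (7/10) * (\<beta>\<^sup>2 / 24)\<^sup>2", OF this[OF b(1)]]
    show "((\<lambda>u. m1 (u * Y) / Y) has_real_derivative (11/100) * (u * Y) - ln (u * Y) + (u * Y)\<^sup>2 / 24 + (7/10) * ((u * Y)\<^sup>2 / 24)\<^sup>2) (at u)" .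
    show "- ln (norm (1 - exp (2 * of_real u * x))) \<le> (11/100) * (u * Y) - ln (u * Y) + (u * Y)\<^sup>2 / 24 + (7/10) * ((u * Y)\<^sup>2 / 24)\<^sup>2"
      using norm_one_minus_exp_small_angle[OF b al[OF b(1)]] unfolding arg[symmetric] .
  next
    have "(m1 \<longlongrightarrow> 0) (at_right 0)" unfolding m1_def[abs_def] by real_asymp
    moreover have "filterlim (\<lambda>u. u * Y) (at_right 0) (at_right 0)" using Y by real_asymp
    ultimately have "((\<lambda>u. m1 (u * Y)) \<longlongrightarrow> 0) (at_right 0)" by (rule filterlim_compose)
    from tendsto_divide[OF this tendsto_const[of Y]] Y show "((\<lambda>u. m1 (u * Y) / Y) \<longlongrightarrow> 0) (at_right 0)" by simp
  qed
  have s2: "ray x (3 * pi / 2 / Y) - ray x ((26/10) / Y) \<le> (\<lambda>u. m2 (u * Y) / Y) (3 * pi / 2 / Y) - (\<lambda>u. m2 (u * Y) / Y) ((26/10) / Y)"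
  proof (rule ray_mono[OF x, where m' = "\<lambda>u. (7/10) * exp (- (22/100) * (u * Y)) * cos (u * Y)"])
    show "0 < (26/10) / Y" using Y by auto
    show "(26/10) / Y \<le> 3 * pi / 2 / Y" by (rule divide_right_mono) (use Y in auto)
    fix u assume u: "(26/10) / Y \<le> u" "u \<le> 3 * pi / 2 / Y"
    hence b: "(26/10) \<le> u * Y" "u * Y \<le> 3 * pi / 2" "0 < u * Y" using Y by (auto simp: field_simps)
    have "3 * pi / 2 / Y \<le> 1" "0 < (26/10) / Y" using Y by auto
    hence "0 \<le> u \<and> u \<le> 1" using u by linarith
    hence "u \<in> {0..1}" by simp
    thus "of_real u * x \<in> slit_dom" by (rule slit_dom_scale[OF x(1)])
    have "(m2 has_real_derivative (7/10) * exp (- (22/100) * \<beta>) * cos \<beta>) (at \<beta>)" for \<beta>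
    proof -
      have "(m2 has_real_derivative (7/10) / (1 + (22/100)\<^sup>2) * ((exp (- (22/100) * \<beta>) * (- (22/100))) * (sin \<beta> - (22/100) * cos \<beta>) + (cos \<beta> - (22/100) * (- sin \<beta>)) * exp (- (22/100) * \<beta>))) (at \<beta>)"
        unfolding m2_def[abs_def]
        by (intro DERIV_cmult DERIV_mult) (auto intro!: derivative_eq_intros)
      moreover have "(exp (- (22/100) * \<beta>) * (- (22/100))) * (sin \<beta> - (22/100) * cos \<beta>) + (cos \<beta> - (22/100) * (- sin \<beta>)) * exp (- (22/100) * \<beta>) = (1 + (22/100)\<^sup>2) * (exp (- (22/100) * \<beta>) * cos \<beta>)"
      proof -
        have "(e * (- k)) * (s - k * c) + (c - k * (- s)) * e = (1 + k\<^sup>2) * (e * c)" for e k s c :: real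
          by (simp add: power2_eq_square algebra_simps)
        thus ?thesis .
      qed
      ultimately have "(m2 has_real_derivative (7/10) / (1 + (22/100)\<^sup>2) * ((1 + (22/100)\<^sup>2) * (exp (- (22/100) * \<beta>) * cos \<beta>))) (at \<beta>)"
        by (simp only:)
      thus ?thesis by (rule DERIV_cong) (simp add: power2_eq_square)
    qed
    from scale[where m' = "\<lambda>\<beta>. (7/10) * exp (- (22/100) * \<beta>) * cos \<beta>", OF this]
    show "((\<lambda>u. m2 (u * Y) / Y) has_real_derivative (7/10) * exp (- (22/100) * (u * Y)) * cos (u * Y)) (at u)" .
    show "- ln (norm (1 - exp (2 * of_real u * x))) \<le> (7/10) * exp (- (22/100) * (u * Y)) * cos (u * Y)"
      using norm_one_minus_exp_obtuse[OF b(1,2) al[OF b(3)]] unfolding arg[symmetric] .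
  qed
  \<comment> \<open>In the last range \<open>2 * pi - \<beta>\<close> lies between
    \<open>\<theta>\<close> and \<open>pi / 2\<close>, so
    \<open>\<bar>sin \<beta>\<bar> \<ge> sin \<theta> > 0.9086\<close>, and
    \<open>1 / 0.9086 - 1\<close> is below 0.1006.\<close>
  have s3: "ray x 1 - ray x (3 * pi / 2 / Y) \<le> (\<lambda>u. (1006/10000) * u) 1 - (\<lambda>u. (1006/10000) * u) (3 * pi / 2 / Y)"
  proof (rule ray_mono[OF x, where m' = "\<lambda>u. (1006/10000)"])
    show "0 < 3 * pi / 2 / Y" "3 * pi / 2 / Y \<le> 1" using Y by auto
    fix u assume u: "3 * pi / 2 / Y \<le> u" "u \<le> 1"
    hence b: "3 * pi / 2 \<le> u * Y" "u * Y \<le> Y" using Y by (auto simp: field_simps)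
    have "0 < 3 * pi / 2 / Y" using Y by auto
    hence "0 \<le> u \<and> u \<le> 1" using u by linarith
    hence "u \<in> {0..1}" by simp
    thus "of_real u * x \<in> slit_dom" by (rule slit_dom_scale[OF x(1)])
    show "((\<lambda>u. (1006/10000) * u) has_real_derivative (1006/10000)) (at u)" by (auto intro!: derivative_eq_intros)
    define f where "f = 2 * pi - u * Y"
    have f: "\<theta> \<le> f" "f \<le> pi / 2" using b by (auto simp: f_def Y_def)
    have "sin \<theta> \<le> sin f" using f theta_range by (intro sin_monotone_2pi_le) auto
    moreover have "sin f = - sin (u * Y)" by (simp add: f_def sin_diff)
    moreover have "\<bar>sin (u * Y)\<bar> \<le> norm (1 - exp (2 * of_real u * x))"
      using norm_one_minus_exp_ge_sin[of "u * Y" "2 * u * Re x"] unfolding arg[symmetric] .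
    ultimately have "sin \<theta> \<le> norm (1 - exp (2 * of_real u * x))" by linarith
    hence "(9086/10000) \<le> norm (1 - exp (2 * of_real u * x))" using cos_sin_theta by linarith
    hence "ln (9086/10000) \<le> ln (norm (1 - exp (2 * of_real u * x)))" by (intro ln_mono) auto
    moreover have "- ln ((9086/10000)::real) \<le> (1006/10000)"
      using ln_le_minus_one[of "1 / (9086/10000) :: real"] by (simp add: ln_div)
    ultimately show "- ln (norm (1 - exp (2 * of_real u * x))) \<le> (1006/10000)" by linarith
  qed
  have "Y * ray x 1 \<le> m1 (26/10) + (m2 (3 * pi / 2) - m2 (26/10)) + (1006/10000) * (Y - 3 * pi / 2)"
  proof -
    have "ray x 1 \<le> m1 (26/10) / Y + (m2 (3 * pi / 2) / Y - m2 (26/10) / Y) + ((1006/10000) * 1 - (1006/10000) * (3 * pi / 2 / Y))"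
      using s1 s2 s3 Y by simp
    hence "Y * ray x 1 \<le> Y * (m1 (26/10) / Y + (m2 (3 * pi / 2) / Y - m2 (26/10) / Y) + ((1006/10000) * 1 - (1006/10000) * (3 * pi / 2 / Y)))"
      using Y by (intro mult_left_mono) auto
    moreover have "Y * (A / Y + (B / Y - C / Y) + (k * 1 - k * (r / Y))) = A + (B - C) + k * (Y - r)" for A B C k r
      using Y by (simp add: field_simps)
    ultimately show ?thesis by (simp only:)
  qed
  moreover have "Y - 3 * pi / 2 \<le> (4597/10000)" using theta_bounds by (simp add: Y_def)
  moreover have "m1 (26/10) \<le> (775/1000)"
  proof -
    have "exp ((95/100)::real) \<le> (26/10)" by (rule exp_le_via_e[of 19 _ 20]) (auto simp: power_divide)
    hence "(95/100) \<le> ln ((26/10)::real)" by (subst ln_ge_iff) auto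
    thus ?thesis by (simp add: m1_def power_divide)
  qed
  moreover have "m2 (3 * pi / 2) - m2 (26/10) \<le> - (497/1000)"
  proof -
    have s: "sin (3 * pi / 2) = -1" "cos (3 * pi / 2) = 0"
      using sin_3over2_pi cos_3over2_pi by (simp_all add: mult.commute)
    define f where "f = pi - (26/10)"
    have f: "(5415/10000) \<le> f" "f \<le> (5417/10000)" using pi_bounds by (auto simp: f_def)
    have "f ^ 3 \<le> (5417/10000) ^ 3" "f\<^sup>2 \<le> (5417/10000)\<^sup>2" using f by (intro power_mono; simp)+
    hence "sin f \<ge> (515/1000)" "cos f \<ge> (853/1000)"
      using sin_ge_cubic[of f] cos_ge_quadratic[of f] f by (simp_all add: power_divide)
    moreover have "sin ((26/10)::real) = sin f" "cos ((26/10)::real) = - cos f"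
      by (simp_all add: f_def sin_diff cos_diff)
    ultimately have sc: "sin ((26/10)::real) - (22/100) * cos (26/10) \<ge> (7026/10000)" by simp
    have "exp ((104/100)::real) \<le> (284/100)" by (rule exp_le_via_e[of 26 _ 25]) (auto simp: power_divide)
    moreover have "exp ((22/100) * (3 * pi / 2)) \<le> exp ((104/100)::real)" using pi_bounds by simp
    ultimately have "exp ((22/100) * (3 * pi / 2)) \<le> (284/100)" by linarith
    hence e1: "exp (- (22/100) * (3 * pi / 2)) \<ge> (352/1000)" by (simp add: exp_minus field_simps)
    have "exp ((575/1000)::real) \<le> (17857/10000)" by (rule exp_le_via_e[of 23 _ 40]) (auto simp: power_divide)
    moreover have "exp ((22/100) * (26/10)) \<le> exp ((575/1000)::real)" by simp
    ultimately have "exp ((22/100) * (26/10)) \<le> ((17857/10000)::real)" by linarith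
    hence e2: "exp (- (22/100) * (26/10)) \<ge> ((56/100)::real)" by (simp add: exp_minus field_simps)
    have "exp (- (22/100) * (26/10)) * (sin ((26/10)::real) - (22/100) * cos (26/10)) \<ge> (56/100) * (7026/10000)"
      using e2 sc by (intro mult_mono) auto
    hence "exp (- (22/100) * (3 * pi / 2)) * (sin (3 * pi / 2) - (22/100) * cos (3 * pi / 2)) - exp (- (22/100) * (26/10)) * (sin (26/10) - (22/100) * cos (26/10)) \<le> - (352/1000) - (56/100) * (7026/10000)"
      unfolding s using e1 by simp
    hence "(7/10) / (1 + (22/100)\<^sup>2) * (exp (- (22/100) * (3 * pi / 2)) * (sin (3 * pi / 2) - (22/100) * cos (3 * pi / 2)) - exp (- (22/100) * (26/10)) * (sin (26/10) - (22/100) * cos (26/10)))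
       \<le> (7/10) / (1 + (22/100)\<^sup>2) * (- (352/1000) - (56/100) * (7026/10000) :: real)"
      by (intro mult_left_mono) auto
    also have "\<dots> \<le> - (497/1000)" by (simp add: power2_eq_square)
    finally show ?thesis unfolding m2_def right_diff_distrib .
  qed
  moreover have "A \<le> B + C + (1006/10000) * D \<Longrightarrow> D \<le> 4597/10000 \<Longrightarrow> B \<le> 775/1000 \<Longrightarrow> C \<le> - (497/1000) \<Longrightarrow> A \<le> 33/100"
    for A B C D :: real by linarith
  ultimately have "Y * ray x 1 \<le> (33/100)" by blast
  hence "ray x 1 \<le> (33/100) / Y" using Y by (simp add: field_simps)
  moreover have "(165/1000) / Y = (33/100) / Y / 2" by simp
  ultimately show ?thesis unfolding Y_def[symmetric] growth_eq_ray[OF x(2)] by linarith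
qed

section \<open>Growth along the ray through the saddle\<close>

lemma exp_2tx0: "exp (2 * of_real t * x0) = exp (Complex (t * Re z0) (t * (2 * pi + \<theta>)))"
proof -
  have "2 * of_real t * x0 = Complex (t * Re z0) (t * (2 * pi + \<theta>))"
    by (simp add: x0_def complex_eq_iff Im_z0)
  thus ?thesis by simp
qed

lemma x0_slit: "x0 \<in> slit_dom" "x0 \<noteq> 0" and ray_x0_slit: "t > 0 \<Longrightarrow> of_real t * x0 \<in> slit_dom"
  using Re_z0_neg by (auto simp: x0_def slit_dom_def mult_pos_neg)

lemma norm_w0_sq: "(norm w0)\<^sup>2 = 1 - 2 * exp (Re z0) * cos \<theta> + (exp (Re z0))\<^sup>2"
proof -
  have "norm w0 = norm (1 - exp (2 * of_real 1 * x0))" using exp_z0 by (simp add: x0_def)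
  thus ?thesis unfolding exp_2tx0 by (simp add: norm_one_minus_exp cos_add)
qed

text \<open>From the starting value of \<open>t\<close> to 1 the angle stays within
  \<open>\<theta>\<close> of a full turn, so its cosine is at least \<open>cos \<theta>\<close>. The
  modulus \<open>y\<close> is larger than at the saddle, and
  \<open>y\<^sup>2 - 2 * y * cos \<theta>\<close> is below its value at \<open>y0\<close> because
  \<open>y + y0 < 2 * cos \<theta>\<close>.\<close>

lemma norm_ray_before:
  assumes t: "(2 * pi - \<theta>) / (2 * pi + \<theta>) \<le> t" "t < 1"
  shows "norm (1 - exp (2 * of_real t * x0)) < norm w0"
proof -
  define y y0 where "y = exp (t * Re z0)" and "y0 = exp (Re z0)"
  define \<psi> where "\<psi> = t * (2 * pi + \<theta>) - 2 * pi"
  have b: "2 * pi + \<theta> > 0" using theta_range by (simp add: add_pos_pos)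
  have "2 * pi - \<theta> \<le> t * (2 * pi + \<theta>)" using t b by (simp add: pos_divide_le_eq)
  moreover have "t * (2 * pi + \<theta>) \<le> 1 * (2 * pi + \<theta>)" using t b by (intro mult_right_mono) auto
  ultimately have psi: "\<bar>\<psi>\<bar> \<le> \<theta>" by (auto simp: \<psi>_def abs_le_iff)
  have "cos \<theta> \<le> cos \<bar>\<psi>\<bar>" using psi theta_range by (intro cos_monotone_0_pi_le) auto
  hence c: "cos \<theta> \<le> cos (t * (2 * pi + \<theta>))" by (simp add: \<psi>_def cos_diff)
  \<comment> \<open>This lower bound on \<open>t\<close> gives
    \<open>y \<le> exp (- 1.04) \<le> 1/2\<close>, hence \<open>y + y0 < 0.71\<close>, while
    \<open>2 * cos \<theta> > 0.83\<close>.\<close>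
  have "(65/100) * (2 * pi + \<theta>) \<le> 2 * pi - \<theta>" using theta_bounds pi_bounds by simp
  hence "65/100 \<le> (2 * pi - \<theta>) / (2 * pi + \<theta>)" using b by (simp add: pos_le_divide_eq)
  hence "65/100 \<le> t" using t by linarith
  hence "t * Re z0 \<le> (65/100) * Re z0" using Re_z0_neg by (intro mult_right_mono_neg) auto
  hence "t * Re z0 \<le> - (104/100)" using Re_z0_bounds by linarith
  hence "y \<le> exp (- (104/100))" by (simp add: y_def)
  also have "\<dots> \<le> 1/2" using exp_ge_add_one_self[of "104/100"] by (simp add: exp_minus field_simps)
  finally have y1: "y \<le> 1/2" .
  have "1 * Re z0 < t * Re z0" using t Re_z0_neg by (intro mult_strict_right_mono_neg) auto
  hence y2: "y0 < y" by (simp add: y_def y0_def)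
  have y3: "y0 < 2008/10000" using norm_bounds exp_Re_z0 by (simp add: y0_def)
  have "(y - y0) * (2 * cos \<theta> - y - y0) > 0" using y1 y2 y3 cos_sin_theta by (intro mult_pos_pos) auto
  moreover have "2 * y * cos \<theta> \<le> 2 * y * cos (t * (2 * pi + \<theta>))" using c by (intro mult_left_mono) (auto simp: y_def)
  ultimately have "(norm (1 - exp (2 * of_real t * x0)))\<^sup>2 < (norm w0)\<^sup>2"
    unfolding exp_2tx0 norm_one_minus_exp norm_w0_sq y_def[symmetric] y0_def[symmetric]
    by (simp add: power2_eq_square algebra_simps)
  thus ?thesis by (rule power_less_imp_less_base) simp
qed

text \<open>Past the saddle the angle leaves the full turn and its cosine decreases, while the
  modulus shrinks; both push the norm above its value at the saddle, up to the angle
  \<open>5 * pi / 2\<close>.\<close>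

lemma norm_ray_after:
  assumes t: "1 < t" "t \<le> 5 * pi / (2 * (2 * pi + \<theta>))"
  shows "norm w0 < norm (1 - exp (2 * of_real t * x0))"
proof -
  define y y0 where "y = exp (t * Re z0)" and "y0 = exp (Re z0)"
  define \<psi> where "\<psi> = t * (2 * pi + \<theta>) - 2 * pi"
  have b: "2 * pi + \<theta> > 0" using theta_range by (simp add: add_pos_pos)
  have "1 * (2 * pi + \<theta>) \<le> t * (2 * pi + \<theta>)" using t b by (intro mult_right_mono) auto
  moreover have "t * (2 * pi + \<theta>) \<le> 5 * pi / 2" using t b by (simp add: pos_le_divide_eq mult_ac)
  ultimately have psi: "\<theta> \<le> \<psi>" "\<psi> \<le> pi / 2" by (auto simp: \<psi>_def)
  have "cos \<psi> \<le> cos \<theta>" using psi theta_range by (intro cos_monotone_0_pi_le) auto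
  hence c: "cos (t * (2 * pi + \<theta>)) \<le> cos \<theta>" by (simp add: \<psi>_def cos_diff)
  have "t * Re z0 < 1 * Re z0" using t Re_z0_neg by (intro mult_strict_right_mono_neg) auto
  hence y2: "y < y0" by (simp add: y_def y0_def)
  have y3: "y0 < 2008/10000" using norm_bounds exp_Re_z0 by (simp add: y0_def)
  have "(y0 - y) * (2 * cos \<theta> - y - y0) > 0" using y2 y3 cos_sin_theta by (intro mult_pos_pos) auto
  moreover have "2 * y * cos (t * (2 * pi + \<theta>)) \<le> 2 * y * cos \<theta>" using c by (intro mult_left_mono) (auto simp: y_def)
  ultimately have "(norm w0)\<^sup>2 < (norm (1 - exp (2 * of_real t * x0)))\<^sup>2"
    unfolding exp_2tx0 norm_one_minus_exp norm_w0_sq y_def[symmetric] y0_def[symmetric]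
    by (simp add: power2_eq_square algebra_simps)
  thus ?thesis by (rule power_less_imp_less_base) simp
qed

lemma norm_ray_obtuse:
  assumes t: "5 * pi / (2 * (2 * pi + \<theta>)) \<le> t" "t \<le> 7 * pi / (2 * (2 * pi + \<theta>))"
  shows "1 \<le> norm (1 - exp (2 * of_real t * x0))"
proof -
  have b: "2 * pi + \<theta> > 0" using theta_range by (simp add: add_pos_pos)
  have "5 * pi / 2 \<le> t * (2 * pi + \<theta>)" "t * (2 * pi + \<theta>) \<le> 7 * pi / 2"
    using t b by (simp_all add: pos_le_divide_eq pos_divide_le_eq mult_ac)
  hence "cos (t * (2 * pi + \<theta>) - 3 * pi) \<ge> 0" by (intro cos_ge_zero) auto
  moreover have "cos (t * (2 * pi + \<theta>) - 3 * pi) = - cos (t * (2 * pi + \<theta>))"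
    using cos_minus_pi[of "t * (2 * pi + \<theta>) - 2 * pi"] by (simp add: cos_diff)
  ultimately have "cos (t * (2 * pi + \<theta>)) \<le> 0" by simp
  hence "exp (t * Re z0) * cos (t * (2 * pi + \<theta>)) \<le> 0" by (simp add: mult_nonneg_nonpos)
  hence "2 * exp (t * Re z0) * cos (t * (2 * pi + \<theta>)) \<le> 0" by linarith
  hence "1\<^sup>2 \<le> (norm (1 - exp (2 * of_real t * x0)))\<^sup>2"
    unfolding exp_2tx0 norm_one_minus_exp one_power2 using zero_le_power2[of "exp (t * Re z0)"] by linarith
  thus ?thesis by (rule power2_le_imp_le) simp
qed

lemma ln_norm_ray_tail:
  assumes t: "exp (t * Re z0) \<le> y" "y < 1"
  shows "- ln (norm (1 - exp (2 * of_real t * x0))) \<le> y / (1 - y)"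
proof -
  have e: "norm (exp (2 * of_real t * x0)) = exp (t * Re z0)" unfolding exp_2tx0 by simp
  have "1 - y \<le> norm (1 - exp (2 * of_real t * x0))"
    using norm_triangle_ineq2[of 1 "exp (2 * of_real t * x0)"] t unfolding e norm_one by linarith
  hence "ln (1 - y) \<le> ln (norm (1 - exp (2 * of_real t * x0)))" using t by (intro ln_mono) auto
  moreover have "- ln (1 - y) \<le> 1 / (1 - y) - 1"
    using ln_le_minus_one[of "1 / (1 - y)"] t by (simp add: ln_div)
  moreover have "1 / (1 - y) - 1 = y / (1 - y)" using t by (simp add: field_simps)
  ultimately show ?thesis by linarith
qed

text \<open>The function \<open>h\<close> equals
  \<open>2 * t * (growth (t * x0) - growth x0)\<close>, with \<open>h 1 = 0\<close> and derivative
  \<open>ln (norm w0) - ln (norm (1 - exp (2 * t * x0)))\<close>. Its sign is clear up to the angle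
  \<open>5 * pi / 2\<close>. Later the norm may come near or below \<open>norm w0\<close> again, so
  a reserve is collected on the obtuse range and partly spent afterwards.\<close>

lemma growth_ray:
  assumes t: "(2 * pi - \<theta>) / (2 * pi + \<theta>) \<le> t" "t \<noteq> 1"
  shows "growth (of_real t * x0) < growth x0"
proof -
  define b where "b = 2 * pi + \<theta>"
  have b: "b > 0" "b < 7437/1000" using theta_range theta_bounds pi_bounds by (auto simp: b_def)
  have t0: "t > 0" 
  proof -
    have "(2 * pi - \<theta>) / (2 * pi + \<theta>) > 0" using theta_range b by (intro divide_pos_pos) (auto simp: b_def)
    thus ?thesis using t by linarith
  qed
  define h where "h t = ray x0 t - t * lam" for t
  have h1: "h 1 = 0" using growth_eq_ray[OF x0_slit(2)] growth_x0 by (simp add: h_def)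
  have dh: "(h has_real_derivative - ln (norm (1 - exp (2 * of_real u * x0))) - lam) (at u)" if "u > 0" for u
    unfolding h_def[abs_def] by (auto intro!: derivative_eq_intros ray_deriv x0_slit ray_x0_slit that)
  have cont: "continuous_on {u..v} h" if "u > 0" for u v
  proof (rule continuous_at_imp_continuous_on, rule ballI)
    fix s assume "s \<in> {u..v}"
    thus "isCont h s" using that by (intro DERIV_isCont[OF dh]) auto
  qed
  have nw: "norm w0 > 0" using one_minus_w0 by simp
  \<comment> \<open>The angle \<open>t * b\<close> is \<open>5 * pi / 2\<close> at
    \<open>\<tau>1\<close> and \<open>7 * pi / 2\<close> at \<open>\<tau>2\<close>. The extra 0.36
    lowers \<open>exp (t * Re z0)\<close> by the factor \<open>exp (- 0.576)\<close>, since
    \<open>Re z0 \<le> - 1.6\<close>.\<close>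
  define \<tau>1 \<tau>2 \<tau>3 where "\<tau>1 = 5 * pi / (2 * b)" and "\<tau>2 = 7 * pi / (2 * b)" and "\<tau>3 = \<tau>2 + 36/100"
  have tau: "1 < \<tau>1" "\<tau>2 - \<tau>1 = pi / b" "\<tau>1 < \<tau>2"
  proof -
    show "1 < \<tau>1" unfolding \<tau>1_def using b theta_range by (simp add: pos_less_divide_eq b_def)
    show d: "\<tau>2 - \<tau>1 = pi / b" unfolding \<tau>1_def \<tau>2_def diff_divide_distrib[symmetric] by simp
    have "pi / b > 0" using b by simp
    thus "\<tau>1 < \<tau>2" using d by linarith
  qed
  have early: "h u < 0" if "1 < u" "u \<le> \<tau>1" for u
  proof -
    have "h u < h 1"
    proof (rule DERIV_neg_imp_decreasing_open[OF that(1)])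
      fix v assume v: "1 < v" "v < u"
      have "norm w0 < norm (1 - exp (2 * of_real v * x0))"
        using v that by (intro norm_ray_after) (auto simp: \<tau>1_def b_def)
      hence "ln (norm w0) < ln (norm (1 - exp (2 * of_real v * x0)))" using nw by (intro ln_strict_mono) auto
      thus "\<exists>y. (h has_real_derivative y) (at v) \<and> y < 0"
        using dh[of v] v by (intro exI[of _ "- ln (norm (1 - exp (2 * of_real v * x0))) - lam"]) (auto simp: lam_def)
    qed (use cont in auto)
    thus ?thesis using h1 by simp
  qed
  have step: "h v \<le> h u + (k - lam) * (v - u)"
    if "0 < u" "u \<le> v" "\<And>s. u \<le> s \<Longrightarrow> s \<le> v \<Longrightarrow> - ln (norm (1 - exp (2 * of_real s * x0))) \<le> k" for u v k
  proof -
    have "ray x0 v - ray x0 u \<le> (\<lambda>s. k * s) v - (\<lambda>s. k * s) u"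
      by (rule ray_mono[OF x0_slit, where m' = "\<lambda>_. k"]) (use that ray_x0_slit in \<open>auto intro!: derivative_eq_intros\<close>)
    thus ?thesis by (simp add: h_def algebra_simps)
  qed
  have mid: "h u \<le> h \<tau>1 + (0 - lam) * (u - \<tau>1)" if "\<tau>1 \<le> u" "u \<le> \<tau>2" for u
  proof (rule step)
    fix s assume "\<tau>1 \<le> s" "s \<le> u"
    hence "1 \<le> norm (1 - exp (2 * of_real s * x0))"
      using that by (intro norm_ray_obtuse) (auto simp: \<tau>1_def \<tau>2_def b_def)
    thus "- ln (norm (1 - exp (2 * of_real s * x0))) \<le> 0" by simp
  qed (use tau that in auto)
  \<comment> \<open>The reserve: over the obtuse range, of length \<open>pi / b\<close>,
    \<open>h\<close> falls at least at the rate \<open>lam\<close>.\<close>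
  have h\<tau>2: "h \<tau>2 \<le> - (282/10000)"
  proof -
    have "h \<tau>2 \<le> h \<tau>1 + (0 - lam) * (\<tau>2 - \<tau>1)" using tau by (intro mid) auto
    moreover have "h \<tau>1 < 0" using tau by (intro early) auto
    moreover have "lam * (pi / b) \<ge> (668/10000) * ((31415/10000) / (7437/1000))"
      using lam_bound pi_bounds b by (intro mult_mono frac_le) auto
    ultimately show ?thesis unfolding tau(2) by simp
  qed
  have e\<tau>2: "exp (\<tau>2 * Re z0) \<le> 1 / 10"
  proof -
    have "14784/10000 \<le> \<tau>2" unfolding \<tau>2_def using b pi_bounds by (subst pos_le_divide_eq) auto
    hence "\<tau>2 * Re z0 \<le> (14784/10000) * Re z0" using Re_z0_neg by (intro mult_right_mono_neg) auto
    hence "\<tau>2 * Re z0 \<le> - (2365/1000)" using Re_z0_bounds by linarith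
    hence "exp (\<tau>2 * Re z0) \<le> exp (- (2365/1000))" by simp
    moreover have "10 \<le> exp (2365/1000 :: real)"
    proof -
      have "10 \<le> (1 + (2365/1000) / real 8 + ((2365/1000) / real 8)\<^sup>2 / 2) ^ 8" by (simp add: power2_eq_square power_divide)
      also have "\<dots> \<le> exp (2365/1000)" by (rule exp_ge_power) auto
      finally show ?thesis .
    qed
    hence "exp (- (2365/1000)) \<le> (1/10 :: real)" by (simp add: exp_minus field_simps)
    ultimately show ?thesis by linarith
  qed
  have ey: "exp (s * Re z0) \<le> 1 / 10" if "\<tau>2 \<le> s" for s
  proof -
    have "s * Re z0 \<le> \<tau>2 * Re z0" using that Re_z0_neg by (intro mult_right_mono_neg) auto
    hence "exp (s * Re z0) \<le> exp (\<tau>2 * Re z0)" by simp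
    thus ?thesis using e\<tau>2 by linarith
  qed
  \<comment> \<open>Here the available slope bound is \<open>1/9 - lam\<close>, which may be
    positive; over the length 0.36 the rise is at most about 0.016, less than the reserve.\<close>
  have late: "h u \<le> - (11/1000)" if "\<tau>2 \<le> u" "u \<le> \<tau>3" for u
  proof -
    have "h u \<le> h \<tau>2 + ((1/10) / (1 - 1/10) - lam) * (u - \<tau>2)"
      using that tau by (intro step ln_norm_ray_tail ey) auto
    moreover have "((1/10) / (1 - 1/10) - lam) * (u - \<tau>2) \<le> (445/10000) * (36/100)"
    proof (cases "(1/10) / (1 - 1/10) - lam \<ge> 0")
      case True
      thus ?thesis using lam_bound that by (intro mult_mono) (auto simp: \<tau>3_def)
    next
      case False
      hence "((1/10) / (1 - 1/10) - lam) * (u - \<tau>2) \<le> 0" using that by (intro mult_nonpos_nonneg) auto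
      also have "0 \<le> (445/10000) * (36/100 :: real)" by simp
      finally show ?thesis .
    qed
    ultimately show ?thesis using h\<tau>2 by linarith
  qed
  \<comment> \<open>From here on \<open>exp (s * Re z0) \<le> 0.0565\<close>, and
    \<open>0.0565 / (1 - 0.0565)\<close> is below \<open>lam\<close>, so \<open>h\<close> no longer
    rises.\<close>
  have tail: "h u < 0" if "\<tau>3 \<le> u" for u
  proof -
    have "h u \<le> h \<tau>3 + ((565/10000) / (1 - 565/10000) - lam) * (u - \<tau>3)"
    proof (intro step ln_norm_ray_tail)
      fix s assume s: "\<tau>3 \<le> s" "s \<le> u"
      have "s * Re z0 \<le> \<tau>3 * Re z0" using s Re_z0_neg by (intro mult_right_mono_neg) auto
      also have "\<dots> \<le> \<tau>2 * Re z0 + - (576/1000)" using Re_z0_bounds by (simp add: \<tau>3_def algebra_simps)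
      finally have "exp (s * Re z0) \<le> exp (\<tau>2 * Re z0 + - (576/1000))" by (simp only: exp_le_cancel_iff)
      also have "\<dots> = exp (\<tau>2 * Re z0) * exp (- (576/1000))" by (rule exp_add)
      also have "\<dots> \<le> (1/10) * (100/177)"
      proof (intro mult_mono e\<tau>2)
        have "177/100 \<le> (1 + (576/1000) / real 4 + ((576/1000) / real 4)\<^sup>2 / 2) ^ 4" by (simp add: power2_eq_square power_divide)
        also have "\<dots> \<le> exp (576/1000)" by (rule exp_ge_power) auto
        finally show "exp (- (576/1000)) \<le> (100/177 :: real)" by (simp add: exp_minus field_simps)
      qed auto
      also have "\<dots> \<le> 565/10000" by simp
      finally show "exp (s * Re z0) \<le> 565/10000" .
    qed (use that tau in \<open>auto simp: \<tau>3_def\<close>)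
    moreover have "((565/10000) / (1 - 565/10000) - lam) * (u - \<tau>3) \<le> 0"
      using lam_bound that by (intro mult_nonpos_nonneg) auto
    moreover have "h \<tau>3 \<le> - (11/1000)" by (intro late) (auto simp: \<tau>3_def)
    ultimately show ?thesis by linarith
  qed
  have "h t < 0"
  proof (cases "t < 1")
    case True
    have "h t < h 1"
    proof (rule DERIV_pos_imp_increasing_open[OF True])
      fix v assume v: "t < v" "v < 1"
      have "norm (1 - exp (2 * of_real v * x0)) < norm w0"
        using v t by (intro norm_ray_before) auto
      moreover have "0 < norm (1 - exp (2 * of_real v * x0))"
      proof -
        have "Re (2 * of_real v * x0) < 0" using v t0 Re_z0_neg by (simp add: x0_def mult_pos_neg)
        from one_minus_exp_Re_pos(1)[OF this] show ?thesis by auto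
      qed
      ultimately have "ln (norm (1 - exp (2 * of_real v * x0))) < ln (norm w0)" by (intro ln_strict_mono) auto
      thus "\<exists>y. (h has_real_derivative y) (at v) \<and> y > 0"
        using dh[of v] v t0 by (intro exI[of _ "- ln (norm (1 - exp (2 * of_real v * x0))) - lam"]) (auto simp: lam_def)
    qed (use cont t0 in auto)
    thus ?thesis using h1 by simp
  next
    case False
    hence t1: "t > 1" using t by simp
    consider "t \<le> \<tau>1" | "\<tau>1 \<le> t" "t \<le> \<tau>2" | "\<tau>2 \<le> t" "t \<le> \<tau>3" | "\<tau>3 \<le> t" by linarith
    thus ?thesis
    proof cases
      case 1 thus ?thesis using early t1 by blast
    next
      case 2
      have "h \<tau>1 < 0" using tau by (intro early) auto
      moreover have "(0 - lam) * (t - \<tau>1) \<le> 0" using 2 lam_bound by (intro mult_nonpos_nonneg) auto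
      ultimately show ?thesis using mid[OF 2] by linarith
    next
      case 3 thus ?thesis using late[of t] by simp
    next
      case 4 thus ?thesis by (rule tail)
    qed
  qed
  moreover have "growth (of_real t * x0) = (h t + t * lam) / (2 * t)"
    using ray_eq_growth[OF x0_slit(2) t0] t0 by (simp add: h_def)
  moreover have "(h t + t * lam) / (2 * t) < lam / 2"
    using \<open>h t < 0\<close> t0 by (simp add: pos_divide_less_eq)
  ultimately show ?thesis using growth_x0 by linarith
qed

end

section \<open>The saddle point expansion\<close>

lemma lpoly_scale: "lpoly D g c \<Longrightarrow> lpoly {t. t * u \<in> D} (\<lambda>N t. g N (t * u)) (\<lambda>t. c (t * u))"
proof (induction rule: lpoly.induct)
  case (const h)
  have "(\<lambda>t. h (t * u)) holomorphic_on {t. t * u \<in> D}"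
    by (rule holomorphic_on_compose_gen[unfolded o_def, OF _ const]) (auto intro!: holomorphic_intros)
  thus ?case by (rule lpoly.const)
qed (auto intro: lpoly.intros)

lemma asy_scale:
  assumes "asy F D r f c"
  shows "asy F {t. t * u \<in> D} r (\<lambda>N t. f N (t * u)) (\<lambda>t. c (t * u))"
proof -
  obtain g where g: "lpoly D g c" "unif_O F D r (\<lambda>N x. f N x - g N x)"
    using assms unfolding asy_def by blast
  have "unif_O F {t. t * u \<in> D} r (\<lambda>N t. f N (t * u) - g N (t * u))"
  proof (rule unif_OI)
    fix K assume K: "compact K" "K \<subseteq> {t. t * u \<in> D}"
    have "compact ((\<lambda>t. t * u) ` K)" by (intro compact_continuous_image continuous_intros K)
    moreover have "(\<lambda>t. t * u) ` K \<subseteq> D" using K by auto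
    ultimately obtain C where "\<forall>\<^sub>F N in F. \<forall>x\<in>(\<lambda>t. t * u) ` K. norm (f N x - g N x) \<le> C / real N ^ r"
      using unif_OE[OF g(2)] by blast
    thus "\<exists>C. \<forall>\<^sub>F N in F. \<forall>t\<in>K. norm (f N (t * u) - g N (t * u)) \<le> C / real N ^ r" by auto
  qed
  thus ?thesis by (rule asyI[OF lpoly_scale[OF g(1)]])
qed

text \<open>The part of \<open>kern\<close> that depends on \<open>x / N\<close> alone, once the
  power of \<open>- x / N\<close> is split off. It equals 1 at 0 and contributes nothing to the
  leading term.\<close>

definition kfac :: "int \<Rightarrow> complex \<Rightarrow> complex" where
  "kfac m z = exp z * expm1_over z powi (- (m + 1))"

lemma kfac_holomorphic: "kfac m holomorphic_on slit_dom"
proof -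
  have "expm1_over z \<noteq> 0" if "z \<in> slit_dom" for z using expm1_over_not_nonpos[OF that] by auto
  thus ?thesis unfolding kfac_def[abs_def] by (intro holomorphic_intros expm1_over_holomorphic) auto
qed

text \<open>The Taylor polynomial at 0, evaluated at \<open>x / N\<close>, is already a polynomial
  in \<open>1/N\<close>; the remainder bound is uniform because \<open>x / N\<close> lies on the
  segment from 0 to \<open>x\<close>.\<close>

lemma kfac_asy:
  assumes F: "F \<le> sequentially"
  shows "asy F slit_dom r (\<lambda>N x. kfac m (x / of_nat N)) (\<lambda>_. 1)"
proof -
  let ?d = "\<lambda>i. (deriv ^^ i) (kfac m) 0"
  have evN: "\<forall>\<^sub>F N in F. N \<ge> 1"
    using F eventually_ge_at_top[of 1] by (auto simp: le_filter_def)
  have 1: "asy F slit_dom r (\<lambda>N x. \<Sum>i\<le>r. (?d i / fact i * x ^ i) * (1 / of_nat N) ^ i) (\<lambda>x. \<Sum>i\<le>r. (?d i / fact i * x ^ i) * 0 ^ i)"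
    by (intro asy_sum asy_cmult asy_power asy_inverse_N F holomorphic_intros) auto
  have "(\<Sum>i\<le>r. (?d i / fact i * x ^ i) * 0 ^ i) = (\<Sum>i\<in>{0}. (?d i / fact i * x ^ i) * 0 ^ i)" for x
    by (rule sum.mono_neutral_right) auto
  hence 2: "asy F slit_dom r (\<lambda>N x. \<Sum>i\<le>r. (?d i / fact i * x ^ i) * (1 / of_nat N) ^ i) (\<lambda>x. 1)"
    using 1 by (simp add: kfac_def expm1_over_def)
  have 3: "unif_O F slit_dom r (\<lambda>N x. kfac m (x / of_nat N) - (\<Sum>i\<le>r. (?d i / fact i * x ^ i) * (1 / of_nat N) ^ i))"
  proof (rule unif_OI)
    fix K assume K: "compact K" "K \<subseteq> slit_dom"
    obtain B where B: "B \<ge> 0" "\<And>x u w. x \<in> K \<Longrightarrow> u \<in> closed_segment 0 x \<Longrightarrow> w \<in> closed_segment 0 x \<Longrightarrow>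
         norm (kfac m w - (\<Sum>i\<le>r. (deriv ^^ i) (kfac m) u * (w - u) ^ i / fact i)) \<le> B * norm (w - u) ^ Suc r"
      using taylor_radial_bound[OF open_slit_dom slit_dom_segment kfac_holomorphic K] by blast
    obtain X where X: "\<And>x. x \<in> K \<Longrightarrow> norm x \<le> X"
      using compact_imp_bounded[OF K(1)] by (auto simp: bounded_iff)
    have "\<forall>\<^sub>F N in F. \<forall>x\<in>K. norm (kfac m (x / of_nat N) - (\<Sum>i\<le>r. (?d i / fact i * x ^ i) * (1 / of_nat N) ^ i)) \<le> (B * \<bar>X\<bar> ^ Suc r) / real N ^ r"
      using evN
    proof eventually_elim
      case (elim N)
      show ?case
      proof
        fix x assume x: "x \<in> K"
        have "x / of_nat N = (1 / real N) *\<^sub>R x" by (simp add: scaleR_conv_of_real)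
        hence mem: "x / of_nat N \<in> closed_segment 0 x" using elim by (auto simp: closed_segment_def intro!: exI[of _ "1 / real N"])
        have "norm (kfac m (x / of_nat N) - (\<Sum>i\<le>r. ?d i * (x / of_nat N - 0) ^ i / fact i)) \<le> B * norm (x / of_nat N - 0) ^ Suc r"
          by (rule B(2)[OF x _ mem]) simp
        also have "(\<Sum>i\<le>r. ?d i * (x / of_nat N - 0) ^ i / fact i) = (\<Sum>i\<le>r. (?d i / fact i * x ^ i) * (1 / of_nat N) ^ i)"
          by (intro sum.cong refl) (simp add: power_divide)
        also have "B * norm (x / of_nat N - 0) ^ Suc r = B * norm x ^ Suc r / real N ^ Suc r"
          by (simp add: norm_divide power_divide)
        also have "\<dots> \<le> B * \<bar>X\<bar> ^ Suc r / real N ^ Suc r"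
          using B X[OF x] by (intro divide_right_mono mult_left_mono power_mono) auto
        also have "\<dots> \<le> B * \<bar>X\<bar> ^ Suc r / real N ^ r"
          using B elim by (intro divide_left_mono power_increasing) auto
        finally show "norm (kfac m (x / of_nat N) - (\<Sum>i\<le>r. (?d i / fact i * x ^ i) * (1 / of_nat N) ^ i)) \<le> (B * \<bar>X\<bar> ^ Suc r) / real N ^ r" .
      qed
    qed
    thus "\<exists>C. \<forall>\<^sub>F N in F. \<forall>x\<in>K. norm (kfac m (x / of_nat N) - (\<Sum>i\<le>r. (?d i / fact i * x ^ i) * (1 / of_nat N) ^ i)) \<le> C / real N ^ r" ..
  qed
  show ?thesis using asy_add[OF 2 asy_small[OF 3]] by simp
qed

text \<open>The power of \<open>N\<close> collects \<open>m + 1\<close> from the factor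
  \<open>1 - exp (x / N)\<close> and loses 1 to \<open>dq / dx\<close>.\<close>

lemma kern_kfac:
  assumes x: "x \<noteq> 0" and N: "N \<ge> 1"
  shows "kern m N x = - (of_nat N powi m) * ((- x) powi (- (m + 1)) * kfac m (x / of_nat N) * inverse (qpoch N (- exp (x / of_nat N))))"
proof -
  have "(1 - exp (x / of_nat N)) powi (- (m + 1)) = (- x / of_nat N) powi (- (m + 1)) * expm1_over (x / of_nat N) powi (- (m + 1))"
    unfolding one_minus_exp by (simp add: power_int_mult_distrib[symmetric])
  also have "(- x / of_nat N) powi (- (m + 1)) = (- x) powi (- (m + 1)) * of_nat N powi (m + 1)"
    unfolding power_int_divide_distrib by (simp add: power_int_minus divide_inverse del: minus_add_distrib)
  also have "of_nat N powi (m + 1) = of_nat N powi m * (of_nat N :: complex)"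
    using N by (simp add: power_int_add)
  finally show ?thesis using N unfolding kern_def kfac_def by (simp add: field_simps)
qed

lemma norm_of_nat_powi_le: "norm (of_nat N powi m :: complex) \<le> real N ^ nat \<bar>m\<bar>" if "N \<ge> 1"
proof (cases "m \<ge> 0")
  case True
  thus ?thesis by (simp add: power_int_def norm_power)
next
  case False
  have "inverse (real N) ^ nat (- m) \<le> 1 ^ nat (- m)" using that by (intro power_mono) (auto simp: inverse_le_1_iff)
  also have "\<dots> \<le> real N ^ nat (- m)" using that by (intro power_mono) auto
  finally show ?thesis using False by (simp add: power_int_def norm_power norm_inverse)
qed

lemma kern_bound:
  assumes K: "compact K" "K \<subseteq> slit_dom - {0}" and g: "\<And>x. x \<in> K \<Longrightarrow> growth x \<le> g"
  obtains C where "C \<ge> 0" "\<forall>\<^sub>F N in parity_filter a. \<forall>x\<in>K. norm (kern m N x) \<le> C * real N ^ nat \<bar>m\<bar> * exp (real N * g)"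
proof -
  obtain C1 where C1: "\<forall>\<^sub>F N in parity_filter a. \<forall>x\<in>K. norm (inverse (qpoch N (- exp (x / of_nat N)))) \<le> C1 * exp (real N * growth x)"
    using inverse_qpoch_bound[OF K] by blast
  have "unif_O (parity_filter a) (slit_dom - {0}) (0 + 0) (\<lambda>N x. (- x) powi (- (m + 1)) * kfac m (x / of_nat N))"
    by (intro unif_O_mult unif_O_const unif_O_subset[OF asy_O0[OF kfac_asy]] parity_filter_le holomorphic_on_imp_continuous_on holomorphic_intros) auto
  then obtain C2 where C2: "C2 \<ge> 0" "\<forall>\<^sub>F N in parity_filter a. \<forall>x\<in>K. norm ((- x) powi (- (m + 1)) * kfac m (x / of_nat N)) \<le> C2 / real N ^ (0 + 0)"
    using unif_OE[OF _ K] by blast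
  have ev: "\<forall>\<^sub>F N in parity_filter a. N \<ge> 1"
    unfolding eventually_parity_filter using eventually_ge_at_top[of 1] by eventually_elim simp
  have "\<forall>\<^sub>F N in parity_filter a. \<forall>x\<in>K. norm (kern m N x) \<le> (C2 * \<bar>C1\<bar>) * real N ^ nat \<bar>m\<bar> * exp (real N * g)"
    using C1 C2(2) ev
  proof eventually_elim
    case (elim N)
    show ?case
    proof
      fix x assume x: "x \<in> K"
      hence x0: "x \<noteq> 0" using K by auto
      have q: "norm (inverse (qpoch N (- exp (x / of_nat N)))) \<le> \<bar>C1\<bar> * exp (real N * g)"
      proof -
        have "norm (inverse (qpoch N (- exp (x / of_nat N)))) \<le> C1 * exp (real N * growth x)" using elim(1) x by blast
        also have "\<dots> \<le> \<bar>C1\<bar> * exp (real N * g)" using g[OF x] by (intro mult_mono) (auto intro: mult_left_mono)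
        finally show ?thesis .
      qed
      have "norm (kern m N x) = norm (of_nat N powi m :: complex) * (norm ((- x) powi (- (m + 1)) * kfac m (x / of_nat N)) * norm (inverse (qpoch N (- exp (x / of_nat N)))))"
        unfolding kern_kfac[OF x0 elim(3)] by (simp add: norm_mult)
      also have "\<dots> \<le> real N ^ nat \<bar>m\<bar> * (C2 * (\<bar>C1\<bar> * exp (real N * g)))"
        using elim(2) x C2(1) by (intro mult_mono norm_of_nat_powi_le elim(3) q) auto
      finally show "norm (kern m N x) \<le> (C2 * \<bar>C1\<bar>) * real N ^ nat \<bar>m\<bar> * exp (real N * g)" by (simp add: mult_ac)
    qed
  qed
  with C2(1) show ?thesis by (intro that[of "C2 * \<bar>C1\<bar>"]) auto
qed

lemma kern_segment_bound:
  assumes s: "closed_segment u v \<subseteq> slit_dom - {0}" and g: "\<And>x. x \<in> closed_segment u v \<Longrightarrow> growth x \<le> g"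
  obtains C where "C \<ge> 0" "\<forall>\<^sub>F N in parity_filter a. norm (contour_integral (linepath u v) (kern m N)) \<le> C * real N ^ nat \<bar>m\<bar> * exp (real N * g)"
proof -
  obtain C where C: "C \<ge> 0" "\<forall>\<^sub>F N in parity_filter a. \<forall>x\<in>closed_segment u v. norm (kern m N x) \<le> C * real N ^ nat \<bar>m\<bar> * exp (real N * g)"
    by (rule kern_bound[OF compact_segment s g])
  have ev: "\<forall>\<^sub>F N in parity_filter a. N \<ge> 1"
    unfolding eventually_parity_filter using eventually_ge_at_top[of 1] by eventually_elim simp
  have "\<forall>\<^sub>F N in parity_filter a. norm (contour_integral (linepath u v) (kern m N)) \<le> (C * norm (v - u)) * real N ^ nat \<bar>m\<bar> * exp (real N * g)"
    using C(2) ev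
  proof eventually_elim
    case (elim N)
    have "norm (contour_integral (linepath u v) (kern m N)) \<le> C * real N ^ nat \<bar>m\<bar> * exp (real N * g) * norm (v - u)"
    proof (rule contour_integral_bound_linepath)
      show "kern m N contour_integrable_on linepath u v"
        by (intro contour_integrable_continuous_linepath holomorphic_on_imp_continuous_on
              holomorphic_on_subset[OF kern_holomorphic[OF elim(2)] s])
    qed (use elim C(1) in auto)
    thus ?case by (simp add: mult_ac)
  qed
  with C(1) show ?thesis by (intro that[of "C * norm (v - u)"]) auto
qed

text \<open>The finitely many remaining indices are absorbed into the constant, which is possible
  because the comparison function is positive.\<close>

lemma eventually_bound_imp_all:
  fixes f g :: "nat \<Rightarrow> real"
  assumes "\<forall>\<^sub>F N in sequentially. f N \<le> C * g N" "\<And>N. N \<ge> 1 \<Longrightarrow> g N > 0"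
  shows "\<exists>C. \<forall>N\<ge>1. f N \<le> C * g N"
proof -
  obtain M where M: "\<And>N. N \<ge> M \<Longrightarrow> f N \<le> C * g N" using assms(1) by (auto simp: eventually_sequentially)
  define C' where "C' = \<bar>C\<bar> + (\<Sum>N<M. \<bar>f N / g N\<bar>)"
  have "f N \<le> C' * g N" if N: "N \<ge> 1" for N
  proof (cases "N \<ge> M")
    case True
    have "(\<Sum>N<M. \<bar>f N / g N\<bar>) \<ge> 0" by (rule sum_nonneg) simp
    hence "C \<le> C'" unfolding C'_def by linarith
    thus ?thesis using M[OF True] mult_right_mono[of C C' "g N"] assms(2)[OF N] by linarith
  next
    case False
    have "f N / g N \<le> \<bar>f N / g N\<bar>" by (rule abs_ge_self)
    also have "\<dots> \<le> (\<Sum>N<M. \<bar>f N / g N\<bar>)" using False by (intro member_le_sum) auto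
    also have "\<dots> \<le> C'" by (simp add: C'_def)
    finally show ?thesis using assms(2)[OF N] by (simp add: divide_le_eq)
  qed
  thus ?thesis by blast
qed

lemma eventually_sequentially_parity:
  assumes "eventually P (parity_filter 0)" "eventually P (parity_filter 1)"
  shows "eventually P sequentially"
  using assms unfolding eventually_parity_filter
  by eventually_elim (metis mod2_eq_if)

lemma closed_segment_Re_Im:
  fixes u v x :: complex
  assumes "x \<in> closed_segment u v"
  shows "Re x \<in> closed_segment (Re u) (Re v)" "Im x \<in> closed_segment (Im u) (Im v)"
  using assms closed_segment_linear_image[OF bounded_linear.linear[OF bounded_linear_Re], of u v]
    closed_segment_linear_image[OF bounded_linear.linear[OF bounded_linear_Im], of u v] by auto

lemma contour_integral_linepath_scale:
  "contour_integral (linepath (a * u) (b * u)) f = contour_integral (linepath a b) (\<lambda>t. f (t * u) * u)"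
proof -
  have "linepath (a * u) (b * u) x = linepath a b x * u" for x by (simp add: linepath_def algebra_simps)
  thus ?thesis by (simp add: contour_integral_integral algebra_simps)
qed

lemma phase_deriv:
  assumes "Re x < 0"
  shows "(phase has_field_derivative ((- Ln (1 - exp (2 * x)) / 2 - phase x) / x)) (at x)"
proof -
  have x: "x \<noteq> 0" using assms by auto
  have d: "(phase has_field_derivative deriv phase x) (at x)"
    by (rule holomorphic_derivI[OF phase_holomorphic open_halfspace_Re_lt]) (use assms in simp)
  have "((\<lambda>x. x * phase x) has_field_derivative (phase x + x * deriv phase x)) (at x)"
    by (rule derivative_eq_intros d refl | simp)+
  from DERIV_unique[OF this x_phase_deriv[OF assms]]
  have "deriv phase x = (- Ln (1 - exp (2 * x)) / 2 - phase x) / x" using x by (simp add: field_simps)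
  with d show ?thesis by simp
qed

section \<open>The joining pieces of the contour\<close>

context dilog_zero
begin

text \<open>The ray meets the top side of the contour at \<open>tA * x0\<close>. There \<open>2 * Im x = 2 * pi - \<theta>\<close> is the reflection of \<open>2 * Im x0 = 2 * pi + \<theta>\<close> in \<open>2 * pi\<close>.\<close>

definition tA :: real where "tA = (2 * pi - \<theta>) / (2 * pi + \<theta>)"

lemma tA_range: "0 < tA" "tA < 1"
  using theta_range by (simp_all add: tA_def)

lemma Im_tA_x0: "Im (of_real tA * x0) = (2 * pi - \<theta>) / 2"
proof -
  have "2 * pi + \<theta> \<noteq> 0" using theta_range by linarith
  hence "tA * (2 * pi + \<theta>) = 2 * pi - \<theta>" by (simp add: tA_def)
  moreover have "Im (of_real tA * x0) = tA * (2 * pi + \<theta>) / 2" by (simp add: x0_def Im_z0)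
  ultimately show ?thesis by simp
qed

lemma Re_tA_x0: "Re (of_real tA * x0) < 0" "Re (of_real tA * x0) \<ge> - (11/100) * (2 * pi - \<theta>)"
proof -
  show "Re (of_real tA * x0) < 0" using tA_range Re_z0_neg by (simp add: x0_def mult_pos_neg)
  have b: "2 * pi + \<theta> > 0" "2 * pi - \<theta> > 0" using theta_range pi_gt_zero by linarith+
  have "1111 < 1000 * \<theta>" "31415 < 10000 * pi" "- 162 \<le> 100 * Re z0"
    using theta_bounds(1) pi_bounds(1) Re_z0_bounds(1) by simp_all
  hence "- 11 * (2 * pi + \<theta>) \<le> 50 * Re z0" by simp
  hence "- (11/100) * (2 * pi + \<theta>) \<le> Re z0 / 2" by (simp add: field_simps)
  hence "Re z0 / 2 / (2 * pi + \<theta>) \<ge> - (11/100)"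
    using b(1) by (simp only: pos_le_divide_eq)
  from mult_left_mono[OF this less_imp_le[OF b(2)]]
  show "Re (of_real tA * x0) \<ge> - (11/100) * (2 * pi - \<theta>)" by (simp add: tA_def x0_def mult_ac)
qed

text \<open>The ray is cut at \<open>1000 * x0\<close>, where \<open>Re z0 \<le> - 1.6\<close>
  ensures real part at most -800. On the horizontal sides \<open>2 * pi - \<theta> > 4.95\<close>
  brings 0.165 divided by it below \<open>1/30\<close>, and the right side at \<open>3/2\<close> has
  nonpositive rate because \<open>ln 3 \<ge> 1\<close>.\<close>

lemma A_coeff_main_integral:
  obtains C where "C \<ge> 0" "\<forall>\<^sub>F N in parity_filter a.
    norm (A_coeff m (-1) N - of_real (Re (contour_integral (linepath (of_real tA * x0) (of_real 1000 * x0)) (kern m N) / (pi * \<i>))))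
      \<le> C * real N ^ nat \<bar>m\<bar> * exp (real N * (1 / 30))"
proof -
  define xA xT where "xA = of_real tA * x0" and "xT = of_real 1000 * x0"
  let ?P = "\<lambda>u v C. \<forall>\<^sub>F N in parity_filter a. norm (contour_integral (linepath u v) (kern m N)) \<le> C * real N ^ nat \<bar>m\<bar> * exp (real N * (1 / 30))"
  have Im: "Im xA = (2 * pi - \<theta>) / 2" unfolding xA_def by (rule Im_tA_x0)
  have Imr: "0 < Im xA" "Im xA < pi" using theta_range pi_gt_zero by (simp_all add: Im)
  have RA: "Re xA < 0" "Re xA \<ge> - (11/100) * (2 * pi - \<theta>)" unfolding xA_def by (rule Re_tA_x0)+
  have RT: "Re xT \<le> - 800" using Re_z0_bounds by (simp add: xT_def x0_def)
  have h: "x \<in> slit_dom - {0} \<and> growth x \<le> 1 / 30" if "Im x = Im xA" "Re x \<ge> Re xA" for x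
  proof
    show "x \<in> slit_dom - {0}" using that Imr by (auto simp: slit_dom_def)
    have "growth x \<le> (165/1000) / (2 * pi - \<theta>)" by (rule growth_horizontal) (use that Im RA in auto)
    also have "\<dots> \<le> 1 / 30" using theta_bounds pi_bounds by (simp add: divide_le_eq)
    finally show "growth x \<le> 1 / 30" .
  qed
  have top: "x \<in> slit_dom - {0} \<and> growth x \<le> 1 / 30"
    if "x \<in> closed_segment xA (Complex (3/2) (Im xA))" for x
    by (rule h) (use closed_segment_Re_Im[OF that] RA in \<open>auto simp: closed_segment_eq_real_ivl split: if_splits\<close>)
  have ln3: "1 \<le> ln (3 :: real)"
    using e_less_272 by (simp add: ln_ge_iff)
  have right: "x \<in> slit_dom - {0} \<and> growth x \<le> 1 / 30"
    if "x \<in> closed_segment (Complex (3/2) (- Im xA)) (Complex (3/2) (Im xA))" for x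
  proof -
    have x: "Re x = 3/2" "\<bar>Im x\<bar> < pi"
      using closed_segment_Re_Im[OF that] Imr by (auto simp: closed_segment_eq_real_ivl split: if_splits)
    show ?thesis using growth_right_side[OF x] ln3 x by (auto simp: slit_dom_def)
  qed
  have left: "x \<in> slit_dom - {0} \<and> growth x \<le> 1 / 30" if "x \<in> closed_segment xT (cnj xT)" for x
  proof -
    have x: "Re x \<le> - 800"
      using closed_segment_Re_Im[OF that] RT by (auto simp: closed_segment_eq_real_ivl split: if_splits)
    show ?thesis using growth_far_left[OF x] x by (auto simp: slit_dom_def)
  qed
  obtain C1 where C1: "C1 \<ge> 0" "?P xA (Complex (3/2) (Im xA)) C1"
    by (rule kern_segment_bound[of xA "Complex (3/2) (Im xA)" "1/30" m a]) (use top in auto)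
  obtain C2 where C2: "C2 \<ge> 0" "?P (Complex (3/2) (- Im xA)) (Complex (3/2) (Im xA)) C2"
    by (rule kern_segment_bound[of "Complex (3/2) (- Im xA)" "Complex (3/2) (Im xA)" "1/30" m a]) (use right in auto)
  obtain C3 where C3: "C3 \<ge> 0" "?P (Complex (3/2) (Im xA)) xA C3"
    by (rule kern_segment_bound[of "Complex (3/2) (Im xA)" xA "1/30" m a]) (use top in \<open>auto simp: closed_segment_commute\<close>)
  obtain C4 where C4: "C4 \<ge> 0" "?P xT (cnj xT) C4"
    by (rule kern_segment_bound[of xT "cnj xT" "1/30" m a]) (use left in auto)
  have ev: "\<forall>\<^sub>F N in parity_filter a. N \<ge> 1"
    unfolding eventually_parity_filter using eventually_ge_at_top[of 1] by eventually_elim simp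
  have "\<forall>\<^sub>F N in parity_filter a.
    norm (A_coeff m (-1) N - of_real (Re (contour_integral (linepath xA xT) (kern m N) / (pi * \<i>))))
      \<le> (C1 + C2 + C3 + C4) * real N ^ nat \<bar>m\<bar> * exp (real N * (1 / 30))"
    using C1(2) C2(2) C3(2) C4(2) ev
  proof eventually_elim
    case (elim N)
    let ?c = "\<lambda>a b. contour_integral (linepath a b) (kern m N)"
    let ?E = "real N ^ nat \<bar>m\<bar> * exp (real N * (1 / 30))"
    define \<Delta> where "\<Delta> = A_coeff m (-1) N - of_real (Re (?c xA xT / (pi * \<i>)))"
    have d: "2 * pi * \<i> * \<Delta> = ?c (cnj xA) (Complex (3/2) (- Im xA)) + ?c (Complex (3/2) (- Im xA)) (Complex (3/2) (Im xA))
        + ?c (Complex (3/2) (Im xA)) xA + ?c xT (cnj xT)"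
      unfolding \<Delta>_def by (rule A_coeff_decomposition) (use elim(5) RA Imr RT in auto)
    \<comment> \<open>The bottom side is the conjugate of the top side, so it needs no growth
      estimate of its own.\<close>
    have bot: "?c (cnj xA) (Complex (3/2) (- Im xA)) = cnj (?c xA (Complex (3/2) (Im xA)))"
      using contour_integral_linepath_cnj[of "kern m N" xA "Complex (3/2) (Im xA)", OF kern_cnj]
      by (simp add: complex_cnj)
    have "1 * norm \<Delta> \<le> 2 * pi * norm \<Delta>" using pi_bounds by (intro mult_right_mono) auto
    also have "\<dots> = norm (2 * pi * \<i> * \<Delta>)" by (simp add: norm_mult)
    also have "\<dots> \<le> norm (?c xA (Complex (3/2) (Im xA))) + norm (?c (Complex (3/2) (- Im xA)) (Complex (3/2) (Im xA)))
        + norm (?c (Complex (3/2) (Im xA)) xA) + norm (?c xT (cnj xT))"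
      unfolding d bot by (intro norm_triangle_le add_mono) auto
    also have "\<dots> \<le> C1 * ?E + C2 * ?E + C3 * ?E + C4 * ?E"
      using elim(1-4) by (intro add_mono) (simp_all only: mult.assoc)
    finally show ?case unfolding \<Delta>_def by (simp add: algebra_simps)
  qed
  thus ?thesis using C1(1) C2(1) C3(1) C4(1) unfolding xA_def xT_def by (intro that[of "C1 + C2 + C3 + C4"]) auto
qed

section \<open>The saddle on the ray and the constants it produces\<close>

definition ray_dom :: "complex set" where "ray_dom = {t. Re (t * x0) < 0}"

lemma open_ray_dom: "open ray_dom"
  unfolding ray_dom_def by (intro open_Collect_less continuous_intros)

lemma of_real_ray_dom: "t > 0 \<Longrightarrow> complex_of_real t \<in> ray_dom"
  using Re_z0_neg by (simp add: ray_dom_def x0_def mult_pos_neg)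

lemma ray_phase_deriv:
  assumes "t \<in> ray_dom"
  shows "((\<lambda>t. phase (t * x0)) has_field_derivative ((- Ln (1 - exp (2 * (t * x0))) / 2 - phase (t * x0)) / t)) (at t)"
proof -
  have t: "t \<noteq> 0" "x0 \<noteq> 0" using assms by (auto simp: ray_dom_def)
  have "((\<lambda>t. phase (t * x0)) has_field_derivative ((- Ln (1 - exp (2 * (t * x0))) / 2 - phase (t * x0)) / (t * x0) * x0)) (at t)"
    by (rule DERIV_chain2[OF phase_deriv]) (use assms in \<open>auto simp: ray_dom_def intro!: derivative_eq_intros\<close>)
  thus ?thesis using t by simp
qed

lemma ray_phase_holomorphic: "(\<lambda>t. phase (t * x0)) holomorphic_on ray_dom"
  using ray_phase_deriv by (auto simp: holomorphic_on_open[OF open_ray_dom])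

lemma exp_2x0: "exp (2 * x0) = 1 - w0"
  using exp_z0 by (simp add: x0_def)

lemma w0_nonpos: "w0 \<notin> \<real>\<^sub>\<le>\<^sub>0"
  using w0_bounds by (auto simp: complex_nonpos_Reals_iff)

lemma ray_phase_crit: "deriv (\<lambda>t. phase (t * x0)) 1 = 0"
  using DERIV_imp_deriv[OF ray_phase_deriv[of 1]] of_real_ray_dom[of 1] by (simp add: exp_2x0 phase_x0)

text \<open>The first derivative is a quotient whose numerator vanishes at 1, and
  \<open>phase\<close> is stationary there; so only the derivative of the logarithm in the numerator
  survives.\<close>

lemma ray_phase_second_deriv: "deriv (deriv (\<lambda>t. phase (t * x0))) 1 = x0 * (1 - w0) / w0"
proof -
  let ?h = "\<lambda>t. (- Ln (1 - exp (2 * (t * x0))) / 2 - phase (t * x0)) / t"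
  have 1: "1 \<in> ray_dom" using of_real_ray_dom[of 1] by simp
  have p: "((\<lambda>t. phase (t * x0)) has_field_derivative 0) (at 1)"
    using ray_phase_deriv[OF 1] by (simp add: exp_2x0 phase_x0)
  have "((\<lambda>t. exp (2 * (t * x0))) has_field_derivative (2 * x0 * (1 - w0))) (at 1)"
    by (auto intro!: derivative_eq_intros simp: exp_2x0)
  hence "((\<lambda>t. 1 - exp (2 * (t * x0))) has_field_derivative (0 - 2 * x0 * (1 - w0))) (at 1)"
    by (intro DERIV_diff DERIV_const)
  hence "((\<lambda>t. Ln (1 - exp (2 * (t * x0)))) has_field_derivative (inverse w0 * (0 - 2 * x0 * (1 - w0)))) (at 1)"
    by (intro DERIV_chain2[where f = Ln]) (auto simp: exp_2x0 intro!: has_field_derivative_Ln w0_nonpos)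
  hence n: "((\<lambda>t. - Ln (1 - exp (2 * (t * x0))) / 2 - phase (t * x0)) has_field_derivative (- (inverse w0 * (0 - 2 * x0 * (1 - w0))) / 2 - 0)) (at 1)"
    by (intro DERIV_diff DERIV_cdivide DERIV_minus p)
  have v: "- Ln (1 - exp (2 * (1 * x0))) / 2 - phase (1 * x0) = 0" by (simp add: exp_2x0 phase_x0)
  have alg: "((- (inverse w * (0 - 2 * x * u)) / 2 - 0) * 1 - 0 * 1) / (1 * 1) = x * u / w" for w x u :: complex
    by (cases "w = 0") (simp_all add: field_simps)
  have "(?h has_field_derivative (x0 * (1 - w0) / w0)) (at 1)"
    by (rule DERIV_cong[OF DERIV_divide[OF n DERIV_ident]]) (simp_all only: v alg one_neq_zero not_False_eq_True)
  hence "(deriv (\<lambda>t. phase (t * x0)) has_field_derivative (x0 * (1 - w0) / w0)) (at 1)"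
    by (rule has_field_derivative_transform_within_open[OF _ open_ray_dom 1])
       (simp add: DERIV_imp_deriv[OF ray_phase_deriv])
  thus ?thesis by (rule DERIV_imp_deriv)
qed

text \<open>The factor \<open>(1 - w0) / w0\<close> lies in the open first quadrant, because
  \<open>(norm w0)\<^sup>2 < Re w0\<close> and \<open>Im w0 < 0\<close>, and \<open>x0\<close> lies
  in the second; both parts of the product formula for the real part are then negative.\<close>

lemma Re_ray_phase_second_deriv: "Re (x0 * (1 - w0) / w0) < 0"
proof -
  define q where "q = (1 - w0) / w0"
  have w: "0 < norm w0" "w0 \<noteq> 0" using one_minus_w0 by auto
  have "(norm w0)\<^sup>2 \<le> (9343/10000)\<^sup>2" using norm_bounds by (intro power_mono) auto
  hence n: "(norm w0)\<^sup>2 < Re w0" using w0_bounds by (simp add: power2_eq_square)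
  have "Re q = (Re w0 - (norm w0)\<^sup>2) / (norm w0)\<^sup>2"
    unfolding q_def Re_divide cmod_power2 by (simp add: algebra_simps power2_eq_square)
  hence q1: "Re q > 0" using n w by simp
  have "Im q = - Im w0 / (norm w0)\<^sup>2"
    unfolding q_def Im_divide cmod_power2 by (simp add: algebra_simps power2_eq_square)
  hence q2: "Im q > 0" using w0_bounds w by (simp add: divide_neg_pos)
  have x: "Re x0 < 0" "Im x0 > 0" using Re_z0_neg Im_z0 theta_range by (auto simp: x0_def)
  have "Re (x0 * q) = Re x0 * Re q - Im x0 * Im q" by simp
  moreover have "Re x0 * Re q < 0" "Im x0 * Im q > 0" using x q1 q2 by (auto simp: mult_neg_pos)
  ultimately have "Re (x0 * q) < 0" by linarith
  thus ?thesis by (simp add: q_def)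
qed

text \<open>The root is written through logarithms so that it can be combined with the amplitude,
  which has the same form. It is the principal one because the imaginary parts of the three
  logarithms add up to less than \<open>pi\<close> in absolute value.\<close>

lemma csqrt_saddle: "csqrt (- (x0 * (1 - w0) / w0) / 2) = exp ((Ln (- x0) + Ln (1 - w0) - Ln w0) / 2) / sqrt 2"
proof (rule csqrt_unique)
  let ?u = "Ln (- x0) + Ln (1 - w0) - Ln w0"
  have x: "Re x0 < 0" "Im x0 > 0" "x0 \<noteq> 0" using Re_z0_neg Im_z0 theta_range by (auto simp: x0_def)
  have "(exp (u / 2) / complex_of_real (sqrt 2))\<^sup>2 = exp u / 2" for u :: complex
    by (simp add: power_divide flip: exp_double of_real_power)
  hence "(exp (?u / 2) / complex_of_real (sqrt 2))\<^sup>2 = exp ?u / 2" .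
  also have "exp ?u = - x0 * (1 - w0) / w0" using x one_minus_w0 by (simp add: exp_diff exp_add)
  finally show "(exp (?u / 2) / complex_of_real (sqrt 2))\<^sup>2 = - (x0 * (1 - w0) / w0) / 2" by simp
  have "\<bar>Im (Ln (- x0))\<bar> < pi / 2" using Re_Ln_pos_lt[of "- x0"] x by simp
  \<comment> \<open>The opposite signs of the first two imaginary parts matter: three bounds by
    \<open>pi / 2\<close> alone would allow a total beyond \<open>pi\<close>.\<close>
  moreover have "Im (Ln (- x0)) < 0"
  proof -
    have "\<not> 0 \<le> Im (Ln (- x0))" using Im_Ln_pos_le[of "- x0"] Im_Ln_le_pi[of "- x0"] x by simp
    thus ?thesis by simp
  qed
  moreover have "\<bar>Im (Ln w0)\<bar> < pi / 2" using Re_Ln_pos_lt[of w0] one_minus_w0 w0_bounds by simp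
  moreover have "0 < Im (Ln (1 - w0))" "Im (Ln (1 - w0)) < pi / 2" using theta_range by (simp_all add: \<theta>_def)
  ultimately have "\<bar>Im (Ln (- x0)) + Im (Ln (1 - w0)) - Im (Ln w0)\<bar> < pi" by arith
  hence "\<bar>Im ?u / 2\<bar> < pi / 2" by simp
  hence "cos (Im ?u / 2) > 0" by (intro cos_gt_zero_pi) auto
  hence "Re (exp (?u / 2)) > 0" unfolding Re_exp by simp
  thus "0 < Re (exp (?u / 2) / complex_of_real (sqrt 2)) \<or> Re (exp (?u / 2) / complex_of_real (sqrt 2)) = 0 \<and> 0 \<le> Im (exp (?u / 2) / complex_of_real (sqrt 2))"
    by (simp only: Re_divide_of_real) simp
qed

definition lead :: "int \<Rightarrow> nat \<Rightarrow> complex" where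
  "lead m a = - (of_real (sqrt 2) / (of_real pi * \<i>)) * ((-2) / z0) powi m * exp (- z0 / 2) * csqrt (1 + (-1) ^ a * exp (z0 / 2))"

definition ray_amp :: "int \<Rightarrow> nat \<Rightarrow> complex \<Rightarrow> complex" where
  "ray_amp m a t = (x0 * (- (t * x0)) powi (- (m + 1))) * 1 *
     (1 / complex_of_real (sqrt pi) * exp ((Ln (- (t * x0)) - Ln (1 - (-1) ^ a * exp (t * x0))) / 2))"

text \<open>The amplitude for Laplace's method: \<open>kern\<close> on the ray with its exponential,
  its power of \<open>N\<close> and its \<open>sqrt N\<close> removed. It is formed from
  \<open>kern\<close> itself and not from \<open>amp_left\<close>, so it does not mention the parity
  and its continuity for every \<open>N\<close> follows from that of \<open>kern\<close>.\<close>

definition ray_kern :: "int \<Rightarrow> nat \<Rightarrow> complex \<Rightarrow> complex" where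
  "ray_kern m N t = (if N = 0 then 0 else
     (- complex_of_real (sqrt (real N)) * (of_nat N powi (- m))) * (exp (- of_nat N * phase (t * x0)) * (kern m N (t * x0) * x0)))"

lemma ray_dom_slit: "t \<in> ray_dom \<Longrightarrow> t * x0 \<in> slit_dom - {0}"
  by (rule Re_neg_slit) (simp add: ray_dom_def)

lemma kern_ray_continuous: "N \<ge> 1 \<Longrightarrow> continuous_on ray_dom (\<lambda>t. kern m N (t * x0) * x0)"
proof -
  assume N: "N \<ge> 1"
  have "continuous_on ray_dom (\<lambda>t. kern m N (t * x0))"
    by (rule continuous_on_compose2[OF holomorphic_on_imp_continuous_on[OF kern_holomorphic[OF N]]])
       (use ray_dom_slit in \<open>auto intro!: continuous_intros\<close>)
  thus ?thesis by (intro continuous_intros)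
qed

lemma ray_kern_continuous: "continuous_on ray_dom (ray_kern m N)"
proof (cases "N = 0")
  case False
  have "continuous_on ray_dom (\<lambda>t. exp (- of_nat N * phase (t * x0)))"
    by (intro continuous_intros holomorphic_on_imp_continuous_on[OF ray_phase_holomorphic])
  hence "continuous_on ray_dom (\<lambda>t. (- complex_of_real (sqrt (real N)) * (of_nat N powi (- m))) * (exp (- of_nat N * phase (t * x0)) * (kern m N (t * x0) * x0)))"
    using False by (intro continuous_on_mult continuous_on_const kern_ray_continuous) auto
  thus ?thesis using False by (simp add: ray_kern_def[abs_def])
qed (simp add: ray_kern_def[abs_def])

lemma ray_kern_eq:
  assumes t: "t \<in> ray_dom" and N: "N \<ge> 1" "N mod 2 = a"
  shows "(x0 * (- (t * x0)) powi (- (m + 1))) * kfac m (t * x0 / of_nat N) * amp_left a N (t * x0) = ray_kern m N t"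
proof -
  have R: "Re (t * x0) < 0" using t by (simp add: ray_dom_def)
  hence nz: "t * x0 \<noteq> 0" by auto
  have k: "kern m N (t * x0) = - (of_nat N powi m) * ((- (t * x0)) powi (- (m + 1)) * kfac m (t * x0 / of_nat N) *
      (exp (of_nat N * phase (t * x0)) * amp_left a N (t * x0) / sqrt (real N)))"
    unfolding kern_kfac[OF nz N(1)] inverse_qpoch_left[OF R N] by (rule refl)
  have alg: "(- s * P') * (E' * (- P * (b * k * (E * l / s)) * x)) = (s / s) * (P' * P) * (E' * E) * ((x * b) * k * l)"
    for s P P' E E' b k l x :: complex by (simp add: mult_ac)
  have "(of_nat N powi (- m)) * (of_nat N powi m) = (1 :: complex)"
    using N by (simp add: power_int_minus)
  moreover have "exp (- of_nat N * phase (t * x0)) * exp (of_nat N * phase (t * x0)) = 1"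
    by (simp flip: exp_add)
  moreover have "complex_of_real (sqrt (real N)) / sqrt (real N) = 1" "N \<noteq> 0" using N by auto
  ultimately show ?thesis unfolding ray_kern_def k alg by (simp only: if_False mult_1_left)
qed

lemma ray_kern_asy:
  assumes a: "a \<in> {0, 1}"
  shows "asy (parity_filter a) ray_dom r (ray_kern m) (ray_amp m a)"
proof -
  have 1: "asy (parity_filter a) ray_dom r (\<lambda>N t. kfac m (t * x0 / of_nat N)) (\<lambda>t. 1)"
    by (rule asy_subset[OF asy_scale[OF kfac_asy[OF parity_filter_le]]]) (use ray_dom_slit in auto)
  have 2: "asy (parity_filter a) ray_dom r (\<lambda>N t. amp_left a N (t * x0))
      (\<lambda>t. 1 / complex_of_real (sqrt pi) * exp ((Ln (- (t * x0)) - Ln (1 - (-1) ^ a * exp (t * x0))) / 2))"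
    using asy_scale[OF amp_left_asy[OF a], where u = x0 and r = r] by (simp add: ray_dom_def)
  have 3: "(\<lambda>t. x0 * (- (t * x0)) powi (- (m + 1))) holomorphic_on ray_dom"
    using ray_dom_slit by (intro holomorphic_intros) auto
  have "asy (parity_filter a) ray_dom r
      (\<lambda>N t. (x0 * (- (t * x0)) powi (- (m + 1))) * kfac m (t * x0 / of_nat N) * amp_left a N (t * x0)) (ray_amp m a)"
    unfolding ray_amp_def[abs_def]
    by (intro asy_mult asy_cmult[where h = "\<lambda>t. x0 * (- (t * x0)) powi (- (m + 1))"] 1 2 3 parity_filter_le)
  thus ?thesis
  proof (rule asy_cong)
    show "\<forall>\<^sub>F N in parity_filter a. \<forall>t\<in>ray_dom. (x0 * (- (t * x0)) powi (- (m + 1))) * kfac m (t * x0 / of_nat N) * amp_left a N (t * x0) = ray_kern m N t"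
      unfolding eventually_parity_filter using eventually_ge_at_top[of 1]
    proof eventually_elim
      case (elim N)
      show ?case using ray_kern_eq[OF _ elim] by blast
    qed
  qed
qed

definition ray_int :: "int \<Rightarrow> nat \<Rightarrow> complex" where
  "ray_int m N = contour_integral (linepath (complex_of_real tA) (complex_of_real 1000)) (\<lambda>t. exp (of_nat N * phase (t * x0)) * ray_kern m N t)"

lemma ray_segment: "complex_of_real ` {tA..1000} \<subseteq> ray_dom"
  using of_real_ray_dom tA_range by force

lemma kern_ray_int:
  assumes N: "N \<ge> 1"
  shows "contour_integral (linepath (of_real tA * x0) (of_real 1000 * x0)) (kern m N)
     = - (of_nat N powi m) / complex_of_real (sqrt (real N)) * ray_int m N"
proof -
  let ?k = "\<lambda>t. kern m N (t * x0) * x0" and ?lp = "linepath (complex_of_real tA) (complex_of_real 1000)"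
  let ?c = "- complex_of_real (sqrt (real N)) * (of_nat N powi (- m))"
  have N0: "N \<noteq> 0" using N by auto
  have alg: "E * (c * (E' * k)) = (E' * E) * (c * k)" for E E' c k :: complex by (simp add: mult_ac)
  have e1: "exp (- of_nat N * phase (t * x0)) * exp (of_nat N * phase (t * x0)) = 1" for t
    by (simp flip: exp_add)
  have eq: "exp (of_nat N * phase (t * x0)) * ray_kern m N t = ?c * ?k t" for t
    unfolding ray_kern_def if_not_P[OF N0] alg e1 mult_1_left by (simp only: mult_ac)
  have seg: "closed_segment (complex_of_real tA) (complex_of_real 1000) \<subseteq> ray_dom"
    unfolding closed_segment_of_real closed_segment_eq_real_ivl using ray_segment tA_range by simp
  have "?k contour_integrable_on ?lp"
    by (intro contour_integrable_continuous_linepath continuous_on_subset[OF kern_ray_continuous[OF N] seg])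
  hence r: "ray_int m N = ?c * contour_integral ?lp ?k"
    unfolding ray_int_def eq by (rule contour_integral_lmul)
  have P: "(of_nat N powi m) * (of_nat N powi (- m)) = (1 :: complex)" using N by (simp add: power_int_minus)
  have s: "complex_of_real (sqrt (real N)) / complex_of_real (sqrt (real N)) = 1" using N by simp
  have alg2: "- P / s * ((- s * P') * I) = (s / s) * (P * P') * I" for P P' s I :: complex by simp
  show ?thesis unfolding r alg2 P s contour_integral_linepath_scale by simp
qed

text \<open>Laplace's method with the saddle at \<open>t = 1\<close>; \<open>growth_ray\<close> is
  the strict maximum that it requires on the whole interval.\<close>

lemma ray_int_asy:
  assumes a: "a \<in> {0, 1}"
  shows "asy (parity_filter a) UNIV r (\<lambda>N _. complex_of_real (sqrt (real N)) * (exp (- of_nat N * phase x0) * ray_int m N))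
     (\<lambda>_. complex_of_real (sqrt pi) * ray_amp m a 1 / csqrt (- (x0 * (1 - w0) / w0) / 2))"
proof -
  have "asy (parity_filter a) UNIV r (\<lambda>N _. complex_of_real (sqrt (real N)) * (exp (- of_nat N * (\<lambda>t. phase (t * x0)) (complex_of_real 1)) *
            contour_integral (linepath (complex_of_real tA) (complex_of_real 1000)) (\<lambda>t. exp (of_nat N * (\<lambda>t. phase (t * x0)) t) * ray_kern m N t)))
     (\<lambda>_. complex_of_real (sqrt pi) * ray_amp m a (complex_of_real 1) / csqrt (- deriv (deriv (\<lambda>t. phase (t * x0))) (complex_of_real 1) / 2))"
  proof (rule laplace_asy[where p = "\<lambda>t. phase (t * x0)" and g = "ray_kern m" and c = "ray_amp m a" and S = ray_dom])
    fix t :: real assume t: "t \<in> {tA..1000}" "t \<noteq> 1"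
    have "Re (of_real t * x0) < 0" "Re x0 < 0" using of_real_ray_dom[of t] of_real_ray_dom[of 1] t tA_range by (auto simp: ray_dom_def)
    hence "Re (phase (of_real t * x0)) = growth (of_real t * x0)" "Re (phase x0) = growth x0" by (simp_all only: Re_phase)
    thus "Re (phase (of_real t * x0)) < Re (phase (of_real 1 * x0))"
      using growth_ray[of t] t by (simp add: tA_def)
  qed (use ray_phase_crit ray_phase_second_deriv Re_ray_phase_second_deriv tA_range
       in \<open>simp_all add: parity_filter_le open_ray_dom ray_segment ray_phase_holomorphic ray_kern_asy[OF a] ray_kern_continuous\<close>)
  thus ?thesis by (simp add: ray_int_def ray_phase_second_deriv)
qed

text \<open>The parity only exchanges the two logarithms into which \<open>Ln w0\<close> splits;
  this lets one computation serve both classes.\<close>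

lemma Ln_w0_split:
  assumes "a \<in> {0, 1}"
  shows "Ln (1 - (-1) ^ a * exp x0) + Ln (1 + (-1) ^ a * exp x0) = Ln w0"
proof -
  have "Re x0 < 0" using Re_z0_neg by (simp add: x0_def)
  from Ln_one_minus_exp_double[OF this] show ?thesis using assms by (auto simp: exp_2x0 add.commute)
qed

text \<open>The amplitude has \<open>1 - (-1) ^ a * exp x0\<close> in the denominator, the root of
  the second derivative has \<open>w0\<close> there. Their quotient leaves the complementary factor
  \<open>1 + (-1) ^ a * exp x0\<close> in the numerator.\<close>

lemma lead_eq:
  assumes a: "a \<in> {0, 1}"
  shows "- (1 / (of_real pi * \<i>)) * (complex_of_real (sqrt pi) * ray_amp m a 1 / csqrt (- (x0 * (1 - w0) / w0) / 2)) = lead m a"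
proof -
  define L1 L2 L3 L4 L5 where "L1 = Ln (- x0)" and "L2 = Ln (1 - (-1) ^ a * exp x0)" and "L3 = Ln (1 + (-1) ^ a * exp x0)"
    and "L4 = Ln (1 - w0)" and "L5 = Ln w0"
  have x0nz: "x0 \<noteq> 0" by (rule x0_slit)
  have Re: "Re x0 < 0" using Re_z0_neg by (simp add: x0_def)
  have nz: "1 + (-1) ^ a * exp x0 \<noteq> 0"
  proof
    assume "1 + (-1) ^ a * exp x0 = 0"
    hence "norm ((-1) ^ a * exp x0) = norm (- 1 :: complex)" by (metis add.commute add_eq_0_iff)
    thus False using Re by (simp add: norm_mult norm_power)
  qed
  have p: "x0 * (- x0) powi (- (m + 1)) = - (((-2) / z0) powi m)"
  proof -
    have "(- x0) powi (- (m + 1)) = (- x0) powi (- m) * (- x0) powi (- 1)"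
      using x0nz by (subst power_int_add[symmetric]) auto
    also have "(- x0) powi (- m) = (inverse (- x0)) powi m" by (simp only: power_int_minus power_int_inverse)
    also have "inverse (- x0) = (-2) / z0" by (simp add: x0_def)
    also have "(- x0) powi (- 1) = - inverse x0" by (simp add: power_int_minus)
    finally show ?thesis using x0nz by simp
  qed
  have s2: "csqrt (1 + (-1) ^ a * exp (z0 / 2)) = exp (L3 / 2)"
    using csqrt_exp_Ln[OF nz] by (simp add: L3_def x0_def)
  \<comment> \<open>The number \<open>z0\<close> differs from \<open>Ln (1 - w0)\<close> by
    \<open>2 * pi * \<i>\<close>, and halving turns this full turn into a sign.\<close>
  have e4: "exp (- L4 / 2) = - exp (- z0 / 2)"
  proof -
    have "- L4 / 2 = - z0 / 2 + of_real pi * \<i>" by (simp add: L4_def z0_def field_simps)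
    hence "exp (- L4 / 2) = exp (- z0 / 2) * exp (of_real pi * \<i>)" by (simp only: exp_add)
    thus ?thesis by simp
  qed
  have E: "exp ((L1 - L2) / 2) / exp ((L1 + L4 - L5) / 2) = - exp (- z0 / 2) * exp (L3 / 2)"
  proof -
    have "L5 = L2 + L3" using Ln_w0_split[OF a] by (simp add: L2_def L3_def L5_def)
    hence "(L1 - L2) / 2 - (L1 + L4 - L5) / 2 = - L4 / 2 + L3 / 2" by (simp add: field_simps)
    hence "exp ((L1 - L2) / 2) / exp ((L1 + L4 - L5) / 2) = exp (- L4 / 2) * exp (L3 / 2)"
      by (metis exp_diff exp_add)
    thus ?thesis unfolding e4 .
  qed
  have r: "ray_amp m a 1 = - (((-2) / z0) powi m) * (1 / complex_of_real (sqrt pi) * exp ((L1 - L2) / 2))"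
    unfolding ray_amp_def L1_def L2_def by (simp only: mult_1_left mult_1_right p)
  have alg: "- (1 / (q * \<i>)) * (s * (- P * (1 / s * E1)) / (E2 / t)) = (s / s) * (t / (q * \<i>)) * P * (E1 / E2)" for q s P E1 E2 t :: complex
    by simp
  have ss: "complex_of_real (sqrt pi) / complex_of_real (sqrt pi) = 1" by simp
  show ?thesis
    unfolding csqrt_saddle L1_def[symmetric] L4_def[symmetric] L5_def[symmetric] r alg ss E lead_def s2 by simp
qed

text \<open>One factor \<open>1 / sqrt N\<close> comes from the product formula and another from the
  Gaussian peak, which together explain the power \<open>N ^ (m - 1)\<close>.\<close>

lemma main_integral_expansion:
  assumes a: "a \<in> {0, 1}"
  obtains d where "d 0 = lead m a"
    "\<forall>r. \<exists>C. \<forall>\<^sub>F N in parity_filter a.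
       norm (contour_integral (linepath (of_real tA * x0) (of_real 1000 * x0)) (kern m N) / (pi * \<i>)
          - (of_nat N powi m) / of_nat N * exp (of_nat N * phase x0) * (\<Sum>j<r. d j / of_nat N ^ j))
       \<le> norm (of_nat N powi m / of_nat N * exp (of_nat N * phase x0)) * (C / real N ^ r)"
proof -
  define A where "A N = - (1 / (of_real pi * \<i>)) * (complex_of_real (sqrt (real N)) * (exp (- of_nat N * phase x0) * ray_int m N))" for N
  have asyA: "asy (parity_filter a) UNIV r (\<lambda>N _. A N) (\<lambda>_. lead m a)" for r
    unfolding A_def lead_eq[OF a, symmetric]
    by (rule asy_cmult[OF ray_int_asy[OF a] _ parity_filter_le]) simp
  have "\<exists>d. d 0 = lead m a \<and> (\<forall>r. \<exists>C. \<forall>\<^sub>F N in parity_filter a. norm (A N - (\<Sum>j<r. d j / of_nat N ^ j)) \<le> C / real N ^ r)"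
  proof (rule asy_const_imp_expansion[OF parity_filter_le parity_filter_neq_bot asyA])
    fix d assume "d 0 = lead m a" "\<And>r. \<exists>C. \<forall>\<^sub>F N in parity_filter a. norm (A N - (\<Sum>j<r. d j / of_nat N ^ j)) \<le> C / real N ^ r"
    thus ?thesis by (intro exI[of _ d] conjI allI)
  qed (use a in auto)
  then obtain d where d: "d 0 = lead m a"
    "\<forall>r. \<exists>C. \<forall>\<^sub>F N in parity_filter a. norm (A N - (\<Sum>j<r. d j / of_nat N ^ j)) \<le> C / real N ^ r"
    by blast
  have ev: "\<forall>\<^sub>F N in parity_filter a. N \<ge> 1"
    unfolding eventually_parity_filter using eventually_ge_at_top[of 1] by eventually_elim simp
  show ?thesis
  proof (rule that[of d]; (intro allI)?)
    fix r
    obtain C where "\<forall>\<^sub>F N in parity_filter a. norm (A N - (\<Sum>j<r. d j / of_nat N ^ j)) \<le> C / real N ^ r"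
      using d(2) by blast
    hence "\<forall>\<^sub>F N in parity_filter a.
       norm (contour_integral (linepath (of_real tA * x0) (of_real 1000 * x0)) (kern m N) / (pi * \<i>)
          - (of_nat N powi m) / of_nat N * exp (of_nat N * phase x0) * (\<Sum>j<r. d j / of_nat N ^ j))
       \<le> norm (of_nat N powi m / of_nat N * exp (of_nat N * phase x0)) * (C / real N ^ r)" using ev
    proof eventually_elim
      case (elim N)
      let ?s = "complex_of_real (sqrt (real N))"
      have s: "?s * ?s = of_nat N" "?s \<noteq> 0" using elim(2) by (simp_all flip: of_real_mult)
      have e: "exp (of_nat N * phase x0) * exp (- of_nat N * phase x0) = 1" by (simp flip: exp_add)
      have alg: "- P / s * I / q = P / (s * s) * E * (- (1 / q) * (s * (E' * I)))" if "E * E' = 1" "s \<noteq> 0" for P s I q E E' :: complex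
      proof -
        have "P / (s * s) * E * (- (1 / q) * (s * (E' * I))) = (E * E') * (s / s) * (- P / s * I / q)" by simp
        thus ?thesis using that by simp
      qed
      have "contour_integral (linepath (of_real tA * x0) (of_real 1000 * x0)) (kern m N) / (pi * \<i>)
          = of_nat N powi m / of_nat N * exp (of_nat N * phase x0) * A N"
        unfolding kern_ray_int[OF elim(2)] alg[OF e s(2)] A_def s(1) by (simp only: of_real_mult)
      hence "norm (contour_integral (linepath (of_real tA * x0) (of_real 1000 * x0)) (kern m N) / (pi * \<i>)
          - (of_nat N powi m) / of_nat N * exp (of_nat N * phase x0) * (\<Sum>j<r. d j / of_nat N ^ j))
        = norm (of_nat N powi m / of_nat N * exp (of_nat N * phase x0)) * norm (A N - (\<Sum>j<r. d j / of_nat N ^ j))"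
        by (simp only: right_diff_distrib[symmetric] norm_mult)
      also have "\<dots> \<le> norm (of_nat N powi m / of_nat N * exp (of_nat N * phase x0)) * (C / real N ^ r)"
        by (intro mult_left_mono elim(1)) simp
      finally show ?case .
    qed
    thus "\<exists>C. \<forall>\<^sub>F N in parity_filter a.
       norm (contour_integral (linepath (of_real tA * x0) (of_real 1000 * x0)) (kern m N) / (pi * \<i>)
          - (of_nat N powi m) / of_nat N * exp (of_nat N * phase x0) * (\<Sum>j<r. d j / of_nat N ^ j))
       \<le> norm (of_nat N powi m / of_nat N * exp (of_nat N * phase x0)) * (C / real N ^ r)" ..
  qed (rule d(1))
qed

text \<open>The real part of the expansion meets the error of the joining pieces, which is
  exponentially smaller and so fits below every power of \<open>1/N\<close>.\<close>

lemma A_coeff_expansion: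
  assumes a: "a \<in> {0, 1}"
  obtains d where "d 0 = lead m a"
    "\<forall>r. \<exists>C. \<forall>\<^sub>F N in parity_filter a.
       norm (A_coeff m (-1) N - of_real (Re (exp (- (of_nat N / 2) * Ln w0) / of_real (real N powr (1 - of_int m)) * (\<Sum>j<r. d j / of_nat N ^ j))))
       \<le> C * (cmod w0 powr (- real N / 2) / real N powr (real r + 1 - of_int m))"
proof -
  let ?I = "\<lambda>N. contour_integral (linepath (of_real tA * x0) (of_real 1000 * x0)) (kern m N) / (pi * \<i>)"
  obtain d where d: "d 0 = lead m a"
    "\<forall>r. \<exists>C. \<forall>\<^sub>F N in parity_filter a.
       norm (?I N - (of_nat N powi m) / of_nat N * exp (of_nat N * phase x0) * (\<Sum>j<r. d j / of_nat N ^ j))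
       \<le> norm (of_nat N powi m / of_nat N * exp (of_nat N * phase x0)) * (C / real N ^ r)"
    by (rule main_integral_expansion[OF a, where m = m])
  obtain C1 where C1: "C1 \<ge> 0" "\<forall>\<^sub>F N in parity_filter a. norm (A_coeff m (-1) N - of_real (Re (?I N))) \<le> C1 * real N ^ nat \<bar>m\<bar> * exp (real N * (1 / 30))"
    by (rule A_coeff_main_integral[where m = m and a = a])
  have ev: "\<forall>\<^sub>F N in parity_filter a. N \<ge> 1"
    unfolding eventually_parity_filter using eventually_ge_at_top[of 1] by eventually_elim simp
  \<comment> \<open>Positive only by the margin 0.0334 against 0.03334; this is the place where the
    numerical estimates are consumed.\<close>
  define \<eta> where "\<eta> = lam / 2 - 1 / 30"
  have \<eta>: "\<eta> > 0" using lam_bound by (simp add: \<eta>_def)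
  show ?thesis
  proof (rule that[of d]; (intro allI)?)
    fix r
    \<comment> \<open>The exponent collects the power of \<open>N\<close> in the crude bound and an
      integer upper bound for \<open>r + 1 - m\<close>, so that one exponential beats both.\<close>
    define k where "k = nat \<bar>m\<bar> + (r + 1 + nat \<bar>m\<bar>)"
    have ev2: "\<forall>\<^sub>F N in parity_filter a. real N ^ k * exp (- \<eta> * real N) \<le> 1"
      unfolding eventually_parity_filter using eventually_power_exp_le[OF \<eta>, of k] by eventually_elim simp
    obtain C where C: "\<forall>\<^sub>F N in parity_filter a.
       norm (?I N - (of_nat N powi m) / of_nat N * exp (of_nat N * phase x0) * (\<Sum>j<r. d j / of_nat N ^ j))
       \<le> norm (of_nat N powi m / of_nat N * exp (of_nat N * phase x0)) * (C / real N ^ r)"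
      using d(2)[rule_format, of r] by (elim exE)
    have "\<forall>\<^sub>F N in parity_filter a.
       norm (A_coeff m (-1) N - of_real (Re (exp (- (of_nat N / 2) * Ln w0) / of_real (real N powr (1 - of_int m)) * (\<Sum>j<r. d j / of_nat N ^ j))))
       \<le> (C1 + C) * (cmod w0 powr (- real N / 2) / real N powr (real r + 1 - of_int m))"
      using C C1(2) ev ev2
    proof eventually_elim
      case (elim N)
      let ?n = "real N" and ?S = "\<Sum>j<r. d j / of_nat N ^ j"
      have n: "?n > 0" "?n \<ge> 1" using elim(3) by auto
      define W where "W = cmod w0 powr (- real N / 2)"
      have W: "W = exp (?n * lam / 2)" using one_minus_w0 by (simp add: W_def powr_def lam_def)
      define M where "M = of_nat N powi m / of_nat N * exp (of_nat N * phase x0)"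
      have P: "of_nat N powi m = complex_of_real (?n powr of_int m)"
        using n by (simp add: powr_real_of_int' of_real_power_int)
      have M: "M = exp (- (of_nat N / 2) * Ln w0) / of_real (?n powr (1 - of_int m))"
        using n by (simp add: M_def P phase_x0 powr_diff)
      have nM: "norm M * (C / ?n ^ r) = C * (W / ?n powr (real r + 1 - of_int m))"
      proof -
        have "norm M = W / ?n powr (1 - of_int m)"
          unfolding M using one_minus_w0 by (simp add: norm_divide W lam_def)
        moreover have "?n powr (real r + 1 - of_int m) = ?n powr (1 - of_int m) * ?n ^ r"
          using n by (simp add: powr_realpow[symmetric] powr_add[symmetric] algebra_simps)
        ultimately show ?thesis by simp
      qed
      have crude: "?n ^ nat \<bar>m\<bar> * exp (?n * (1 / 30)) \<le> W / ?n powr (real r + 1 - of_int m)"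
      proof -
        have ee: "exp (?n * (1 / 30)) = exp (- \<eta> * ?n) * W"
        proof -
          have "?n * (1 / 30) = - \<eta> * ?n + ?n * lam / 2" by (simp add: \<eta>_def field_simps)
          thus ?thesis unfolding W by (simp only: exp_add)
        qed
        have "?n powr (real r + 1 - of_int m) \<le> ?n powr real (r + 1 + nat \<bar>m\<bar>)"
          using n by (intro powr_mono) auto
        also have "\<dots> = ?n ^ (r + 1 + nat \<bar>m\<bar>)" using n(1) by (rule powr_realpow)
        finally have "?n ^ nat \<bar>m\<bar> * exp (?n * (1 / 30)) * ?n powr (real r + 1 - of_int m)
            \<le> ?n ^ nat \<bar>m\<bar> * exp (?n * (1 / 30)) * ?n ^ (r + 1 + nat \<bar>m\<bar>)"
          by (intro mult_left_mono) auto
        also have "\<dots> = ?n ^ k * exp (?n * (1 / 30))" unfolding k_def power_add by (simp only: mult_ac)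
        also have "\<dots> = (?n ^ k * exp (- \<eta> * ?n)) * W" unfolding ee by (simp only: mult_ac)
        also have "\<dots> \<le> 1 * W" by (intro mult_right_mono elim(4)) (simp add: W)
        finally show ?thesis using n by (simp add: pos_le_divide_eq)
      qed
      have "norm (A_coeff m (-1) N - of_real (Re (M * ?S)))
          \<le> norm (A_coeff m (-1) N - of_real (Re (?I N))) + norm (complex_of_real (Re (?I N)) - of_real (Re (M * ?S)))"
        unfolding dist_norm[symmetric] by (rule dist_triangle)
      also have "norm (complex_of_real (Re (?I N)) - of_real (Re (M * ?S))) \<le> norm (?I N - M * ?S)"
        using abs_Re_le_cmod[of "?I N - M * ?S"] by (simp only: of_real_diff[symmetric] norm_of_real minus_complex.simps)
      also have "\<dots> \<le> C * (W / ?n powr (real r + 1 - of_int m))" using elim(1) unfolding M_def[symmetric] nM .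
      also have "norm (A_coeff m (-1) N - of_real (Re (?I N))) \<le> C1 * (W / ?n powr (real r + 1 - of_int m))"
        using order_trans[OF elim(2)[unfolded mult.assoc] mult_left_mono[OF crude C1(1)]] .
      finally show ?case unfolding M W_def by (simp only: distrib_right)
    qed
    thus "\<exists>C. \<forall>\<^sub>F N in parity_filter a.
       norm (A_coeff m (-1) N - of_real (Re (exp (- (of_nat N / 2) * Ln w0) / of_real (real N powr (1 - of_int m)) * (\<Sum>j<r. d j / of_nat N ^ j))))
       \<le> C * (cmod w0 powr (- real N / 2) / real N powr (real r + 1 - of_int m))" ..
  qed (rule d(1))
qed

end

theorem theorem1p2:
  fixes m :: int and w0 z0 :: complex
  assumes w0_eq: "Li2 w0 - 2 * pi * \<i> * Ln w0 = 0"
    and w0_approx: "cmod (w0 - Complex 0.91619782 (-0.18245890)) < 0.0000001"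
    and z0_def: "z0 = 2 * pi * \<i> + Ln (1 - w0)"
  shows "\<exists>d :: nat \<Rightarrow> nat \<Rightarrow> complex.
     (\<forall>a\<in>{0,1}. d 0 a = - (of_real (sqrt 2) / (of_real pi * \<i>)) * ((-2) / z0) powi m
                          * exp (- z0 / 2) * csqrt (1 + (-1) ^ a * exp (z0 / 2))) \<and>
     (\<forall>r::nat. r \<ge> 1 \<longrightarrow> (\<exists>C::real. \<forall>N::nat. N \<ge> 1 \<longrightarrow>
        cmod (A_coeff m (-1) N
              - of_real (Re (exp (- (of_nat N / 2) * Ln w0) / of_real (real N powr (1 - of_int m))
                   * (\<Sum>j<r. d j (N mod 2) / of_nat N ^ j))))
        \<le> C * cmod w0 powr (- real N / 2) / real N powr (real r + 1 - of_int m)))"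
proof -
  interpret dilog_zero w0 z0 by unfold_locales (fact assms)+
  define B where "B r N = cmod w0 powr (- real N / 2) / real N powr (real r + 1 - of_int m)" for r N
  define err where "err d r N = cmod (A_coeff m (-1) N
              - of_real (Re (exp (- (of_nat N / 2) * Ln w0) / of_real (real N powr (1 - of_int m))
                   * (\<Sum>j<r. d j / of_nat N ^ j))))" for d r N
  have Bpos: "B r N > 0" if "N \<ge> 1" for r N
    using that one_minus_w0 by (simp add: B_def)
  obtain d0 where d0: "d0 0 = lead m 0" "\<forall>r. \<exists>C. \<forall>\<^sub>F N in parity_filter 0. err d0 r N \<le> C * B r N"
    unfolding B_def err_def by (rule A_coeff_expansion[of 0 m]) simp
  obtain d1 where d1: "d1 0 = lead m 1" "\<forall>r. \<exists>C. \<forall>\<^sub>F N in parity_filter 1. err d1 r N \<le> C * B r N"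
    unfolding B_def err_def by (rule A_coeff_expansion[of 1 m]) simp
  define d where "d j a = (if a = (0::nat) then d0 j else d1 j)" for j a
  have "\<exists>C. \<forall>N\<ge>1. err (\<lambda>j. d j (N mod 2)) r N \<le> C * B r N" for r
  proof -
    obtain C0 where C0: "\<forall>\<^sub>F N in parity_filter 0. err d0 r N \<le> C0 * B r N" using d0(2) by blast
    obtain C1 where C1: "\<forall>\<^sub>F N in parity_filter 1. err d1 r N \<le> C1 * B r N" using d1(2) by blast
    have le: "err e r N \<le> max C0 C1 * B r N" if "N \<ge> 1" "err e r N \<le> C * B r N" "C \<le> max C0 C1" for e N C
      using that(2) mult_right_mono[OF that(3) less_imp_le[OF Bpos[OF that(1)]]] by (rule order_trans)
    \<comment> \<open>Each class has its own constant; the larger one serves all large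
      \<open>N\<close>, and the finitely many small \<open>N\<close> are absorbed
      afterwards.\<close>
    have "\<forall>\<^sub>F N in sequentially. err (\<lambda>j. d j (N mod 2)) r N \<le> max C0 C1 * B r N"
    proof (rule eventually_sequentially_parity)
      show "\<forall>\<^sub>F N in parity_filter 0. err (\<lambda>j. d j (N mod 2)) r N \<le> max C0 C1 * B r N"
        using C0 eventually_ge_at_top[of 1] unfolding eventually_parity_filter
        by eventually_elim (auto simp: d_def intro: le[where C = C0])
      show "\<forall>\<^sub>F N in parity_filter 1. err (\<lambda>j. d j (N mod 2)) r N \<le> max C0 C1 * B r N"
        using C1 eventually_ge_at_top[of 1] unfolding eventually_parity_filter
        by eventually_elim (auto simp: d_def intro: le[where C = C1])
    qed
    thus ?thesis by (rule eventually_bound_imp_all) (rule Bpos)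
  qed
  hence bound: "\<forall>r. \<exists>C. \<forall>N\<ge>1. err (\<lambda>j. d j (N mod 2)) r N \<le> C * B r N" by blast
  show ?thesis
  proof (intro exI[of _ d] conjI allI impI ballI)
    fix a :: nat assume "a \<in> {0, 1}"
    thus "d 0 a = - (of_real (sqrt 2) / (of_real pi * \<i>)) * ((-2) / z0) powi m
                          * exp (- z0 / 2) * csqrt (1 + (-1) ^ a * exp (z0 / 2))"
      using d0(1) d1(1) unfolding d_def lead_def by auto
  next
    fix r :: nat
    obtain C where "\<forall>N\<ge>1. err (\<lambda>j. d j (N mod 2)) r N \<le> C * B r N" using bound by blast
    thus "\<exists>C. \<forall>N\<ge>1. cmod (A_coeff m (-1) N
              - of_real (Re (exp (- (of_nat N / 2) * Ln w0) / of_real (real N powr (1 - of_int m))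
                   * (\<Sum>j<r. d j (N mod 2) / of_nat N ^ j))))
        \<le> C * cmod w0 powr (- real N / 2) / real N powr (real r + 1 - of_int m)"
      unfolding err_def B_def times_divide_eq_right by (rule exI)
  qed
qed

end
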